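(* Let $M$ be an invariant submanifold of a generalized Sasakian-space-form $\overline{M}^{2n+1}(f_1,f_2,f_3)$ such that $f_1\neq f_3$ and $r\neq 2n(2n+1)(f_1-f_3)$ at every point, where $r$ is the scalar curvature of $M$. Then $M$ is totally geodesic if and only if $M$ is concircularly $2$-semiparallel.
   Context: An almost contact metric manifold $(\overline M,\phi,\xi,\eta,g)$ is a Riemannian manifold $(\overline M,g)$ with a $(1,1)$-tensor field $\phi$, a vector field $\xi$ and a $1$-form $\eta$ such that $\phi^2X=-X+\eta(X)\xi$, $\phi\xi=0$, $\eta(\xi)=1$, $g(X,\xi)=\eta(X)$, $\eta(\phi X)=0$, $g(\phi X,\phi Y)=g(X,Y)-\eta(X)\eta(Y)$. Curvature convention: $R(X,Y)=[\nabla_X,\nabla_Y]-\nabla_{[X,Y]}$. A generalized Sasakian-space-form $\overline M^{2n+1}(f_1,f_2,f_3)$ is an almost contact metric manifold of dimension $2n+1$, $n>1$, with smooth functions $f_1,f_2,f_3$ on $\overline M$ such that the curvature tensor $\overline R$ of its Levi-Civita connection $\overline\nabla$ satisfies $\overline R(X,Y)Z=f_1\{g(Y,Z)X-g(X,Z)Y\}+f_2\{g(X,\phi Z)\phi Y-g(Y,\phi Z)\phi X+2g(X,\phi Y)\phi Z\}+f_3\{\eta(X)\eta(Z)Y-\eta(Y)\eta(Z)X+g(X,Z)\eta(Y)\xi-g(Y,Z)\eta(X)\xi\}.$ Throughout, the following structure equations also hold on $\overline M$: $(\overline\nabla_X\phi)(Y)=(f_1-f_3)[g(X,Y)\xi-\eta(Y)X]$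 and $\overline\nabla_X\xi=-(f_1-f_3)\phi X$. A submanifold $M$ of $\overline M$ is invariant if $\xi$ is tangent to $M$ and $\phi(TM)\subset TM$ at every point of $M$. $M$ carries the induced metric and Levi-Civita connection $\nabla$ with curvature tensor $R$, the normal connection $\nabla^\perp$ with curvature $R^\perp(X,Y)=[\nabla^\perp_X,\nabla^\perp_Y]-\nabla^\perp_{[X,Y]}$, and the second fundamental form $h$, with $\overline\nabla_XY=\nabla_XY+h(X,Y)$. $M$ is totally geodesic if $h=0$. Write $(\overline\nabla h)(Z,U,W)=(\overline\nabla_Zh)(U,W)=\nabla^\perp_Z(h(U,W))-h(\nabla_ZU,W)-h(U,\nabla_ZW)$. The concircular curvature tensor of $M$ is $C(X,Y)Z=R(X,Y)Z-\frac{r}{2n(2n+1)}[g(Y,Z)X-g(X,Z)Y]$. $M$ is concircularly $2$-semiparallel if, for all $X,Y,Z,U,W$ tangent to $M$, $(\overline C(X,Y)\cdot\overline\nabla h)(Z,U,W):=R^\perp(X,Y)(\overline\nabla h)(Z,U,W)-(\overline\nabla h)(C(X,Y)Z,U,W)-(\overline\nabla h)(Z,C(X,Y)U,W)-(\overline\nabla h)(Z,U,C(X,Y)W)=0$. *)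

theory Defs
  imports "HOL-Analysis.Analysis" "HOL-Library.Function_Algebras"
begin

primrec differentiable_order_on ::
    "nat \<Rightarrow> 'e::euclidean_space set \<Rightarrow> ('e \<Rightarrow> 'f::real_normed_vector) \<Rightarrow> bool" where
  "differentiable_order_on 0 S f \<longleftrightarrow> continuous_on S f"
| "differentiable_order_on (Suc k) S f \<longleftrightarrow>
     (\<forall>x\<in>S. f differentiable (at x)) \<and>
     (\<forall>v. differentiable_order_on k S (\<lambda>x. frechet_derivative f (at x) v))"

text \<open>Only used for open \<open>S\<close>.\<close>

definition smooth_on :: "'e::euclidean_space set \<Rightarrow> ('e \<Rightarrow> 'f::real_normed_vector) \<Rightarrow> bool" where
  "smooth_on S f \<longleftrightarrow> (\<forall>k. differentiable_order_on k S f)"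

text \<open>A manifold is a whole (Hausdorff, second countable) type together with an atlas. The
  dimension of the manifold is that of the model space \<open>'e\<close>. The atlas need not be maximal.\<close>

type_synonym ('a, 'e) atlas = "('a set \<times> ('a \<Rightarrow> 'e)) set"

definition smooth_manifold ::
    "('a::{t2_space, second_countable_topology}, 'e::euclidean_space) atlas \<Rightarrow> bool" where
  "smooth_manifold A \<longleftrightarrow>
     (\<Union>(U, c)\<in>A. U) = UNIV \<and>
     (\<forall>(U, c)\<in>A. open U \<and> open (c ` U) \<and> homeomorphism U (c ` U) c (inv_into U c)) \<and>
     (\<forall>(U, c)\<in>A. \<forall>(V, d)\<in>A. smooth_on (c ` (U \<inter> V)) (d \<circ> inv_into U c))"

definition smooth_functions :: "('a, 'e::euclidean_space) atlas \<Rightarrow> ('a \<Rightarrow> real) set" where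
  "smooth_functions A = {f. \<forall>(U, c)\<in>A. smooth_on (c ` U) (f \<circ> inv_into U c)}"

definition smooth_map ::
    "('b::topological_space, 'k::euclidean_space) atlas \<Rightarrow>
     ('a::topological_space, 'e::euclidean_space) atlas \<Rightarrow> ('b \<Rightarrow> 'a) \<Rightarrow> bool" where
  "smooth_map A B \<iota> \<longleftrightarrow> continuous_on UNIV \<iota> \<and>
     (\<forall>(U, c)\<in>A. \<forall>(V, d)\<in>B. smooth_on (c ` (U \<inter> \<iota> -` V)) (d \<circ> \<iota> \<circ> inv_into U c))"

text \<open>A tangent vector is the directional derivative it induces on smooth functions. It is extended
  by 0 to non-smooth functions, so that it is determined by its action on smooth ones. Sums,
  differences and zero of tangent vectors and of fields are the pointwise ones.\<close>

type_synonym 'a tvec = "('a \<Rightarrow> real) \<Rightarrow> real"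
type_synonym 'a field = "'a \<Rightarrow> 'a tvec"

definition tangent_space :: "('a, 'e::euclidean_space) atlas \<Rightarrow> 'a \<Rightarrow> 'a tvec set" where
  "tangent_space A p =
     {v. \<exists>(U, c)\<in>A. p \<in> U \<and> (\<exists>w. v =
        (\<lambda>f. if f \<in> smooth_functions A
             then frechet_derivative (f \<circ> inv_into U c) (at (c p)) w else 0))}"

definition tscale :: "real \<Rightarrow> 'a tvec \<Rightarrow> 'a tvec" (infixr "*\<^sub>T" 75) where
  "a *\<^sub>T v = (\<lambda>f. a * v f)"

definition fscale :: "('b \<Rightarrow> real) \<Rightarrow> ('b \<Rightarrow> 'a tvec) \<Rightarrow> 'b \<Rightarrow> 'a tvec" (infixr "*\<^sub>F" 75) where
  "a *\<^sub>F V = (\<lambda>p. a p *\<^sub>T V p)"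

text \<open>Smooth sections of the pullback of the tangent bundle under \<open>\<iota>\<close>; vector fields are the case
  of the identity map.\<close>

definition fields_along ::
    "('b, 'k::euclidean_space) atlas \<Rightarrow> ('a, 'e::euclidean_space) atlas \<Rightarrow> ('b \<Rightarrow> 'a) \<Rightarrow>
     ('b \<Rightarrow> 'a tvec) set" where
  "fields_along A B \<iota> =
     {V. (\<forall>p. V p \<in> tangent_space B (\<iota> p)) \<and>
         (\<forall>f\<in>smooth_functions B. (\<lambda>p. V p f) \<in> smooth_functions A)}"

definition vector_fields :: "('a, 'e::euclidean_space) atlas \<Rightarrow> 'a field set" where
  "vector_fields A = fields_along A A id"

definition lie_bracket :: "'a field \<Rightarrow> 'a field \<Rightarrow> 'a field" where
  "lie_bracket X Y = (\<lambda>p f. X p (\<lambda>q. Y q f) - Y p (\<lambda>q. X q f))"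

definition pushforward ::
    "('a, 'e::euclidean_space) atlas \<Rightarrow> ('b \<Rightarrow> 'a) \<Rightarrow> 'b tvec \<Rightarrow> 'a tvec" where
  "pushforward B \<iota> v = (\<lambda>f. if f \<in> smooth_functions B then v (f \<circ> \<iota>) else 0)"

type_synonym 'a metric = "'a \<Rightarrow> 'a tvec \<Rightarrow> 'a tvec \<Rightarrow> real"

definition riemannian_metric :: "('a, 'e::euclidean_space) atlas \<Rightarrow> 'a metric \<Rightarrow> bool" where
  "riemannian_metric A g \<longleftrightarrow>
     (\<forall>p. \<forall>u\<in>tangent_space A p. \<forall>v\<in>tangent_space A p.
        g p u v = g p v u \<and>
        (\<forall>w\<in>tangent_space A p. g p (u + w) v = g p u v + g p w v) \<and>
        (\<forall>a. g p (a *\<^sub>T u) v = a * g p u v) \<and>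
        (u \<noteq> 0 \<longrightarrow> g p u u > 0)) \<and>
     (\<forall>X\<in>vector_fields A. \<forall>Y\<in>vector_fields A. (\<lambda>p. g p (X p) (Y p)) \<in> smooth_functions A)"

text \<open>A connection (covariant derivative) in a vector bundle over the manifold \<open>A\<close>, where \<open>\<Gamma>\<close> is the
  set of smooth sections of the bundle.\<close>

definition connection_on ::
    "('b, 'k::euclidean_space) atlas \<Rightarrow> ('b \<Rightarrow> 'a tvec) set \<Rightarrow>
     ('b field \<Rightarrow> ('b \<Rightarrow> 'a tvec) \<Rightarrow> ('b \<Rightarrow> 'a tvec)) \<Rightarrow> bool" where
  "connection_on A \<Gamma> D \<longleftrightarrow>
     (\<forall>X\<in>vector_fields A. \<forall>V\<in>\<Gamma>.
        D X V \<in> \<Gamma> \<and>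
        (\<forall>Y\<in>vector_fields A. D (X + Y) V = D X V + D Y V) \<and>
        (\<forall>W\<in>\<Gamma>. D X (V + W) = D X V + D X W) \<and>
        (\<forall>a\<in>smooth_functions A.
           D (a *\<^sub>F X) V = a *\<^sub>F D X V \<and>
           D X (a *\<^sub>F V) = (\<lambda>p. X p a) *\<^sub>F V + a *\<^sub>F D X V))"

definition levi_civita ::
    "('a, 'e::euclidean_space) atlas \<Rightarrow> 'a metric \<Rightarrow> ('a field \<Rightarrow> 'a field \<Rightarrow> 'a field) \<Rightarrow> bool" where
  "levi_civita A g nabla \<longleftrightarrow>
     connection_on A (vector_fields A) nabla \<and>
     (\<forall>X\<in>vector_fields A. \<forall>Y\<in>vector_fields A. nabla X Y - nabla Y X = lie_bracket X Y) \<and>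
     (\<forall>X\<in>vector_fields A. \<forall>Y\<in>vector_fields A. \<forall>Z\<in>vector_fields A. \<forall>p.
        X p (\<lambda>q. g q (Y q) (Z q)) = g p (nabla X Y p) (Z p) + g p (Y p) (nabla X Z p))"

text \<open>The curvature of a connection in an arbitrary bundle; it yields the curvature tensors of both
  Levi-Civita connections as well as that of the normal connection.\<close>

definition curvature ::
    "('b field \<Rightarrow> ('b \<Rightarrow> 'a tvec) \<Rightarrow> ('b \<Rightarrow> 'a tvec)) \<Rightarrow>
     'b field \<Rightarrow> 'b field \<Rightarrow> ('b \<Rightarrow> 'a tvec) \<Rightarrow> ('b \<Rightarrow> 'a tvec)" where
  "curvature D X Y V = D X (D Y V) - D Y (D X V) - D (lie_bracket X Y) V"

text \<open>The set \<open>Basis\<close> of the model space serves as an index set with as many elements as the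
  dimension of the manifold. The fields are only required to be orthonormal at the point \<open>p\<close>.\<close>

definition orthonormal_at ::
    "('a, 'e::euclidean_space) atlas \<Rightarrow> 'a metric \<Rightarrow> 'a \<Rightarrow> ('e \<Rightarrow> 'a field) \<Rightarrow> bool" where
  "orthonormal_at A g p E \<longleftrightarrow>
     (\<forall>i\<in>Basis. E i \<in> vector_fields A) \<and>
     (\<forall>i\<in>Basis. \<forall>j\<in>Basis. g p (E i p) (E j p) = (if i = j then 1 else 0))"

text \<open>Full trace of the curvature tensor; the value does not depend on the chosen frame. The sign is
  such that round spheres have positive scalar curvature.\<close>

definition scalar_curvature ::
    "('a, 'e::euclidean_space) atlas \<Rightarrow> 'a metric \<Rightarrow> ('a field \<Rightarrow> 'a field \<Rightarrow> 'a field) \<Rightarrow>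
     'a \<Rightarrow> real" where
  "scalar_curvature A g nabla p =
     (let E = (SOME E. orthonormal_at A g p E) in
        \<Sum>i\<in>Basis. \<Sum>j\<in>Basis. g p (curvature nabla (E i) (E j) (E j) p) (E i p))"

definition almost_contact_metric ::
    "('a, 'e::euclidean_space) atlas \<Rightarrow> ('a \<Rightarrow> 'a tvec \<Rightarrow> 'a tvec) \<Rightarrow> 'a field \<Rightarrow>
     ('a \<Rightarrow> 'a tvec \<Rightarrow> real) \<Rightarrow> 'a metric \<Rightarrow> bool" where
  "almost_contact_metric A \<phi> \<xi> \<eta> g \<longleftrightarrow>
     riemannian_metric A g \<and>
     \<xi> \<in> vector_fields A \<and>
     (\<forall>X\<in>vector_fields A.
        (\<lambda>p. \<phi> p (X p)) \<in> vector_fields A \<and> (\<lambda>p. \<eta> p (X p)) \<in> smooth_functions A) \<and>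
     (\<forall>p. \<forall>u\<in>tangent_space A p. \<forall>v\<in>tangent_space A p. \<forall>a.
        \<phi> p u \<in> tangent_space A p \<and>
        \<phi> p (u + v) = \<phi> p u + \<phi> p v \<and> \<phi> p (a *\<^sub>T u) = a *\<^sub>T \<phi> p u \<and>
        \<eta> p (u + v) = \<eta> p u + \<eta> p v \<and> \<eta> p (a *\<^sub>T u) = a * \<eta> p u) \<and>
     (\<forall>p. \<phi> p (\<xi> p) = 0 \<and> \<eta> p (\<xi> p) = 1 \<and>
        (\<forall>u\<in>tangent_space A p.
           \<phi> p (\<phi> p u) = \<eta> p u *\<^sub>T \<xi> p - u \<and>
           g p u (\<xi> p) = \<eta> p u \<and>
           \<eta> p (\<phi> p u) = 0 \<and>
           (\<forall>v\<in>tangent_space A p. g p (\<phi> p u) (\<phi> p v) = g p u v - \<eta> p u * \<eta> p v)))"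

definition generalized_sasakian_space_form ::
    "nat \<Rightarrow> ('a::{t2_space, second_countable_topology}, 'e::euclidean_space) atlas \<Rightarrow>
     ('a \<Rightarrow> 'a tvec \<Rightarrow> 'a tvec) \<Rightarrow> 'a field \<Rightarrow> ('a \<Rightarrow> 'a tvec \<Rightarrow> real) \<Rightarrow> 'a metric \<Rightarrow>
     ('a field \<Rightarrow> 'a field \<Rightarrow> 'a field) \<Rightarrow>
     ('a \<Rightarrow> real) \<Rightarrow> ('a \<Rightarrow> real) \<Rightarrow> ('a \<Rightarrow> real) \<Rightarrow> bool" where
  "generalized_sasakian_space_form n A \<phi> \<xi> \<eta> g nabla f\<^sub>1 f\<^sub>2 f\<^sub>3 \<longleftrightarrow>
     n > 1 \<and> DIM('e) = 2 * n + 1 \<and>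
     smooth_manifold A \<and>
     almost_contact_metric A \<phi> \<xi> \<eta> g \<and>
     levi_civita A g nabla \<and>
     f\<^sub>1 \<in> smooth_functions A \<and> f\<^sub>2 \<in> smooth_functions A \<and> f\<^sub>3 \<in> smooth_functions A \<and>
     (\<forall>X\<in>vector_fields A. \<forall>Y\<in>vector_fields A. \<forall>Z\<in>vector_fields A. \<forall>p.
        curvature nabla X Y Z p =
          f\<^sub>1 p *\<^sub>T (g p (Y p) (Z p) *\<^sub>T X p - g p (X p) (Z p) *\<^sub>T Y p) +
          f\<^sub>2 p *\<^sub>T (g p (X p) (\<phi> p (Z p)) *\<^sub>T \<phi> p (Y p) - g p (Y p) (\<phi> p (Z p)) *\<^sub>T \<phi> p (X p)
                    + (2 * g p (X p) (\<phi> p (Y p))) *\<^sub>T \<phi> p (Z p)) +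
          f\<^sub>3 p *\<^sub>T ((\<eta> p (X p) * \<eta> p (Z p)) *\<^sub>T Y p - (\<eta> p (Y p) * \<eta> p (Z p)) *\<^sub>T X p
                    + (g p (X p) (Z p) * \<eta> p (Y p)) *\<^sub>T \<xi> p
                    - (g p (Y p) (Z p) * \<eta> p (X p)) *\<^sub>T \<xi> p))"

definition structure_equations ::
    "('a, 'e::euclidean_space) atlas \<Rightarrow> ('a \<Rightarrow> 'a tvec \<Rightarrow> 'a tvec) \<Rightarrow> 'a field \<Rightarrow>
     ('a \<Rightarrow> 'a tvec \<Rightarrow> real) \<Rightarrow> 'a metric \<Rightarrow> ('a field \<Rightarrow> 'a field \<Rightarrow> 'a field) \<Rightarrow>
     ('a \<Rightarrow> real) \<Rightarrow> ('a \<Rightarrow> real) \<Rightarrow> bool" where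
  "structure_equations A \<phi> \<xi> \<eta> g nabla f\<^sub>1 f\<^sub>3 \<longleftrightarrow>
     (\<forall>X\<in>vector_fields A. \<forall>Y\<in>vector_fields A. \<forall>p.
        nabla X (\<lambda>q. \<phi> q (Y q)) p - \<phi> p (nabla X Y p) =
          (f\<^sub>1 p - f\<^sub>3 p) *\<^sub>T (g p (X p) (Y p) *\<^sub>T \<xi> p - \<eta> p (Y p) *\<^sub>T X p)) \<and>
     (\<forall>X\<in>vector_fields A. \<forall>p. nabla X \<xi> p = - ((f\<^sub>1 p - f\<^sub>3 p) *\<^sub>T \<phi> p (X p)))"

text \<open>A submanifold is given by an immersion \<open>\<iota>\<close>; embedded submanifolds are the case where \<open>\<iota>\<close> is an
  inclusion map. Its tangent space at \<open>p\<close>, as a subspace of the ambient tangent space at \<open>\<iota> p\<close>, is the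
  image of the differential of \<open>\<iota>\<close>.\<close>

definition immersed_submanifold ::
    "('b::{t2_space, second_countable_topology}, 'k::euclidean_space) atlas \<Rightarrow>
     ('a::{t2_space, second_countable_topology}, 'e::euclidean_space) atlas \<Rightarrow>
     ('b \<Rightarrow> 'a) \<Rightarrow> bool" where
  "immersed_submanifold A B \<iota> \<longleftrightarrow>
     smooth_manifold A \<and> smooth_map A B \<iota> \<and>
     (\<forall>p. inj_on (pushforward B \<iota>) (tangent_space A p))"

definition tangent_image ::
    "('b, 'k::euclidean_space) atlas \<Rightarrow> ('a, 'e::euclidean_space) atlas \<Rightarrow> ('b \<Rightarrow> 'a) \<Rightarrow>
     'b \<Rightarrow> 'a tvec set" where
  "tangent_image A B \<iota> p = pushforward B \<iota> ` tangent_space A p"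

definition invariant_submanifold ::
    "('b::{t2_space, second_countable_topology}, 'k::euclidean_space) atlas \<Rightarrow>
     ('a::{t2_space, second_countable_topology}, 'e::euclidean_space) atlas \<Rightarrow> ('b \<Rightarrow> 'a) \<Rightarrow>
     ('a \<Rightarrow> 'a tvec \<Rightarrow> 'a tvec) \<Rightarrow> 'a field \<Rightarrow> bool" where
  "invariant_submanifold A B \<iota> \<phi> \<xi> \<longleftrightarrow>
     immersed_submanifold A B \<iota> \<and>
     (\<forall>p. \<xi> (\<iota> p) \<in> tangent_image A B \<iota> p \<and>
          \<phi> (\<iota> p) ` tangent_image A B \<iota> p \<subseteq> tangent_image A B \<iota> p)"

definition induced_metric ::
    "('a, 'e::euclidean_space) atlas \<Rightarrow> ('b \<Rightarrow> 'a) \<Rightarrow> 'a metric \<Rightarrow> 'b metric" where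
  "induced_metric B \<iota> g = (\<lambda>p u v. g (\<iota> p) (pushforward B \<iota> u) (pushforward B \<iota> v))"

text \<open>The pullback connection \<open>D\<close> gives meaning to \<open>nablabar X V\<close> for \<open>X\<close> tangent to the submanifold and \<open>V\<close> an
  ambient field defined only along it: \<open>D\<close> is the unique connection in the pullback of the ambient
  tangent bundle that agrees with \<open>nablabar\<close> on restrictions of ambient fields.\<close>

definition pullback_connection ::
    "('b, 'k::euclidean_space) atlas \<Rightarrow> ('a, 'e::euclidean_space) atlas \<Rightarrow> ('b \<Rightarrow> 'a) \<Rightarrow>
     ('a field \<Rightarrow> 'a field \<Rightarrow> 'a field) \<Rightarrow>
     ('b field \<Rightarrow> ('b \<Rightarrow> 'a tvec) \<Rightarrow> ('b \<Rightarrow> 'a tvec)) \<Rightarrow> bool" where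
  "pullback_connection A B \<iota> nablabar D \<longleftrightarrow>
     connection_on A (fields_along A B \<iota>) D \<and>
     (\<forall>X\<in>vector_fields A. \<forall>X'\<in>vector_fields B. \<forall>Y'\<in>vector_fields B. \<forall>p.
        X' (\<iota> p) = pushforward B \<iota> (X p) \<longrightarrow> D X (Y' \<circ> \<iota>) p = nablabar X' Y' (\<iota> p))"

text \<open>Gauss formula \<open>nablabar X Y = nabla X Y + h X Y\<close>.\<close>

definition second_fundamental_form ::
    "('a, 'e::euclidean_space) atlas \<Rightarrow> ('b \<Rightarrow> 'a) \<Rightarrow> ('b field \<Rightarrow> 'b field \<Rightarrow> 'b field) \<Rightarrow>
     ('b field \<Rightarrow> ('b \<Rightarrow> 'a tvec) \<Rightarrow> ('b \<Rightarrow> 'a tvec)) \<Rightarrow> 'b field \<Rightarrow> 'b field \<Rightarrow> 'b \<Rightarrow> 'a tvec" where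
  "second_fundamental_form B \<iota> nabla D X Y =
     D X (\<lambda>p. pushforward B \<iota> (Y p)) - (\<lambda>p. pushforward B \<iota> (nabla X Y p))"

definition normal_part ::
    "('b, 'k::euclidean_space) atlas \<Rightarrow> ('a, 'e::euclidean_space) atlas \<Rightarrow> ('b \<Rightarrow> 'a) \<Rightarrow>
     'a metric \<Rightarrow> 'b \<Rightarrow> 'a tvec \<Rightarrow> 'a tvec" where
  "normal_part A B \<iota> g p v =
     (THE u. u \<in> tangent_space B (\<iota> p) \<and> v - u \<in> tangent_image A B \<iota> p \<and>
             (\<forall>t\<in>tangent_image A B \<iota> p. g (\<iota> p) u t = 0))"

definition normal_connection ::
    "('b, 'k::euclidean_space) atlas \<Rightarrow> ('a, 'e::euclidean_space) atlas \<Rightarrow> ('b \<Rightarrow> 'a) \<Rightarrow>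
     'a metric \<Rightarrow> ('b field \<Rightarrow> ('b \<Rightarrow> 'a tvec) \<Rightarrow> ('b \<Rightarrow> 'a tvec)) \<Rightarrow>
     'b field \<Rightarrow> ('b \<Rightarrow> 'a tvec) \<Rightarrow> 'b \<Rightarrow> 'a tvec" where
  "normal_connection A B \<iota> g D X N = (\<lambda>p. normal_part A B \<iota> g p (D X N p))"

definition totally_geodesic ::
    "('b, 'k::euclidean_space) atlas \<Rightarrow> ('b field \<Rightarrow> 'b field \<Rightarrow> 'b \<Rightarrow> 'a tvec) \<Rightarrow> bool" where
  "totally_geodesic A h \<longleftrightarrow> (\<forall>X\<in>vector_fields A. \<forall>Y\<in>vector_fields A. h X Y = 0)"

definition covariant_derivative_sff ::
    "('b field \<Rightarrow> ('b \<Rightarrow> 'a tvec) \<Rightarrow> ('b \<Rightarrow> 'a tvec)) \<Rightarrow> ('b field \<Rightarrow> 'b field \<Rightarrow> 'b field) \<Rightarrow>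
     ('b field \<Rightarrow> 'b field \<Rightarrow> 'b \<Rightarrow> 'a tvec) \<Rightarrow>
     'b field \<Rightarrow> 'b field \<Rightarrow> 'b field \<Rightarrow> 'b \<Rightarrow> 'a tvec" where
  "covariant_derivative_sff nabla_perp nabla h Z U W = nabla_perp Z (h U W) - h (nabla Z U) W - h U (nabla Z W)"

text \<open>Here \<open>n\<close> is the parameter of the ambient dimension \<open>2n+1\<close>, whereas the metric and the scalar
  curvature are those of the submanifold.\<close>

definition concircular_curvature ::
    "nat \<Rightarrow> ('b, 'k::euclidean_space) atlas \<Rightarrow> 'b metric \<Rightarrow> ('b field \<Rightarrow> 'b field \<Rightarrow> 'b field) \<Rightarrow>
     'b field \<Rightarrow> 'b field \<Rightarrow> 'b field \<Rightarrow> 'b field" where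
  "concircular_curvature n A g nabla X Y Z =
     curvature nabla X Y Z -
     (\<lambda>p. (scalar_curvature A g nabla p / (2 * real n * (2 * real n + 1))) *\<^sub>T
            (g p (Y p) (Z p) *\<^sub>T X p - g p (X p) (Z p) *\<^sub>T Y p))"

text \<open>\<open>C\<close> is a curvature-type tensor of the submanifold, \<open>nabla_perp\<close> the normal connection, and \<open>T\<close> the covariant
  derivative of the second fundamental form.\<close>

definition two_semiparallel ::
    "('b, 'k::euclidean_space) atlas \<Rightarrow> ('b field \<Rightarrow> 'b field \<Rightarrow> 'b field \<Rightarrow> 'b field) \<Rightarrow>
     ('b field \<Rightarrow> ('b \<Rightarrow> 'a tvec) \<Rightarrow> ('b \<Rightarrow> 'a tvec)) \<Rightarrow>
     ('b field \<Rightarrow> 'b field \<Rightarrow> 'b field \<Rightarrow> 'b \<Rightarrow> 'a tvec) \<Rightarrow> bool" where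
  "two_semiparallel A C nabla_perp T \<longleftrightarrow>
     (\<forall>X\<in>vector_fields A. \<forall>Y\<in>vector_fields A. \<forall>Z\<in>vector_fields A.
      \<forall>U\<in>vector_fields A. \<forall>W\<in>vector_fields A.
        curvature nabla_perp X Y (T Z U W) - T (C X Y Z) U W - T Z (C X Y U) W - T Z U (C X Y W) = 0)"

definition concircularly_two_semiparallel ::
    "nat \<Rightarrow> ('b, 'k::euclidean_space) atlas \<Rightarrow> ('a, 'e::euclidean_space) atlas \<Rightarrow> ('b \<Rightarrow> 'a) \<Rightarrow>
     'a metric \<Rightarrow> ('b field \<Rightarrow> 'b field \<Rightarrow> 'b field) \<Rightarrow>
     ('b field \<Rightarrow> ('b \<Rightarrow> 'a tvec) \<Rightarrow> ('b \<Rightarrow> 'a tvec)) \<Rightarrow> bool" where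
  "concircularly_two_semiparallel n A B \<iota> g nabla D \<longleftrightarrow>
     two_semiparallel A
       (concircular_curvature n A (induced_metric B \<iota> g) nabla)
       (normal_connection A B \<iota> g D)
       (covariant_derivative_sff (normal_connection A B \<iota> g D) nabla
          (second_fundamental_form B \<iota> nabla D))"

end

theory Submission
  imports Defs "HOL-Computational_Algebra.Polynomial"
begin

text \<open>Write \<open>c = f\<^sub>1 - f\<^sub>3\<close>. Computing \<open>R(X, \<xi>)\<xi>\<close> in the ambient manifold from the structure equations and
  comparing with the curvature formula forces \<open>c\<^sup>2 = c\<close>, hence \<open>c = 1\<close> along the submanifold. The pulled back
  connection is metric and torsion free, so the second fundamental form \<open>h\<close> is symmetric and normal;
  invariance then gives \<open>h X \<xi> = 0\<close>, \<open>nabla X \<xi> = - \<phi> X\<close> and \<open>R(X, \<xi>)\<xi> = X - \<eta>(X) \<xi>\<close> on the submanifold, without the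
  Gauss equation. Evaluated at \<open>(X, \<xi>)\<close> and \<open>(Z, \<xi>, \<xi>)\<close>, concircular 2-semiparallelity reduces to
  \<open>2 (1 - r / (2n(2n+1))) h (X - \<eta>(X) \<xi>) (\<phi> Z) = 0\<close>. The covariant derivative of \<open>h\<close> is only meaningful on smooth
  fields, so both directions need the scalar curvature \<open>r\<close> to be smooth; this follows from the existence of local
  orthonormal frames and the independence of the trace of the frame.\<close>

section \<open>Calculus of smooth functions\<close>

text \<open>The pullback connection \<open>D\<close> is known explicitly only on restrictions of
  ambient fields, while pushed-forward fields are merely smooth along \<open>\<iota>\<close>. This
  obstacle shapes the middle of the development: each identity for \<open>D\<close> is phrased as
  the vanishing of a defect that is linear over smooth functions; such a defect depends only on the
  value of the field at the point, and every tangent vector there extends to a global ambient field.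
  Tangent vectors act on globally defined functions, so coordinates and frames must be cut off by
  bump functions.

  Inserting \<open>\<xi>\<close> twice pays off on both sides: the ambient curvature formula then
  keeps only the combination \<open>f\<^sub>1 - f\<^sub>3\<close>, and the covariant derivative of
  \<open>h\<close> loses its normal derivative, which is taken of the zero section only. The factor
  2 counts the two places of \<open>(Z, \<xi>, \<xi>)\<close> into which
  \<open>C(X, \<xi>)\<xi>\<close> is inserted.\<close>

lemma differentiable_order_on_cong:
  assumes "open S" "\<And>x. x \<in> S \<Longrightarrow> f x = g x"
  shows "differentiable_order_on k S f \<longleftrightarrow> differentiable_order_on k S g"
  using assms(2)
proof (induction k arbitrary: f g)
  case 0
  then show ?case by (auto cong: continuous_on_cong)
next
  case (Suc k)
  have fd: "f differentiable (at x) \<longleftrightarrow> g differentiable (at x)" 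
    "frechet_derivative f (at x) = frechet_derivative g (at x)" if "x \<in> S" for x
  proof -
    have "(f has_derivative f') (at x) \<longleftrightarrow> (g has_derivative f') (at x)" for f'
      using has_derivative_transform_within_open[OF _ assms(1) that, of f f' UNIV g]
        has_derivative_transform_within_open[OF _ assms(1) that, of g f' UNIV f] Suc.prems by auto
    then show "f differentiable (at x) \<longleftrightarrow> g differentiable (at x)"
      "frechet_derivative f (at x) = frechet_derivative g (at x)"
      unfolding differentiable_def frechet_derivative_def by auto
  qed
  show ?case using fd Suc.IH[of "\<lambda>x. frechet_derivative f (at x) v" "\<lambda>x. frechet_derivative g (at x) v" for v]
    by auto
qed

lemma differentiable_order_on_subset:
  assumes "differentiable_order_on k S f" "T \<subseteq> S"
  shows "differentiable_order_on k T f"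
  using assms by (induction k arbitrary: f) (auto intro: continuous_on_subset)

lemma differentiable_order_on_local:
  assumes "\<And>x. x \<in> S \<Longrightarrow> \<exists>T. open T \<and> x \<in> T \<and> differentiable_order_on k T f"
  shows "differentiable_order_on k S f"
  using assms
proof (induction k arbitrary: f)
  case 0
  have "continuous (at x within S) f" if "x \<in> S" for x
    using 0[OF that] by (auto simp: continuous_on_eq_continuous_at intro: continuous_at_imp_continuous_within)
  then show ?case by (simp add: continuous_on_eq_continuous_within)
next
  case (Suc k)
  have "\<exists>T. open T \<and> x \<in> T \<and> differentiable_order_on k T (\<lambda>x. frechet_derivative f (at x) v)" 
    if "x \<in> S" for x v using Suc.prems[OF that] by auto
  moreover have "f differentiable (at x)" if "x \<in> S" for x
    using Suc.prems[OF that] by auto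
  ultimately show ?case using Suc.IH by auto
qed

lemma differentiable_order_on_imp_continuous_on: "differentiable_order_on k S f \<Longrightarrow> continuous_on S f"
  by (cases k) (auto intro!: continuous_at_imp_continuous_on differentiable_imp_continuous_within)

lemma differentiable_order_on_Suc_imp: "differentiable_order_on (Suc k) S f \<Longrightarrow> differentiable_order_on k S f"
proof (induction k arbitrary: f)
  case 0
  then show ?case by (metis differentiable_order_on_imp_continuous_on differentiable_order_on.simps(1))
next
  case (Suc k)
  then show ?case by (metis differentiable_order_on.simps(2))
qed

lemma differentiable_order_on_const: "differentiable_order_on k S (\<lambda>x. a)"
  by (induction k arbitrary: a) auto

lemma differentiable_order_on_linear:
  assumes "bounded_linear L"
  shows "differentiable_order_on k S L"
proof (cases k)
  case 0
  then show ?thesis using assms by (simp add: linear_continuous_on)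
next
  case (Suc m)
  have "frechet_derivative L (at x) = L" for x
    using bounded_linear_imp_has_derivative[OF assms] frechet_derivative_at by metis
  then show ?thesis unfolding Suc using assms bounded_linear_imp_differentiable
    by (auto intro: differentiable_order_on_const)
qed

text \<open>\<open>frechet_derivative\<close> is only a chosen derivative; on an open set any
  explicit formula may stand in for it. The calculus rules below run their inductions through this
  rule.\<close>

lemma differentiable_order_on_SucI:
  assumes "open S" "\<And>x. x \<in> S \<Longrightarrow> (f has_derivative f' x) (at x)"
    "\<And>v. differentiable_order_on k S (\<lambda>x. f' x v)"
  shows "differentiable_order_on (Suc k) S f"
proof -
  have "frechet_derivative f (at x) = f' x" if "x \<in> S" for x
    using assms(2)[OF that] frechet_derivative_at by metis
  then have "differentiable_order_on k S (\<lambda>x. frechet_derivative f (at x) v)" for v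
    using assms(3)[of v] differentiable_order_on_cong[OF assms(1), of "\<lambda>x. frechet_derivative f (at x) v" "\<lambda>x. f' x v"] by auto
  then show ?thesis using assms(2) by (auto simp: differentiable_def)
qed

lemma differentiable_order_on_SucD:
  assumes "differentiable_order_on (Suc k) S f" "x \<in> S"
  shows "(f has_derivative frechet_derivative f (at x)) (at x)"
  using assms frechet_derivative_works by auto

lemma differentiable_order_on_add:
  assumes "open S" "differentiable_order_on k S f" "differentiable_order_on k S g"
  shows "differentiable_order_on k S (\<lambda>x. f x + g x)"
  using assms(2,3)
proof (induction k arbitrary: f g)
  case 0
  then show ?case by (auto intro: continuous_on_add)
next
  case (Suc k)
  show ?case
  proof (rule differentiable_order_on_SucI[OF assms(1), where f' = "\<lambda>x v. frechet_derivative f (at x) v + frechet_derivative g (at x) v"])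
    fix x assume x: "x \<in> S"
    show "((\<lambda>x. f x + g x) has_derivative (\<lambda>v. frechet_derivative f (at x) v + frechet_derivative g (at x) v)) (at x)"
      by (intro has_derivative_add differentiable_order_on_SucD[OF Suc.prems(1) x] differentiable_order_on_SucD[OF Suc.prems(2) x])
  next
    fix v
    show "differentiable_order_on k S (\<lambda>x. frechet_derivative f (at x) v + frechet_derivative g (at x) v)"
      by (rule Suc.IH) (use Suc.prems in auto)
  qed
qed

text \<open>One product rule serves multiplication, scalar multiplication and the inner product
  alike.\<close>

lemma differentiable_order_on_bilinear:
  assumes "open S" "bounded_bilinear B" "differentiable_order_on k S f" "differentiable_order_on k S g"
  shows "differentiable_order_on k S (\<lambda>x. B (f x) (g x))"
  using assms(3,4)
proof (induction k arbitrary: f g)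
  case 0
  then show ?case using bounded_bilinear.continuous_on[OF assms(2)] by auto
next
  case (Suc k)
  show ?case
  proof (rule differentiable_order_on_SucI[OF assms(1), where f' = "\<lambda>x v. B (f x) (frechet_derivative g (at x) v) + B (frechet_derivative f (at x) v) (g x)"])
    fix x assume x: "x \<in> S"
    show "((\<lambda>x. B (f x) (g x)) has_derivative
      (\<lambda>v. B (f x) (frechet_derivative g (at x) v) + B (frechet_derivative f (at x) v) (g x))) (at x)"
      by (intro bounded_bilinear.FDERIV[OF assms(2)] differentiable_order_on_SucD[OF Suc.prems(1) x] differentiable_order_on_SucD[OF Suc.prems(2) x])
  next
    fix v
    show "differentiable_order_on k S (\<lambda>x. B (f x) (frechet_derivative g (at x) v) + B (frechet_derivative f (at x) v) (g x))"
      by (intro differentiable_order_on_add[OF assms(1)] Suc.IH differentiable_order_on_Suc_imp[OF Suc.prems(1)] differentiable_order_on_Suc_imp[OF Suc.prems(2)])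
        (use Suc.prems in auto)
  qed
qed

lemma differentiable_order_on_sum:
  assumes "open S" "\<And>i. i \<in> I \<Longrightarrow> differentiable_order_on k S (f i)"
  shows "differentiable_order_on k S (\<lambda>x. \<Sum>i\<in>I. f i x)"
  using assms(2) by (induction I rule: infinite_finite_induct) (auto intro: differentiable_order_on_const differentiable_order_on_add[OF assms(1)])

lemma differentiable_order_on_compose:
  fixes f :: "'e::euclidean_space \<Rightarrow> 'f::real_normed_vector" and g :: "'d::euclidean_space \<Rightarrow> 'e"
  assumes "open S" "open T" "differentiable_order_on k T f" "differentiable_order_on k S g" "g ` S \<subseteq> T"
  shows "differentiable_order_on k S (\<lambda>x. f (g x))"
  using assms(3,4)
proof (induction k arbitrary: f)
  case 0
  then show ?case using assms(5) by (auto intro: continuous_on_compose2)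
next
  case (Suc k)
  have gx: "g x \<in> T" if "x \<in> S" for x using that assms(5) by auto
  \<comment> \<open>The chain rule differentiates \<open>f\<close> in a direction that moves with
    \<open>x\<close>, whereas the induction hypothesis covers fixed directions; expanding in the
    basis separates the two.\<close>
  have e: "frechet_derivative f (at (g x)) w = (\<Sum>b\<in>Basis. (w \<bullet> b) *\<^sub>R frechet_derivative f (at (g x)) b)" 
    if "x \<in> S" for x w
  proof -
    have "linear (frechet_derivative f (at (g x)))"
      using differentiable_order_on_SucD[OF Suc.prems(1) gx[OF that]] has_derivative_linear by auto
    then have "frechet_derivative f (at (g x)) (\<Sum>b\<in>Basis. (w \<bullet> b) *\<^sub>R b) = (\<Sum>b\<in>Basis. (w \<bullet> b) *\<^sub>R frechet_derivative f (at (g x)) b)"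
      by (simp add: linear_sum linear_cmul)
    then show ?thesis by (simp add: euclidean_representation)
  qed
  show ?case
  proof (rule differentiable_order_on_SucI[OF assms(1), where f' = "\<lambda>x v. \<Sum>b\<in>Basis. (frechet_derivative g (at x) v \<bullet> b) *\<^sub>R frechet_derivative f (at (g x)) b"])
    fix x assume x: "x \<in> S"
    have "((\<lambda>x. f (g x)) has_derivative (\<lambda>v. frechet_derivative f (at (g x)) (frechet_derivative g (at x) v))) (at x)"
      by (rule has_derivative_compose[OF differentiable_order_on_SucD[OF Suc.prems(2) x]]) 
         (use differentiable_order_on_SucD[OF Suc.prems(1) gx[OF x]] in \<open>auto intro: has_derivative_at_withinI\<close>)
    then show "((\<lambda>x. f (g x)) has_derivative (\<lambda>v. \<Sum>b\<in>Basis. (frechet_derivative g (at x) v \<bullet> b) *\<^sub>R frechet_derivative f (at (g x)) b)) (at x)"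
      by (rule has_derivative_eq_rhs) (rule ext, rule e[OF x])
  next
    fix v
    have g: "differentiable_order_on k S (\<lambda>x. frechet_derivative g (at x) v)" using Suc.prems by auto
    have f: "differentiable_order_on k S (\<lambda>x. frechet_derivative f (at (g x)) b)" for b
      using Suc.IH[of "\<lambda>x. frechet_derivative f (at x) b"] Suc.prems(1) differentiable_order_on_Suc_imp[OF Suc.prems(2)] by simp
    show "differentiable_order_on k S (\<lambda>x. \<Sum>b\<in>Basis. (frechet_derivative g (at x) v \<bullet> b) *\<^sub>R frechet_derivative f (at (g x)) b)"
      by (intro differentiable_order_on_sum[OF assms(1)] differentiable_order_on_bilinear[OF assms(1) bounded_bilinear_scaleR] f
          differentiable_order_on_bilinear[OF assms(1) bounded_bilinear_inner] g differentiable_order_on_const)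
  qed
qed

text \<open>The derivative is a polynomial in \<open>inverse\<close> itself, so the product rule
  closes the induction.\<close>

lemma differentiable_order_on_inverse: "differentiable_order_on k (- {0}) (inverse :: real \<Rightarrow> real)"
proof (induction k)
  case 0
  then show ?case by (auto intro!: continuous_intros)
next
  case (Suc k)
  show ?case
    by (intro differentiable_order_on_SucI[where f' = "\<lambda>x v. - v * (inverse x * inverse x)"] Suc
        differentiable_order_on_bilinear[OF _ bounded_bilinear_mult] differentiable_order_on_const)
      (auto intro!: derivative_eq_intros ext simp: field_simps)
qed

lemma differentiable_order_on_sqrt: "differentiable_order_on k {0<..} sqrt"
proof (induction k)
  case 0
  then show ?case by (auto intro!: continuous_intros)
next
  case (Suc k)
  have "differentiable_order_on k {0<..} (\<lambda>x. inverse (sqrt x))"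
    by (rule differentiable_order_on_compose[OF _ _ differentiable_order_on_inverse Suc]) auto
  moreover have "(sqrt has_derivative (\<lambda>v. (v / 2) * inverse (sqrt x))) (at x)" if "x \<in> {0<..}" for x
    by (rule has_derivative_eq_rhs[OF DERIV_real_sqrt[of x, unfolded has_field_derivative_def]])
      (use that in auto)
  ultimately show ?case
    by (intro differentiable_order_on_SucI[where f' = "\<lambda>x v. (v / 2) * inverse (sqrt x)"]
        differentiable_order_on_bilinear[OF _ bounded_bilinear_mult] differentiable_order_on_const) auto
qed

text \<open>Multiplying \<open>exp (- 1 / t)\<close> by a polynomial in \<open>1 / t\<close> gives a class of functions closed under
  differentiation.\<close>

definition flat :: "real poly \<Rightarrow> real \<Rightarrow> real" where
  "flat p t = (if t > 0 then poly p (1 / t) * exp (- (1 / t)) else 0)"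

text \<open>After the substitution s = 1/t this says that the exponential outgrows each monomial of
  \<open>p\<close>.\<close>

lemma flat_tendsto: "((\<lambda>t. poly p (1 / t) * exp (- (1 / t))) \<longlongrightarrow> 0) (at_right (0::real))"
proof -
  have "((\<lambda>s. poly p s * exp (- s)) \<longlongrightarrow> 0) at_top"
  proof -
    have "((\<lambda>s. \<Sum>i\<le>degree p. coeff p i * (s ^ i / exp s)) \<longlongrightarrow> (\<Sum>i\<le>degree p. coeff p i * 0)) at_top"
      by (intro tendsto_sum tendsto_mult tendsto_const tendsto_power_div_exp_0)
    moreover have "poly p s * exp (- s) = (\<Sum>i\<le>degree p. coeff p i * (s ^ i / exp s))" for s
      by (simp add: poly_altdef exp_minus sum_distrib_right divide_inverse mult.assoc)
    ultimately show ?thesis by simp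
  qed
  from filterlim_compose[OF this filterlim_inverse_at_top_right]
  show ?thesis by (simp add: inverse_eq_divide)
qed

text \<open>The inner function s = 1/t has derivative - s^2, so the chain and product rules replace
  \<open>p\<close> by s^2 (p - p'); \<open>[:0, 0, 1:]\<close> is the monomial s^2.\<close>

lemma flat_deriv: "(flat p has_real_derivative flat ([:0, 0, 1:] * (p - pderiv p)) t) (at t)"
proof -
  consider "t > 0" | "t < 0" | "t = 0" by linarith
  then show ?thesis
  proof cases
    case 1
    have "((\<lambda>t. poly p (1 / t) * exp (- (1 / t))) has_real_derivative flat ([:0, 0, 1:] * (p - pderiv p)) t) (at t)"
      using 1 by (auto intro!: derivative_eq_intros simp: flat_def field_simps power2_eq_square)
    then show ?thesis
      by (rule has_field_derivative_transform_within_open[where S = "{0<..}"]) (use 1 in \<open>auto simp: flat_def\<close>)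
  next
    case 2
    have "((\<lambda>t. 0) has_real_derivative flat ([:0, 0, 1:] * (p - pderiv p)) t) (at t)"
      using 2 by (auto simp: flat_def)
    then show ?thesis
      by (rule has_field_derivative_transform_within_open[where S = "{..<0}"]) (use 2 in \<open>auto simp: flat_def\<close>)
  next
    case 3
    \<comment> \<open>Dividing by \<open>h\<close> multiplies the polynomial by s = 1/h, so the
      right difference quotient is again of the flat form, with \<open>[:0,1:] * p\<close>.\<close>
    have r: "((\<lambda>h. flat p h / h) \<longlongrightarrow> 0) (at_right 0)"
      by (rule Lim_transform_eventually[OF flat_tendsto[of "[:0,1:] * p"]])
        (auto simp: flat_def eventually_at_filter intro!: always_eventually)
    have l: "((\<lambda>h. flat p h / h) \<longlongrightarrow> 0) (at_left 0)"
      by (rule Lim_transform_eventually[OF tendsto_const])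
        (auto simp: flat_def eventually_at_filter intro!: always_eventually)
    have "((\<lambda>h. flat p h / h) \<longlongrightarrow> 0) (at 0)"
      using l r by (simp add: filterlim_at_split)
    then show ?thesis unfolding 3 DERIV_def by (simp add: flat_def)
  qed
qed

lemma differentiable_order_on_flat: "differentiable_order_on k UNIV (flat p)"
proof (induction k arbitrary: p)
  case 0
  then show ?case using flat_deriv DERIV_isCont by (fastforce simp: continuous_on_eq_continuous_at)
next
  case (Suc k)
  show ?case
    by (intro differentiable_order_on_SucI[where f' = "\<lambda>x v. flat ([:0, 0, 1:] * (p - pderiv p)) x * v"] Suc
        differentiable_order_on_bilinear[OF _ bounded_bilinear_mult] differentiable_order_on_const flat_deriv[unfolded has_field_derivative_def] open_UNIV)
qed

text \<open>The quotient \<open>a / (a + b)\<close>: \<open>a\<close> vanishes outside the ball of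
  radius \<open>e\<close>, \<open>b\<close> inside the ball of radius \<open>e/2\<close>, and no
  point annihilates both. Squared distances keep everything smooth at the centre. The compact set
  \<open>K\<close> makes extension by zero possible later.\<close>

lemma bump_exists:
  fixes x0 :: "'e::euclidean_space"
  assumes "open S" "x0 \<in> S"
  obtains bmp :: "'e \<Rightarrow> real" and N K where "smooth_on UNIV bmp" "open N" "x0 \<in> N" "\<And>x. x \<in> N \<Longrightarrow> bmp x = 1"
    "compact K" "N \<subseteq> K" "K \<subseteq> S" "\<And>x. x \<notin> K \<Longrightarrow> bmp x = 0"
proof -
  obtain e where e: "e > 0" "cball x0 e \<subseteq> S" using assms open_contains_cball by metis
  define s where "s x = (x - x0) \<bullet> (x - x0)" for x :: 'e
  define a where "a x = flat 1 (e^2 + (-1) * s x)" for x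
  define b where "b x = flat 1 (s x + (- ((e/2)^2)))" for x
  define bmp where "bmp x = a x * inverse (a x + b x)" for x
  have s: "differentiable_order_on k UNIV s" for k
  proof -
    have "differentiable_order_on k UNIV (\<lambda>x. x + (- x0))"
      by (intro differentiable_order_on_add differentiable_order_on_const differentiable_order_on_linear) (auto simp: bounded_linear_ident)
    then have "differentiable_order_on k UNIV (\<lambda>x. (x + - x0) \<bullet> (x + - x0))"
      by (intro differentiable_order_on_bilinear[OF _ bounded_bilinear_inner]) auto
    then show ?thesis unfolding s_def by simp
  qed
  have a: "differentiable_order_on k UNIV a" for k unfolding a_def
    by (intro differentiable_order_on_compose[OF _ _ differentiable_order_on_flat] differentiable_order_on_add differentiable_order_on_const differentiable_order_on_bilinear[OF _ bounded_bilinear_mult] s) auto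
  have b: "differentiable_order_on k UNIV b" for k unfolding b_def
    by (intro differentiable_order_on_compose[OF _ _ differentiable_order_on_flat] differentiable_order_on_add differentiable_order_on_const s) auto
  have sn: "s x = (dist x0 x)^2" for x by (simp add: s_def dist_norm norm_minus_commute[of x0] power2_norm_eq_inner)
  have fp: "flat 1 t > 0 \<longleftrightarrow> t > 0" "flat 1 t \<ge> 0" "t \<le> 0 \<Longrightarrow> flat 1 t = 0" for t by (auto simp: flat_def)
  have pos: "a x + b x > 0" for x
  proof (cases "s x < e^2")
    case True
    then have "a x > 0" by (simp add: a_def fp)
    then show ?thesis using fp(2)[of "s x + (- ((e/2)^2))"] by (simp add: b_def)
  next
    case False
    moreover have "(e/2)^2 < e^2" using e(1) by (simp add: power2_eq_square)
    ultimately have "b x > 0" by (simp add: b_def fp)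
    then show ?thesis using fp(2)[of "e^2 + (-1) * s x"] by (simp add: a_def)
  qed
  have "differentiable_order_on k UNIV bmp" for k unfolding bmp_def
    by (intro differentiable_order_on_bilinear[OF _ bounded_bilinear_mult _ differentiable_order_on_compose[OF _ _ differentiable_order_on_inverse]] a differentiable_order_on_add b open_UNIV)
      (use pos in \<open>auto simp: less_imp_neq[symmetric] dest: less_imp_neq\<close>)
  then have 1: "smooth_on UNIV bmp" by (simp add: smooth_on_def)
  have 2: "bmp x = 1" if "x \<in> ball x0 (e/2)" for x
  proof -
    have "s x < (e/2)^2" using that e(1) by (auto simp: sn intro!: power_strict_mono)
    then have "b x = 0" by (simp add: b_def fp)
    then show ?thesis using pos[of x] by (simp add: bmp_def)
  qed
  have 3: "bmp x = 0" if "x \<notin> cball x0 e" for x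
  proof -
    have "s x \<ge> e^2" using that e(1) by (auto simp: sn intro!: power_mono)
    then show ?thesis by (simp add: bmp_def a_def fp)
  qed
  show ?thesis 
    by (rule that[of bmp "ball x0 (e/2)" "cball x0 e"]) (use 1 2 3 e in auto)
qed

section \<open>Closure properties of smoothness of all orders\<close>

lemma smooth_on_cong:
  assumes "open S" "\<And>x. x \<in> S \<Longrightarrow> f x = g x"
  shows "smooth_on S f \<longleftrightarrow> smooth_on S g"
  using differentiable_order_on_cong[of S f g, OF assms] by (simp add: smooth_on_def)

lemma smooth_on_congI:
  "open S \<Longrightarrow> smooth_on S g \<Longrightarrow> (\<And>x. x \<in> S \<Longrightarrow> f x = g x) \<Longrightarrow> smooth_on S f"
  using smooth_on_cong by metis

lemma smooth_on_subset: "smooth_on S f \<Longrightarrow> T \<subseteq> S \<Longrightarrow> smooth_on T f"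
  using differentiable_order_on_subset by (metis smooth_on_def)

lemma smooth_on_local:
  assumes "\<And>x. x \<in> S \<Longrightarrow> \<exists>T. open T \<and> x \<in> T \<and> smooth_on T f"
  shows "smooth_on S f"
  using assms differentiable_order_on_local[of S _ f] unfolding smooth_on_def by metis

lemma smooth_on_const: "smooth_on S (\<lambda>x. a)"
  by (simp add: smooth_on_def differentiable_order_on_const)

lemma smooth_on_linear: "bounded_linear L \<Longrightarrow> smooth_on S L"
  by (simp add: smooth_on_def differentiable_order_on_linear)

lemma smooth_on_add:
  "open S \<Longrightarrow> smooth_on S f \<Longrightarrow> smooth_on S g \<Longrightarrow> smooth_on S (\<lambda>x. f x + g x)"
  by (simp add: smooth_on_def differentiable_order_on_add)

lemma smooth_on_mult:
  fixes f g :: "_ \<Rightarrow> real"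
  shows "open S \<Longrightarrow> smooth_on S f \<Longrightarrow> smooth_on S g \<Longrightarrow> smooth_on S (\<lambda>x. f x * g x)"
  by (simp add: smooth_on_def differentiable_order_on_bilinear[OF _ bounded_bilinear_mult])

lemma smooth_on_compose:
  assumes "open S" "open T" "smooth_on T f" "smooth_on S g" "g ` S \<subseteq> T"
  shows "smooth_on S (\<lambda>x. f (g x))"
  using differentiable_order_on_compose[OF assms(1,2) _ _ assms(5)] assms(3,4) unfolding smooth_on_def by metis

lemma smooth_on_differentiable:
  assumes "smooth_on S f" "x \<in> S"
  shows "f differentiable (at x)"
proof -
  have "differentiable_order_on (Suc 0) S f" using assms unfolding smooth_on_def by blast
  then show ?thesis using assms(2) by simp
qed

lemma smooth_on_derivative:
  assumes "smooth_on S f"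
  shows "smooth_on S (\<lambda>x. frechet_derivative f (at x) v)"
  unfolding smooth_on_def
proof
  fix k
  have "differentiable_order_on (Suc k) S f" using assms unfolding smooth_on_def by blast
  then show "differentiable_order_on k S (\<lambda>x. frechet_derivative f (at x) v)" by simp
qed

section \<open>Smooth functions on a manifold\<close>

lemma chartD:
  assumes "smooth_manifold A" "(U, c) \<in> A"
  shows "open U" "open (c ` U)" "continuous_on U c" "continuous_on (c ` U) (inv_into U c)"
    "q \<in> U \<Longrightarrow> inv_into U c (c q) = q"
proof -
  have h: "open U" "open (c ` U)" "homeomorphism U (c ` U) c (inv_into U c)"
    using assms unfolding smooth_manifold_def by auto
  show "open U" "open (c ` U)" by fact+
  show "continuous_on U c" "continuous_on (c ` U) (inv_into U c)" "q \<in> U \<Longrightarrow> inv_into U c (c q) = q"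
    using h(3) unfolding homeomorphism_def by auto
qed

lemma chart_exists:
  assumes "smooth_manifold A"
  obtains U c where "(U, c) \<in> A" "p \<in> U"
proof -
  have "p \<in> (\<Union>(U, c)\<in>A. U)" using assms unfolding smooth_manifold_def by simp
  then show ?thesis using that by auto
qed

lemma transition_smooth:
  assumes "smooth_manifold A" "(U, c) \<in> A" "(V, d) \<in> A"
  shows "smooth_on (c ` (U \<inter> V)) (d \<circ> inv_into U c)"
  using assms unfolding smooth_manifold_def by fast

lemma open_chart_image:
  assumes "smooth_manifold A" "(U, c) \<in> A" "open W"
  shows "open (c ` (U \<inter> W))"
proof -
  note c = chartD[OF assms(1,2)]
  have "open (c ` U \<inter> inv_into U c -` W)"
    using continuous_open_preimage[OF c(4) c(2) assms(3)] .
  moreover have "c ` (U \<inter> W) = c ` U \<inter> inv_into U c -` W"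
    using c(5) by force
  ultimately show ?thesis by simp
qed

lemma smooth_functionsD:
  assumes "f \<in> smooth_functions A" "(U, c) \<in> A"
  shows "smooth_on (c ` U) (\<lambda>x. f (inv_into U c x))"
  using assms by (auto simp: smooth_functions_def comp_def)

text \<open>One chart around each point is enough, because the smooth transition maps carry the
  property into every other chart there.\<close>

lemma smooth_functionsI:
  assumes A: "smooth_manifold A"
    and f: "\<And>p. \<exists>U c W. (U, c) \<in> A \<and> p \<in> U \<and> open W \<and> p \<in> W \<and> smooth_on (c ` (U \<inter> W)) (\<lambda>x. f (inv_into U c x))"
  shows "f \<in> smooth_functions A"
  unfolding smooth_functions_def
proof clarify
  fix V d assume V: "(V, d) \<in> A"
  show "smooth_on (d ` V) (f \<circ> inv_into V d)"
  proof (rule smooth_on_local)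
    fix x assume "x \<in> d ` V"
    then obtain p where p: "p \<in> V" "x = d p" by auto
    obtain U c W where U: "(U, c) \<in> A" "p \<in> U" "open W" "p \<in> W"
      and s: "smooth_on (c ` (U \<inter> W)) (\<lambda>x. f (inv_into U c x))" using f by blast
    let ?S = "d ` (V \<inter> (U \<inter> W))"
    have oS: "open ?S" by (intro open_chart_image[OF A V] open_Int U chartD(1)[OF A U(1)])
    have oT: "open (c ` (U \<inter> W))" by (intro open_chart_image[OF A U(1)] U)
    have "smooth_on ?S (\<lambda>x. f (inv_into U c ((c \<circ> inv_into V d) x)))"
    proof (rule smooth_on_compose[OF oS oT s])
      show "smooth_on ?S (c \<circ> inv_into V d)"
        by (rule smooth_on_subset[OF transition_smooth[OF A V U(1)]]) auto
      show "(c \<circ> inv_into V d) ` ?S \<subseteq> c ` (U \<inter> W)"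
        using chartD(5)[OF A V] by auto
    qed
    moreover have "f (inv_into U c ((c \<circ> inv_into V d) x)) = (f \<circ> inv_into V d) x" if "x \<in> ?S" for x
      using that chartD(5)[OF A V] chartD(5)[OF A U(1)] by auto
    ultimately have "smooth_on ?S (f \<circ> inv_into V d)" using smooth_on_congI[OF oS] by metis
    then show "\<exists>T. open T \<and> x \<in> T \<and> smooth_on T (f \<circ> inv_into V d)"
      using oS p U by blast
  qed
qed

lemma smooth_functions_local:
  assumes A: "smooth_manifold A"
    and f: "\<And>p. \<exists>W g. open W \<and> p \<in> W \<and> g \<in> smooth_functions A \<and> (\<forall>q\<in>W. f q = g q)"
  shows "f \<in> smooth_functions A"
proof (rule smooth_functionsI[OF A])
  fix p
  obtain W g where W: "open W" "p \<in> W" "g \<in> smooth_functions A" "\<forall>q\<in>W. f q = g q" using f by blast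
  obtain U c where U: "(U, c) \<in> A" "p \<in> U" using chart_exists[OF A] .
  have "smooth_on (c ` (U \<inter> W)) (\<lambda>x. g (inv_into U c x))"
    by (rule smooth_on_subset[OF smooth_functionsD[OF W(3) U(1)]]) auto
  then have "smooth_on (c ` (U \<inter> W)) (\<lambda>x. f (inv_into U c x))"
    by (rule smooth_on_congI[OF open_chart_image[OF A U(1) W(1)]]) (use W(4) chartD(5)[OF A U(1)] in auto)
  then show "\<exists>U c W. (U, c) \<in> A \<and> p \<in> U \<and> open W \<and> p \<in> W \<and> smooth_on (c ` (U \<inter> W)) (\<lambda>x. f (inv_into U c x))"
    using U W by blast
qed

text \<open>The preimage of \<open>K\<close> is compact, hence closed by the Hausdorff property. Its
  complement is therefore an open set on which the extension is zero, and it contains every point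
  outside the chart.\<close>

lemma smooth_functions_extend:
  assumes A: "smooth_manifold A" and U: "(U, c) \<in> A"
    and F: "smooth_on (c ` U) F" and K: "compact K" "K \<subseteq> c ` U" "\<And>x. x \<in> c ` U - K \<Longrightarrow> F x = 0"
  shows "(\<lambda>q. if q \<in> U then F (c q) else 0) \<in> smooth_functions A" (is "?f \<in> _")
proof (rule smooth_functionsI[OF A])
  fix p
  show "\<exists>U c W. (U, c) \<in> A \<and> p \<in> U \<and> open W \<and> p \<in> W \<and> smooth_on (c ` (U \<inter> W)) (\<lambda>x. ?f (inv_into U c x))"
  proof (cases "p \<in> U")
    case True
    have "smooth_on (c ` (U \<inter> UNIV)) (\<lambda>x. ?f (inv_into U c x))" unfolding Int_UNIV_right
      by (rule smooth_on_congI[OF chartD(2)[OF A U] F]) (auto simp: chartD(5)[OF A U])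
    then show ?thesis using True U open_UNIV UNIV_I by blast
  next
    case False
    obtain V d where V: "(V, d) \<in> A" "p \<in> V" using chart_exists[OF A] .
    let ?L = "inv_into U c ` K"
    have "compact ?L"
      by (rule compact_continuous_image[OF continuous_on_subset[OF chartD(4)[OF A U] K(2)] K(1)])
    then have o: "open (- ?L)" using compact_imp_closed by blast
    have "?L \<subseteq> U" using K(2) inv_into_into[of _ c U] by (metis image_subsetI subsetD)
    then have p: "p \<in> - ?L" using False by auto
    have z: "?f q = 0" if "q \<in> - ?L" for q
    proof (cases "q \<in> U")
      case True
      then have "c q \<notin> K" using that chartD(5)[OF A U True] by force
      then show ?thesis using K(3) True by auto
    qed simp
    have "smooth_on (d ` (V \<inter> - ?L)) (\<lambda>x. 0::real)" by (rule smooth_on_const)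
    then have "smooth_on (d ` (V \<inter> - ?L)) (\<lambda>x. ?f (inv_into V d x))"
    proof (rule smooth_on_congI[OF open_chart_image[OF A V(1) o]])
      fix x assume "x \<in> d ` (V \<inter> - ?L)"
      then obtain q where "q \<in> V" "q \<in> - ?L" "x = d q" by blast
      then show "?f (inv_into V d x) = 0" using z chartD(5)[OF A V(1)] by metis
    qed
    then show ?thesis using V o p by blast
  qed
qed

lemma smooth_functions_const: "(\<lambda>q. a) \<in> smooth_functions A"
  by (auto simp: smooth_functions_def comp_def smooth_on_const)

lemma smooth_functions_add:
  assumes "smooth_manifold A" "f \<in> smooth_functions A" "g \<in> smooth_functions A"
  shows "(\<lambda>q. f q + g q) \<in> smooth_functions A"
  using assms chartD(2)[OF assms(1)] by (auto simp: smooth_functions_def comp_def intro!: smooth_on_add)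

lemma smooth_functions_mult:
  assumes "smooth_manifold A" "f \<in> smooth_functions A" "g \<in> smooth_functions A"
  shows "(\<lambda>q. f q * g q) \<in> smooth_functions A"
  using assms chartD(2)[OF assms(1)] by (auto simp: smooth_functions_def comp_def intro!: smooth_on_mult)

lemma smooth_functions_minus:
  assumes "smooth_manifold A" "f \<in> smooth_functions A"
  shows "(\<lambda>q. - f q) \<in> smooth_functions A"
  using smooth_functions_mult[OF assms(1) smooth_functions_const[of "-1"] assms(2)] by simp

lemma smooth_functions_diff:
  assumes "smooth_manifold A" "f \<in> smooth_functions A" "g \<in> smooth_functions A"
  shows "(\<lambda>q. f q - g q) \<in> smooth_functions A"
  using smooth_functions_add[OF assms(1,2) smooth_functions_minus[OF assms(1,3)]] by simp

lemma smooth_functions_sum: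
  assumes "smooth_manifold A" "\<And>i. i \<in> I \<Longrightarrow> f i \<in> smooth_functions A"
  shows "(\<lambda>q. \<Sum>i\<in>I. f i q) \<in> smooth_functions A"
  using assms(2) by (induction I rule: infinite_finite_induct)
    (auto intro: smooth_functions_const smooth_functions_add[OF assms(1)])

lemma smooth_functions_compose:
  assumes A: "smooth_manifold A" and \<rho>: "smooth_on UNIV \<rho>" and f: "f \<in> smooth_functions A"
  shows "(\<lambda>q. \<rho> (f q)) \<in> smooth_functions A"
  unfolding smooth_functions_def
proof clarify
  fix U c assume U: "(U, c) \<in> A"
  show "smooth_on (c ` U) ((\<lambda>q. \<rho> (f q)) \<circ> inv_into U c)"
    using smooth_on_compose[OF chartD(2)[OF A U] open_UNIV \<rho> smooth_functionsD[OF f U]] by (simp add: comp_def)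
qed

text \<open>The bump stays a function of the coordinates, so that coordinate expressions can be
  multiplied by it before they are extended by zero.\<close>

lemma chart_bump:
  assumes A: "smooth_manifold A" and U: "(U, c) \<in> A" "p \<in> U" and W: "open W" "p \<in> W"
  obtains \<beta> N K where "smooth_on UNIV (\<beta> :: _ \<Rightarrow> real)" "open N" "p \<in> N" "N \<subseteq> U \<inter> W" "compact K"
    "K \<subseteq> c ` (U \<inter> W)" "\<And>q. q \<in> N \<Longrightarrow> \<beta> (c q) = 1" "\<And>x. x \<notin> K \<Longrightarrow> \<beta> x = 0"
proof -
  have "c p \<in> c ` (U \<inter> W)" using U W by auto
  from bump_exists[OF open_chart_image[OF A U(1) W(1)] this]
  obtain \<beta> :: "_ \<Rightarrow> real" and M K where b: "smooth_on UNIV \<beta>" "open M" "c p \<in> M" "\<And>x. x \<in> M \<Longrightarrow> \<beta> x = 1"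
    "compact K" "M \<subseteq> K" "K \<subseteq> c ` (U \<inter> W)" "\<And>x. x \<notin> K \<Longrightarrow> \<beta> x = 0" by metis
  have o: "open (U \<inter> c -` M)"
    using continuous_open_preimage[OF chartD(3)[OF A U(1)] chartD(1)[OF A U(1)] b(2)] .
  have "U \<inter> c -` M \<subseteq> U \<inter> W"
  proof
    fix q assume q: "q \<in> U \<inter> c -` M"
    then have "c q \<in> c ` (U \<inter> W)" using b(6,7) by auto
    then obtain q' where "q' \<in> U \<inter> W" "c q = c q'" by auto
    then show "q \<in> U \<inter> W" using q chartD(5)[OF A U(1)] by (metis IntD1)
  qed
  then show ?thesis using that[of \<beta> "U \<inter> c -` M" K] b o U by auto
qed

lemma manifold_bump:
  assumes A: "smooth_manifold A" and W: "open W" "p \<in> W"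
  obtains \<beta> N where "\<beta> \<in> smooth_functions A" "open N" "p \<in> N" "N \<subseteq> W"
    "\<And>q. q \<in> N \<Longrightarrow> \<beta> q = 1" "\<And>q. q \<notin> W \<Longrightarrow> \<beta> q = 0"
proof -
  obtain U c where U: "(U, c) \<in> A" "p \<in> U" using chart_exists[OF A] .
  obtain \<beta> :: "_ \<Rightarrow> real" and N K where b: "smooth_on UNIV \<beta>" "open N" "p \<in> N" "N \<subseteq> U \<inter> W" "compact K"
    "K \<subseteq> c ` (U \<inter> W)" "\<And>q. q \<in> N \<Longrightarrow> \<beta> (c q) = 1" "\<And>x. x \<notin> K \<Longrightarrow> \<beta> x = 0" 
    using chart_bump[OF A U W] by metis
  let ?f = "\<lambda>q. if q \<in> U then \<beta> (c q) else 0"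
  have "?f \<in> smooth_functions A"
    by (rule smooth_functions_extend[OF A U(1) smooth_on_subset[OF b(1)] b(5)]) (use b in auto)
  moreover have "?f q = 0" if "q \<notin> W" for q
  proof (cases "q \<in> U")
    case True
    have "c q \<notin> K"
    proof
      assume "c q \<in> K"
      then obtain q' where "q' \<in> U \<inter> W" "c q = c q'" using b(6) by auto
      then show False using True that chartD(5)[OF A U(1)] by (metis IntD1 IntD2)
    qed
    then show ?thesis using b(8) by simp
  qed simp
  moreover have "?f q = 1" if "q \<in> N" for q using that b(4,7) by auto
  moreover have "N \<subseteq> W" using b(4) by blast
  ultimately show ?thesis using that[of ?f N] b(2,3) by blast
qed

section \<open>Tangent vectors\<close>

definition chart_vector :: "('a, 'e::euclidean_space) atlas \<Rightarrow> 'a set \<Rightarrow> ('a \<Rightarrow> 'e) \<Rightarrow> 'a \<Rightarrow> 'e \<Rightarrow> 'a tvec" where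
  "chart_vector A U c p w = (\<lambda>f. if f \<in> smooth_functions A
     then frechet_derivative (f \<circ> inv_into U c) (at (c p)) w else 0)"

lemma tangent_space_altdef:
  "tangent_space A p = {v. \<exists>U c. (U, c) \<in> A \<and> p \<in> U \<and> (\<exists>w. v = chart_vector A U c p w)}"
  by (auto simp: tangent_space_def chart_vector_def)

lemma smooth_map_id: "smooth_manifold A \<Longrightarrow> smooth_map A A id"
  unfolding smooth_map_def smooth_manifold_def by (fastforce simp: comp_def id_def)

lemma smooth_map_comp:
  assumes A: "smooth_manifold A" and B: "smooth_manifold B" and m: "smooth_map A B \<iota>" and f: "f \<in> smooth_functions B"
  shows "(\<lambda>p. f (\<iota> p)) \<in> smooth_functions A"
proof (rule smooth_functionsI[OF A])
  fix p
  obtain U c where U: "(U, c) \<in> A" "p \<in> U" using chart_exists[OF A] .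
  obtain V d where V: "(V, d) \<in> B" "\<iota> p \<in> V" using chart_exists[OF B] .
  have W: "open (\<iota> -` V)" using m chartD(1)[OF B V(1)] open_vimage unfolding smooth_map_def
    using continuous_on_open_vimage[of UNIV \<iota>] by auto
  let ?S = "c ` (U \<inter> \<iota> -` V)"
  have oS: "open ?S" by (rule open_chart_image[OF A U(1) W])
  have "smooth_on ?S (\<lambda>x. f (inv_into V d ((d \<circ> \<iota> \<circ> inv_into U c) x)))"
  proof (rule smooth_on_compose[OF oS chartD(2)[OF B V(1)] smooth_functionsD[OF f V(1)]])
    show "smooth_on ?S (d \<circ> \<iota> \<circ> inv_into U c)" using m U V unfolding smooth_map_def by fast
    show "(d \<circ> \<iota> \<circ> inv_into U c) ` ?S \<subseteq> d ` V" using chartD(5)[OF A U(1)] by auto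
  qed
  moreover have "f (inv_into V d ((d \<circ> \<iota> \<circ> inv_into U c) x)) = f (\<iota> (inv_into U c x))" if "x \<in> ?S" for x
    using that chartD(5)[OF A U(1)] chartD(5)[OF B V(1)] by auto
  ultimately have s: "smooth_on ?S (\<lambda>x. f (\<iota> (inv_into U c x)))"
    using smooth_on_congI[OF oS] by metis
  have "p \<in> \<iota> -` V" using V by simp
  then show "\<exists>U c W. (U, c) \<in> A \<and> p \<in> U \<and> open W \<and> p \<in> W \<and> smooth_on (c ` (U \<inter> W)) (\<lambda>x. f (\<iota> (inv_into U c x)))"
    using s U W by blast
qed

lemma chart_vector_differentiable:
  assumes "smooth_manifold A" "(U, c) \<in> A" "p \<in> U" "f \<in> smooth_functions A"
  shows "(f \<circ> inv_into U c) differentiable (at (c p))"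
  using smooth_on_differentiable[OF smooth_functionsD[OF assms(4,2)]] assms(3) by (auto simp: comp_def)

text \<open>The chain rule in charts. For the identity map it is the change of coordinates, by which
  two tangent vectors can be written in a common chart.\<close>

lemma pushforward_chart_vector:
  assumes A: "smooth_manifold A" and B: "smooth_manifold B" and m: "smooth_map A B \<iota>"
    and U: "(U, c) \<in> A" "p \<in> U" and V: "(V, d) \<in> B" "\<iota> p \<in> V"
  shows "pushforward B \<iota> (chart_vector A U c p w) =
    chart_vector B V d (\<iota> p) (frechet_derivative (d \<circ> \<iota> \<circ> inv_into U c) (at (c p)) w)"
proof
  fix f
  show "pushforward B \<iota> (chart_vector A U c p w) f =
    chart_vector B V d (\<iota> p) (frechet_derivative (d \<circ> \<iota> \<circ> inv_into U c) (at (c p)) w) f"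
  proof (cases "f \<in> smooth_functions B")
    case f: True
    have W: "open (\<iota> -` V)" using m chartD(1)[OF B V(1)] unfolding smooth_map_def
      using continuous_on_open_vimage[of UNIV \<iota>] by auto
    let ?S = "c ` (U \<inter> \<iota> -` V)" and ?h = "d \<circ> \<iota> \<circ> inv_into U c" and ?k = "f \<circ> inv_into V d"
    have oS: "open ?S" by (rule open_chart_image[OF A U(1) W])
    have cp: "c p \<in> ?S" using U V by auto
    have hp: "?h (c p) = d (\<iota> p)" using chartD(5)[OF A U(1) U(2)] by simp
    have "smooth_on ?S ?h" using m U V unfolding smooth_map_def by fast
    then have dh: "?h differentiable (at (c p))" using smooth_on_differentiable cp by blast
    have dk: "?k differentiable (at (?h (c p)))" unfolding hp by (rule chart_vector_differentiable[OF B V f])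
    have "frechet_derivative (?k \<circ> ?h) (at (c p)) w = frechet_derivative ?k (at (d (\<iota> p))) (frechet_derivative ?h (at (c p)) w)"
      using frechet_derivative_compose[OF dh dk, THEN fun_cong, of w] unfolding hp by (simp add: comp_def)
    moreover have "frechet_derivative (?k \<circ> ?h) (at (c p)) = frechet_derivative (f \<circ> \<iota> \<circ> inv_into U c) (at (c p))"
      by (rule frechet_derivative_transform_within_open[OF differentiable_chain_at[OF dh dk] oS cp])
        (use chartD(5)[OF A U(1)] chartD(5)[OF B V(1)] in auto)
    moreover have "f \<circ> \<iota> \<in> smooth_functions A" using smooth_map_comp[OF A B m f] by (simp add: comp_def)
    ultimately show ?thesis using f by (simp add: pushforward_def chart_vector_def)
  qed (simp add: pushforward_def chart_vector_def)
qed

lemma tangent_space_chart: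
  assumes A: "smooth_manifold A" and V: "(V, d) \<in> A" "p \<in> V"
  shows "tangent_space A p = range (chart_vector A V d p)"
proof -
  have "\<exists>w'. chart_vector A U c p w = chart_vector A V d p w'" if U: "(U, c) \<in> A" "p \<in> U" for U c w
  proof -
    have "pushforward A id (chart_vector A U c p w) = chart_vector A U c p w"
      by (auto simp: pushforward_def chart_vector_def)
    then show ?thesis using pushforward_chart_vector[OF A A smooth_map_id[OF A] U V(1), of w] V(2)
      by (metis id_apply)
  qed
  then show ?thesis using V unfolding tangent_space_altdef by blast
qed

lemma pushforward_tangent:
  assumes A: "smooth_manifold A" and B: "smooth_manifold B" and m: "smooth_map A B \<iota>"
    and v: "v \<in> tangent_space A p"
  shows "pushforward B \<iota> v \<in> tangent_space B (\<iota> p)"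
proof -
  obtain U c where U: "(U, c) \<in> A" "p \<in> U" using chart_exists[OF A] .
  obtain V d where V: "(V, d) \<in> B" "\<iota> p \<in> V" using chart_exists[OF B] .
  show ?thesis using v pushforward_chart_vector[OF A B m U V]
    unfolding tangent_space_chart[OF A U] tangent_space_chart[OF B V] by auto
qed

lemma tangent_space_linear:
  assumes A: "smooth_manifold A" and u: "u \<in> tangent_space A p"
  shows "v \<in> tangent_space A p \<Longrightarrow> u + v \<in> tangent_space A p" "a *\<^sub>T u \<in> tangent_space A p"
proof -
  obtain U c where U: "(U, c) \<in> A" "p \<in> U" using chart_exists[OF A] .
  have l: "linear (frechet_derivative (f \<circ> inv_into U c) (at (c p)))" if "f \<in> smooth_functions A" for f
    using chart_vector_differentiable[OF A U that] linear_frechet_derivative by blast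
  have "chart_vector A U c p w + chart_vector A U c p w' = chart_vector A U c p (w + w')" for w w'
    using linear_add[OF l] by (auto simp: chart_vector_def)
  moreover have "a *\<^sub>T chart_vector A U c p w = chart_vector A U c p (a *\<^sub>R w)" for w
    using linear_cmul[OF l] by (auto simp: chart_vector_def tscale_def)
  ultimately show "v \<in> tangent_space A p \<Longrightarrow> u + v \<in> tangent_space A p" "a *\<^sub>T u \<in> tangent_space A p"
    using u unfolding tangent_space_chart[OF A U] by auto
qed

lemma tscale_apply [simp]: "(a *\<^sub>T v) f = a * v f"
  by (simp add: tscale_def)

lemma fscale_apply [simp]: "(a *\<^sub>F V) p = a p *\<^sub>T V p"
  by (simp add: fscale_def)

lemma sum_fun_apply [simp]: "(\<Sum>i\<in>I. F i) x = (\<Sum>i\<in>I. F i x)" for F :: "_ \<Rightarrow> _ \<Rightarrow> 'z::comm_monoid_add"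
  by (induction I rule: infinite_finite_induct) auto

lemma tangent_space_zero:
  assumes A: "smooth_manifold A"
  shows "0 \<in> tangent_space A p"
proof -
  obtain U c where U: "(U, c) \<in> A" "p \<in> U" using chart_exists[OF A] .
  then have "chart_vector A U c p 0 \<in> tangent_space A p" using tangent_space_chart[OF A U] by auto
  from tangent_space_linear(2)[OF A this, of 0] show ?thesis
    by (simp add: tscale_def zero_fun_def)
qed

lemma tangent_space_diff:
  assumes A: "smooth_manifold A" and u: "u \<in> tangent_space A p" and v: "v \<in> tangent_space A p"
  shows "u - v \<in> tangent_space A p"
proof -
  have "u - v = u + (-1) *\<^sub>T v" by auto
  then show ?thesis using tangent_space_linear[OF A] u v by presburger
qed

lemma tangent_space_minus:
  assumes A: "smooth_manifold A" and u: "u \<in> tangent_space A p"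
  shows "- u \<in> tangent_space A p"
  using tangent_space_diff[OF A tangent_space_zero[OF A] u] by simp

lemma tangent_space_sum:
  assumes A: "smooth_manifold A" and u: "\<And>i. i \<in> I \<Longrightarrow> u i \<in> tangent_space A p"
  shows "(\<Sum>i\<in>I. u i) \<in> tangent_space A p"
  using u by (induction I rule: infinite_finite_induct)
    (auto intro: tangent_space_zero[OF A] tangent_space_linear(1)[OF A])

lemma tangent_vector_derivation:
  assumes A: "smooth_manifold A" and v: "v \<in> tangent_space A p"
  shows "f \<notin> smooth_functions A \<Longrightarrow> v f = 0"
    and "f \<in> smooth_functions A \<Longrightarrow> g \<in> smooth_functions A \<Longrightarrow> v (\<lambda>q. f q + g q) = v f + v g"
    and "f \<in> smooth_functions A \<Longrightarrow> g \<in> smooth_functions A \<Longrightarrow> v (\<lambda>q. f q * g q) = f p * v g + v f * g p"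
    and "v (\<lambda>q. a) = 0"
proof -
  obtain U c where U: "(U, c) \<in> A" "p \<in> U" using chart_exists[OF A] .
  obtain w where w: "v = chart_vector A U c p w" using v unfolding tangent_space_chart[OF A U] by auto
  show "f \<notin> smooth_functions A \<Longrightarrow> v f = 0" by (simp add: w chart_vector_def)
  have d: "((\<lambda>x. h (inv_into U c x)) has_derivative frechet_derivative (\<lambda>x. h (inv_into U c x)) (at (c p))) (at (c p))"
    if "h \<in> smooth_functions A" for h
    using chart_vector_differentiable[OF A U that] by (simp add: frechet_derivative_works comp_def)
  have e: "v h = H w" if "h \<in> smooth_functions A" "((\<lambda>x. h (inv_into U c x)) has_derivative H) (at (c p))" for h H
    using that frechet_derivative_at by (fastforce simp: w chart_vector_def comp_def)
  have e': "v h = frechet_derivative (\<lambda>x. h (inv_into U c x)) (at (c p)) w" if "h \<in> smooth_functions A" for h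
    using that by (simp add: w chart_vector_def comp_def)
  show "v (\<lambda>q. f q + g q) = v f + v g" if "f \<in> smooth_functions A" "g \<in> smooth_functions A"
    using e[OF smooth_functions_add[OF A that] has_derivative_add[OF d[OF that(1)] d[OF that(2)]]] that e' by simp
  show "v (\<lambda>q. f q * g q) = f p * v g + v f * g p" if "f \<in> smooth_functions A" "g \<in> smooth_functions A"
    using e[OF smooth_functions_mult[OF A that] has_derivative_mult[OF d[OF that(1)] d[OF that(2)]]] that e'
      chartD(5)[OF A U] by simp
  show "v (\<lambda>q. a) = 0"
    using e[OF smooth_functions_const has_derivative_const] .
qed

lemma vector_fields_iff:
  "X \<in> vector_fields A \<longleftrightarrow> (\<forall>p. X p \<in> tangent_space A p) \<and> (\<forall>f\<in>smooth_functions A. (\<lambda>p. X p f) \<in> smooth_functions A)"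
  by (simp add: vector_fields_def fields_along_def)

text \<open>Coordinate fields and coordinate functions, cut off by a bump so that they become global
  objects. On \<open>N\<close> the bump is 1, and there \<open>x\<close> is dual to
  \<open>E\<close>.\<close>

lemma local_frame:
  fixes A :: "('a::{t2_space, second_countable_topology}, 'e::euclidean_space) atlas"
  assumes A: "smooth_manifold A"
  obtains N and E :: "'e \<Rightarrow> 'a field" and x where "open N" "p \<in> N"
    "\<And>b. b \<in> Basis \<Longrightarrow> E b \<in> vector_fields A" "\<And>b. b \<in> Basis \<Longrightarrow> x b \<in> smooth_functions A"
    "\<And>q v. q \<in> N \<Longrightarrow> v \<in> tangent_space A q \<Longrightarrow> v = (\<Sum>b\<in>Basis. v (x b) *\<^sub>T E b q)"
    "\<And>q a b. q \<in> N \<Longrightarrow> a \<in> Basis \<Longrightarrow> b \<in> Basis \<Longrightarrow> E a q (x b) = (if a = b then 1 else 0)"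
proof -
  obtain U c where U: "(U, c) \<in> A" "p \<in> U" using chart_exists[OF A] .
  obtain \<beta> :: "_ \<Rightarrow> real" and N K where b: "smooth_on UNIV \<beta>" "open N" "p \<in> N" "N \<subseteq> U" "compact K"
    "K \<subseteq> c ` U" "\<And>q. q \<in> N \<Longrightarrow> \<beta> (c q) = 1" "\<And>x. x \<notin> K \<Longrightarrow> \<beta> x = 0" 
    using chart_bump[OF A U open_UNIV] by (metis Int_UNIV_right UNIV_I)
  define x where "x b = (\<lambda>q. if q \<in> U then \<beta> (c q) * (c q \<bullet> b) else 0)" for b
  define E where "E b = (\<lambda>q. if q \<in> U then \<beta> (c q) *\<^sub>T chart_vector A U c q b else 0)" for b
  have oU: "open (c ` U)" using chartD[OF A U(1)] by blast
  have sb: "smooth_on (c ` U) \<beta>" using smooth_on_subset[OF b(1)] by auto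
  have xs: "x b \<in> smooth_functions A" for b unfolding x_def
    by (rule smooth_functions_extend[OF A U(1) smooth_on_mult[OF oU sb
            smooth_on_linear[OF bounded_linear_inner_left]] b(5,6)])
      (use b(8) in auto)
  have Es: "E b \<in> vector_fields A" for b
    unfolding vector_fields_iff
  proof safe
    fix q
    have "chart_vector A U c q b \<in> tangent_space A q" if "q \<in> U"
      using tangent_space_chart[OF A U(1) that] by blast
    then show "E b q \<in> tangent_space A q"
      using tangent_space_zero[OF A] tangent_space_linear(2)[OF A] by (auto simp: E_def)
  next
    fix f assume f: "f \<in> smooth_functions A"
    have "(\<lambda>q. if q \<in> U then \<beta> (c q) * frechet_derivative (\<lambda>x. f (inv_into U c x)) (at (c q)) b else 0) \<in> smooth_functions A"
      by (rule smooth_functions_extend[OF A U(1) smooth_on_mult[OF oU sb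
            smooth_on_derivative[OF smooth_functionsD[OF f U(1)]]] b(5,6)])
       (use b(8) in auto)
    also have "(\<lambda>q. if q \<in> U then \<beta> (c q) * frechet_derivative (\<lambda>x. f (inv_into U c x)) (at (c q)) b else 0) = (\<lambda>q. E b q f)"
      using f by (auto simp: E_def chart_vector_def comp_def)
    finally show "(\<lambda>q. E b q f) \<in> smooth_functions A" .
  qed
  have EN: "E b q = chart_vector A U c q b" if "q \<in> N" for b q
    using that b(4,7) by (auto simp: E_def)
  have cx: "chart_vector A U c q w (x b) = w \<bullet> b" if q: "q \<in> N" for q w b
  proof -
    have qU: "q \<in> U" using q b(4) by auto
    have oN: "open (c ` (U \<inter> N))" by (rule open_chart_image[OF A U(1) b(2)])
    have "frechet_derivative (\<lambda>y. y \<bullet> b) (at (c q)) = frechet_derivative (x b \<circ> inv_into U c) (at (c q))"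
      by (rule frechet_derivative_transform_within_open[OF _ oN])
        (use q qU chartD(5)[OF A U(1)] b(7) in \<open>auto simp: x_def bounded_linear_imp_differentiable bounded_linear_inner_left\<close>)
    moreover have "frechet_derivative (\<lambda>y. y \<bullet> b) (at (c q)) w = w \<bullet> b"
      using frechet_derivative_at[OF bounded_linear_imp_has_derivative[OF bounded_linear_inner_left]] by metis
    ultimately show ?thesis using xs by (simp add: chart_vector_def)
  qed
  show ?thesis
  proof (rule that[of N E x])
    fix q v assume q: "q \<in> N" and v: "v \<in> tangent_space A q"
    have qU: "q \<in> U" using q b(4) by auto
    obtain w where w: "v = chart_vector A U c q w" using v tangent_space_chart[OF A U(1) qU] by auto
    show "v = (\<Sum>b\<in>Basis. v (x b) *\<^sub>T E b q)"
    proof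
      fix f
      show "v f = (\<Sum>b\<in>Basis. v (x b) *\<^sub>T E b q) f"
      proof (cases "f \<in> smooth_functions A")
        case True
        let ?d = "frechet_derivative (f \<circ> inv_into U c) (at (c q))"
        have l: "linear ?d" using chart_vector_differentiable[OF A U(1) qU True] linear_frechet_derivative by blast
        have "?d w = ?d (\<Sum>b\<in>Basis. (w \<bullet> b) *\<^sub>R b)" by (simp add: euclidean_representation)
        also have "\<dots> = (\<Sum>b\<in>Basis. (w \<bullet> b) *\<^sub>R ?d b)" using l by (simp add: linear_sum linear_cmul)
        finally show ?thesis using True by (simp add: w cx[OF q] EN[OF q]) (simp add: chart_vector_def)
      qed (simp add: w EN[OF q], simp add: chart_vector_def)
    qed
  next
    fix q and a b' :: 'e assume "q \<in> N" "a \<in> Basis" "b' \<in> Basis"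
    then show "E a q (x b') = (if a = b' then 1 else 0)"
      by (simp add: EN cx inner_Basis)
  qed (use b xs Es in auto)
qed

section \<open>Fields along a map\<close>

text \<open>Real-valued functionals at a fixed point are enough: an identity between vectors is
  brought to this form by applying a test function or by pairing with the metric.\<close>

definition tensorial_at ::
    "('b, 'k::euclidean_space) atlas \<Rightarrow> ('b \<Rightarrow> 'a tvec) set \<Rightarrow> 'b \<Rightarrow> (('b \<Rightarrow> 'a tvec) \<Rightarrow> real) \<Rightarrow> bool" where
  "tensorial_at A \<Gamma> p \<Phi> \<longleftrightarrow>
     (\<forall>V\<in>\<Gamma>. \<forall>W\<in>\<Gamma>. \<Phi> (V + W) = \<Phi> V + \<Phi> W) \<and>
     (\<forall>a\<in>smooth_functions A. \<forall>V\<in>\<Gamma>. \<Phi> (a *\<^sub>F V) = a p * \<Phi> V)"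

locale manifold_map =
  fixes A :: "('b::{t2_space, second_countable_topology}, 'k::euclidean_space) atlas"
    and B :: "('a::{t2_space, second_countable_topology}, 'e::euclidean_space) atlas"
    and \<iota> :: "'b \<Rightarrow> 'a"
  assumes manifold_A: "smooth_manifold A" and manifold_B: "smooth_manifold B" and smooth_\<iota>: "smooth_map A B \<iota>"
begin

abbreviation "\<Gamma> \<equiv> fields_along A B \<iota>"

lemma \<Gamma>D:
  assumes "V \<in> \<Gamma>"
  shows "V p \<in> tangent_space B (\<iota> p)" "f \<in> smooth_functions B \<Longrightarrow> (\<lambda>p. V p f) \<in> smooth_functions A"
  using assms by (auto simp: fields_along_def)

lemma \<Gamma>I:
  assumes "\<And>p. V p \<in> tangent_space B (\<iota> p)" "\<And>f. f \<in> smooth_functions B \<Longrightarrow> (\<lambda>p. V p f) \<in> smooth_functions A"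
  shows "V \<in> \<Gamma>"
  using assms by (auto simp: fields_along_def)

lemma \<Gamma>_add: "V \<in> \<Gamma> \<Longrightarrow> W \<in> \<Gamma> \<Longrightarrow> V + W \<in> \<Gamma>"
  by (rule \<Gamma>I) (auto dest: \<Gamma>D intro: tangent_space_linear[OF manifold_B] smooth_functions_add[OF manifold_A])

lemma \<Gamma>_scale: "a \<in> smooth_functions A \<Longrightarrow> V \<in> \<Gamma> \<Longrightarrow> a *\<^sub>F V \<in> \<Gamma>"
  by (rule \<Gamma>I) (auto dest: \<Gamma>D intro: tangent_space_linear[OF manifold_B] smooth_functions_mult[OF manifold_A])

lemma \<Gamma>_diff: "V \<in> \<Gamma> \<Longrightarrow> W \<in> \<Gamma> \<Longrightarrow> V - W \<in> \<Gamma>"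
  by (rule \<Gamma>I) (auto dest: \<Gamma>D intro: tangent_space_diff[OF manifold_B] smooth_functions_diff[OF manifold_A])

lemma \<Gamma>_zero: "0 \<in> \<Gamma>"
  by (rule \<Gamma>I) (auto intro: tangent_space_zero[OF manifold_B] smooth_functions_const)

lemma \<Gamma>_sum: "(\<And>i. i \<in> I \<Longrightarrow> V i \<in> \<Gamma>) \<Longrightarrow> (\<Sum>i\<in>I. V i) \<in> \<Gamma>"
  by (induction I rule: infinite_finite_induct) (auto intro: \<Gamma>_zero \<Gamma>_add)

lemma restriction_\<Gamma>: "Y \<in> vector_fields B \<Longrightarrow> (\<lambda>p. Y (\<iota> p)) \<in> \<Gamma>"
  by (rule \<Gamma>I) (auto simp: vector_fields_iff intro: smooth_map_comp[OF manifold_A manifold_B smooth_\<iota>])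

lemma pushforward_\<Gamma>:
  assumes X: "X \<in> vector_fields A"
  shows "(\<lambda>p. pushforward B \<iota> (X p)) \<in> \<Gamma>"
proof (rule \<Gamma>I)
  show "pushforward B \<iota> (X p) \<in> tangent_space B (\<iota> p)" for p
    using pushforward_tangent[OF manifold_A manifold_B smooth_\<iota>] X by (simp add: vector_fields_iff)
  show "(\<lambda>p. pushforward B \<iota> (X p) f) \<in> smooth_functions A" if "f \<in> smooth_functions B" for f
    using X smooth_map_comp[OF manifold_A manifold_B smooth_\<iota> that] that
    by (simp add: pushforward_def vector_fields_iff comp_def)
qed

lemma frame_along:
  obtains N and E :: "'e \<Rightarrow> 'a field" and x where "open N" "p \<in> N"
    "\<And>b. b \<in> Basis \<Longrightarrow> E b \<in> vector_fields B" "\<And>b. b \<in> Basis \<Longrightarrow> x b \<in> smooth_functions B"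
    "\<And>q v. q \<in> N \<Longrightarrow> v \<in> tangent_space B (\<iota> q) \<Longrightarrow> v = (\<Sum>b\<in>Basis. v (x b) *\<^sub>T E b (\<iota> q))"
proof -
  obtain N and E :: "'e \<Rightarrow> 'a field" and x where N: "open N" "\<iota> p \<in> N"
    and E: "\<And>b. b \<in> Basis \<Longrightarrow> E b \<in> vector_fields B" and x: "\<And>b. b \<in> Basis \<Longrightarrow> x b \<in> smooth_functions B"
    and Ex: "\<And>q v. q \<in> N \<Longrightarrow> v \<in> tangent_space B q \<Longrightarrow> v = (\<Sum>b\<in>Basis. v (x b) *\<^sub>T E b q)"
    and Ex': "\<And>q a b. q \<in> N \<Longrightarrow> a \<in> Basis \<Longrightarrow> b \<in> Basis \<Longrightarrow> E a q (x b) = (if a = b then 1 else 0)"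
    by (rule local_frame[OF manifold_B, of "\<iota> p"]) (rule that)
  have "continuous_on UNIV \<iota>" using smooth_\<iota> by (simp add: smooth_map_def)
  then have "open (\<iota> -` N)" using N(1) open_vimage by blast
  then show ?thesis using that[of "\<iota> -` N" E x] N(2) E x Ex by simp
qed

section \<open>Functionals linear over smooth functions\<close>

lemma tensorial_sum:
  assumes t: "tensorial_at A \<Gamma> p \<Phi>"
    and a: "\<And>i. i \<in> I \<Longrightarrow> a i \<in> smooth_functions A" and V: "\<And>i. i \<in> I \<Longrightarrow> V i \<in> \<Gamma>"
  shows "\<Phi> (\<Sum>i\<in>I. a i *\<^sub>F V i) = (\<Sum>i\<in>I. a i p * \<Phi> (V i))"
proof -
  have z: "\<Phi> 0 = 0"
  proof -
    have "\<Phi> (0 + 0) = \<Phi> 0 + \<Phi> 0" using t \<Gamma>_zero unfolding tensorial_at_def by blast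
    then show ?thesis by simp
  qed
  show ?thesis
    using a V
  proof (induction I rule: infinite_finite_induct)
    case (insert i I)
    have "\<Phi> (a i *\<^sub>F V i + (\<Sum>i\<in>I. a i *\<^sub>F V i)) = \<Phi> (a i *\<^sub>F V i) + \<Phi> (\<Sum>i\<in>I. a i *\<^sub>F V i)"
    proof -
      have "a i *\<^sub>F V i \<in> \<Gamma>" "(\<Sum>i\<in>I. a i *\<^sub>F V i) \<in> \<Gamma>"
        using insert.prems by (auto intro!: \<Gamma>_sum \<Gamma>_scale)
      then show ?thesis using t unfolding tensorial_at_def by blast
    qed
    moreover have "\<Phi> (a i *\<^sub>F V i) = a i p * \<Phi> (V i)" using t insert.prems unfolding tensorial_at_def by auto
    moreover have "\<Phi> (\<Sum>i\<in>I. a i *\<^sub>F V i) = (\<Sum>i\<in>I. a i p * \<Phi> (V i))"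
      by (rule insert.IH) (use insert.prems in auto)
    ultimately show ?case unfolding sum.insert[OF insert.hyps] by (simp only:)
  qed (auto simp: z)
qed

text \<open>A bump supported in the domain of the frame turns the local expansion of
  \<open>V\<close> into a global one; since the bump is 1 at \<open>p\<close>, pulling it out as a
  scalar changes nothing there.\<close>

lemma tensorial_pointwise:
  assumes t: "tensorial_at A \<Gamma> p \<Phi>" and V: "V \<in> \<Gamma>" and W: "W \<in> \<Gamma>" and eq: "V p = W p"
  shows "\<Phi> V = \<Phi> W"
proof -
  obtain N and E :: "'e \<Rightarrow> 'a field" and x where N: "open N" "p \<in> N"
    and E: "\<And>b. b \<in> Basis \<Longrightarrow> E b \<in> vector_fields B" and x: "\<And>b. b \<in> Basis \<Longrightarrow> x b \<in> smooth_functions B"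
    and Ex: "\<And>q v. q \<in> N \<Longrightarrow> v \<in> tangent_space B (\<iota> q) \<Longrightarrow> v = (\<Sum>b\<in>Basis. v (x b) *\<^sub>T E b (\<iota> q))"
    by (rule frame_along[of p]) (rule that)
  obtain \<beta> M where b: "\<beta> \<in> smooth_functions A" "p \<in> M" "\<And>q. q \<in> M \<Longrightarrow> \<beta> q = 1" "\<And>q. q \<notin> N \<Longrightarrow> \<beta> q = 0"
    using manifold_bump[OF manifold_A N] by metis
  have *: "\<Phi> V = (\<Sum>b\<in>Basis. V p (x b) * \<Phi> (\<lambda>q. E b (\<iota> q)))" if V: "V \<in> \<Gamma>" for V
  proof -
    have a: "(\<lambda>q. \<beta> q * V q (x b)) \<in> smooth_functions A" if "b \<in> Basis" for b
      by (intro smooth_functions_mult[OF manifold_A] b \<Gamma>D(2)[OF V] x that)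
    have "(\<beta> *\<^sub>F V) q f = (\<Sum>b\<in>Basis. (\<lambda>q. \<beta> q * V q (x b)) *\<^sub>F (\<lambda>q. E b (\<iota> q))) q f" for q f
    proof (cases "q \<in> N")
      case True
      have "V q f = (\<Sum>b\<in>Basis. V q (x b) *\<^sub>T E b (\<iota> q)) f" using Ex[OF True \<Gamma>D(1)[OF V]] by simp
      then show ?thesis by (simp add: sum_distrib_left mult.assoc)
    qed (simp add: b(4))
    then have "\<beta> *\<^sub>F V = (\<Sum>b\<in>Basis. (\<lambda>q. \<beta> q * V q (x b)) *\<^sub>F (\<lambda>q. E b (\<iota> q)))" by blast
    then have "\<Phi> (\<beta> *\<^sub>F V) = (\<Sum>b\<in>Basis. \<beta> p * V p (x b) * \<Phi> (\<lambda>q. E b (\<iota> q)))"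
      using tensorial_sum[OF t a restriction_\<Gamma>[OF E]] by simp
    moreover have "\<Phi> (\<beta> *\<^sub>F V) = \<beta> p * \<Phi> V" using t b(1) V unfolding tensorial_at_def by blast
    ultimately show ?thesis using b(2,3) by simp
  qed
  show ?thesis using *[OF V] *[OF W] eq by simp
qed

lemma field_extension:
  assumes "u \<in> tangent_space B q"
  obtains Y where "Y \<in> vector_fields B" "Y q = u"
proof -
  interpret id: manifold_map B B id
    by unfold_locales (rule manifold_B smooth_map_id)+
  obtain N and E :: "'e \<Rightarrow> 'a field" and x where N: "open N" "q \<in> N"
    and E: "\<And>b. b \<in> Basis \<Longrightarrow> E b \<in> vector_fields B" and x: "\<And>b. b \<in> Basis \<Longrightarrow> x b \<in> smooth_functions B"
    and Ex: "\<And>q v. q \<in> N \<Longrightarrow> v \<in> tangent_space B q \<Longrightarrow> v = (\<Sum>b\<in>Basis. v (x b) *\<^sub>T E b q)"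
    and Ex': "\<And>q a b. q \<in> N \<Longrightarrow> a \<in> Basis \<Longrightarrow> b \<in> Basis \<Longrightarrow> E a q (x b) = (if a = b then 1 else 0)"
    by (rule local_frame[OF manifold_B, of "q"]) (rule that)
  let ?Y = "\<Sum>b\<in>Basis. (\<lambda>_. u (x b)) *\<^sub>F E b"
  have "?Y \<in> vector_fields B" unfolding vector_fields_def
    by (intro id.\<Gamma>_sum id.\<Gamma>_scale smooth_functions_const) (use E in \<open>simp add: vector_fields_def\<close>)
  moreover have "?Y q = u" using Ex[OF N(2) assms] by simp
  ultimately show ?thesis using that by blast
qed

text \<open>Reduces identities for the pullback connection to restrictions of ambient fields, where
  \<open>D\<close> is given by \<open>nablabar\<close>.\<close>

lemma tensorial_vanish:
  assumes t: "tensorial_at A \<Gamma> p \<Phi>" and V: "V \<in> \<Gamma>" and "\<And>Y. Y \<in> vector_fields B \<Longrightarrow> \<Phi> (\<lambda>q. Y (\<iota> q)) = 0"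
  shows "\<Phi> V = 0"
proof -
  obtain Y where Y: "Y \<in> vector_fields B" "Y (\<iota> p) = V p" using field_extension[OF \<Gamma>D(1)[OF V]] by metis
  then show ?thesis using tensorial_pointwise[OF t V restriction_\<Gamma>[OF Y(1)]] assms(3) by simp
qed

text \<open>Near each point the function is a finite sum over a frame, with smooth coefficients;
  smoothness on restrictions of ambient fields thus spreads to all fields along
  \<open>\<iota>\<close>.\<close>

lemma smooth_pointwise_linear:
  assumes add: "\<And>p u v. u \<in> tangent_space B (\<iota> p) \<Longrightarrow> v \<in> tangent_space B (\<iota> p) \<Longrightarrow> \<psi> p (u + v) = \<psi> p u + \<psi> p v"
    and scale: "\<And>p u a. u \<in> tangent_space B (\<iota> p) \<Longrightarrow> \<psi> p (a *\<^sub>T u) = a * \<psi> p u"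
    and smooth: "\<And>Y. Y \<in> vector_fields B \<Longrightarrow> (\<lambda>p. \<psi> p (Y (\<iota> p))) \<in> smooth_functions A"
    and V: "V \<in> \<Gamma>"
  shows "(\<lambda>p. \<psi> p (V p)) \<in> smooth_functions A"
proof (rule smooth_functions_local[OF manifold_A])
  fix p
  obtain N and E :: "'e \<Rightarrow> 'a field" and x where N: "open N" "p \<in> N"
    and E: "\<And>b. b \<in> Basis \<Longrightarrow> E b \<in> vector_fields B" and x: "\<And>b. b \<in> Basis \<Longrightarrow> x b \<in> smooth_functions B"
    and Ex: "\<And>q v. q \<in> N \<Longrightarrow> v \<in> tangent_space B (\<iota> q) \<Longrightarrow> v = (\<Sum>b\<in>Basis. v (x b) *\<^sub>T E b (\<iota> q))"
    by (rule frame_along[of p]) (rule that)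
  let ?g = "\<lambda>q. \<Sum>b\<in>Basis. V q (x b) * \<psi> q (E b (\<iota> q))"
  have g: "?g \<in> smooth_functions A"
    by (intro smooth_functions_sum[OF manifold_A] smooth_functions_mult[OF manifold_A] \<Gamma>D(2)[OF V] x smooth E)
  have Et: "E b (\<iota> q) \<in> tangent_space B (\<iota> q)" if "b \<in> Basis" for b q
    using E[OF that] by (simp add: vector_fields_iff)
  have z: "\<psi> q 0 = 0" for q using add[OF tangent_space_zero[OF manifold_B] tangent_space_zero[OF manifold_B], of q] by simp
  have s: "\<psi> q (\<Sum>b\<in>S. a b *\<^sub>T E b (\<iota> q)) = (\<Sum>b\<in>S. a b * \<psi> q (E b (\<iota> q)))" if "S \<subseteq> Basis" for S a q
    using finite_subset[OF that finite_Basis] that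
  proof (induction S rule: finite_induct)
    case (insert b S)
    have "\<psi> q (a b *\<^sub>T E b (\<iota> q) + (\<Sum>b\<in>S. a b *\<^sub>T E b (\<iota> q))) = \<psi> q (a b *\<^sub>T E b (\<iota> q)) + \<psi> q (\<Sum>b\<in>S. a b *\<^sub>T E b (\<iota> q))"
      by (intro add tangent_space_sum[OF manifold_B] tangent_space_linear(2)[OF manifold_B] Et) (use insert.prems in auto)
    moreover have "\<psi> q (a b *\<^sub>T E b (\<iota> q)) = a b * \<psi> q (E b (\<iota> q))"
      by (intro scale Et) (use insert.prems in auto)
    moreover have "\<psi> q (\<Sum>b\<in>S. a b *\<^sub>T E b (\<iota> q)) = (\<Sum>b\<in>S. a b * \<psi> q (E b (\<iota> q)))"
      by (rule insert.IH) (use insert.prems in auto)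
    ultimately show ?case unfolding sum.insert[OF insert.hyps] by (simp only:)
  qed (simp add: z)
  have "\<psi> q (V q) = ?g q" if "q \<in> N" for q
    using s[OF subset_refl, of q "\<lambda>b. V q (x b)"] Ex[OF that \<Gamma>D(1)[OF V]] by simp
  then show "\<exists>W g. open W \<and> p \<in> W \<and> g \<in> smooth_functions A \<and> (\<forall>q\<in>W. \<psi> q (V q) = g q)"
    using N g by (intro exI[of _ N] exI[of _ ?g]) simp
qed

end

lemma manifold_map_id: "smooth_manifold A \<Longrightarrow> manifold_map A A id"
  by (simp add: manifold_map_def smooth_map_id)

section \<open>Riemannian metrics and orthonormal frames\<close>

locale riemannian_manifold =
  fixes A :: "('b::{t2_space, second_countable_topology}, 'k::euclidean_space) atlas" and g :: "'b metric"
  assumes manifold: "smooth_manifold A" and metric: "riemannian_metric A g"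
begin

sublocale id: manifold_map A A id
  by (rule manifold_map_id[OF manifold])

abbreviation "\<X> \<equiv> vector_fields A"
abbreviation "\<F> \<equiv> smooth_functions A"

lemmas field_add = id.\<Gamma>_add[folded vector_fields_def]
  and field_scale = id.\<Gamma>_scale[folded vector_fields_def]
  and field_diff = id.\<Gamma>_diff[folded vector_fields_def]
  and field_zero = id.\<Gamma>_zero[folded vector_fields_def]
  and field_sum = id.\<Gamma>_sum[folded vector_fields_def]
  and field_at = id.\<Gamma>D(1)[folded vector_fields_def, simplified]
  and field_apply = id.\<Gamma>D(2)[folded vector_fields_def]
  and field_pointwise = id.tensorial_pointwise[folded vector_fields_def]

lemmas tangent_intros = tangent_space_linear[OF manifold] tangent_space_diff[OF manifold]
  tangent_space_minus[OF manifold] tangent_space_zero[OF manifold] tangent_space_sum[OF manifold]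

section \<open>Bilinear algebra of the metric at a point\<close>

lemma g_sym: "u \<in> tangent_space A p \<Longrightarrow> v \<in> tangent_space A p \<Longrightarrow> g p u v = g p v u"
  using metric unfolding riemannian_metric_def by blast

lemma g_add_left:
  "u \<in> tangent_space A p \<Longrightarrow> v \<in> tangent_space A p \<Longrightarrow> w \<in> tangent_space A p \<Longrightarrow>
     g p (u + w) v = g p u v + g p w v"
  using metric unfolding riemannian_metric_def by blast

lemma g_scale_left:
  "u \<in> tangent_space A p \<Longrightarrow> v \<in> tangent_space A p \<Longrightarrow> g p (a *\<^sub>T u) v = a * g p u v"
  using metric unfolding riemannian_metric_def by blast

lemma g_pos: "u \<in> tangent_space A p \<Longrightarrow> u \<noteq> 0 \<Longrightarrow> g p u u > 0"
  using metric unfolding riemannian_metric_def by blast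

lemma g_smooth: "X \<in> \<X> \<Longrightarrow> Y \<in> \<X> \<Longrightarrow> (\<lambda>p. g p (X p) (Y p)) \<in> \<F>"
  using metric unfolding riemannian_metric_def by blast

lemma g_zero_left: "v \<in> tangent_space A p \<Longrightarrow> g p 0 v = 0"
  using g_add_left[of 0 p v 0] tangent_intros(5) by simp

lemma g_diff_left:
  assumes "u \<in> tangent_space A p" "v \<in> tangent_space A p" "w \<in> tangent_space A p"
  shows "g p (u - w) v = g p u v - g p w v"
  using g_add_left[of "u - w" p v w] assms tangent_intros(3) by simp

lemma g_minus_left:
  assumes "u \<in> tangent_space A p" "v \<in> tangent_space A p"
  shows "g p (- u) v = - g p u v"
  using g_diff_left[of 0 p v u] assms tangent_intros(5) g_zero_left by simp

lemma g_add_right: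
  assumes "u \<in> tangent_space A p" "v \<in> tangent_space A p" "w \<in> tangent_space A p"
  shows "g p v (u + w) = g p v u + g p v w"
  using g_add_left[OF assms] g_sym assms tangent_intros(1) by simp

lemma g_scale_right:
  assumes "u \<in> tangent_space A p" "v \<in> tangent_space A p"
  shows "g p v (a *\<^sub>T u) = a * g p v u"
  using g_scale_left[OF assms] g_sym assms tangent_intros(2) by metis

lemma g_diff_right:
  assumes "u \<in> tangent_space A p" "v \<in> tangent_space A p" "w \<in> tangent_space A p"
  shows "g p v (u - w) = g p v u - g p v w"
  using g_diff_left[OF assms] g_sym assms tangent_intros(3) by simp

lemma g_sum_left:
  assumes "\<And>i. i \<in> I \<Longrightarrow> u i \<in> tangent_space A p" "v \<in> tangent_space A p"
  shows "g p (\<Sum>i\<in>I. u i) v = (\<Sum>i\<in>I. g p (u i) v)"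
  using assms(1)
  by (induction I rule: infinite_finite_induct) (auto simp: g_zero_left g_add_left assms(2) tangent_intros(6))

text \<open>Dimension counting is transferred to the model space \<open>'k\<close>, with
  \<open>L\<close> taking coordinates and \<open>M\<close> rebuilding vectors. \<open>\<Psi>\<close>
  sends coefficients with respect to \<open>e\<close> to coordinates, \<open>\<Phi>\<close> takes
  inner products with \<open>e\<close>. Orthonormality gives one composition as the identity, and in
  finite dimension the other one follows.\<close>

lemma orthonormal_expansion:
  fixes e :: "'k \<Rightarrow> 'b tvec"
  assumes e: "\<And>i. i \<in> Basis \<Longrightarrow> e i \<in> tangent_space A p"
    and o: "\<And>i j. i \<in> Basis \<Longrightarrow> j \<in> Basis \<Longrightarrow> g p (e i) (e j) = (if i = j then 1 else 0)"
    and u: "u \<in> tangent_space A p"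
  shows "u = (\<Sum>i\<in>Basis. g p u (e i) *\<^sub>T e i)"
proof -
  obtain N and E :: "'k \<Rightarrow> 'b field" and x where N: "open N" "p \<in> N"
    and E: "\<And>b. b \<in> Basis \<Longrightarrow> E b \<in> vector_fields A" and x: "\<And>b. b \<in> Basis \<Longrightarrow> x b \<in> smooth_functions A"
    and Ex: "\<And>q v. q \<in> N \<Longrightarrow> v \<in> tangent_space A q \<Longrightarrow> v = (\<Sum>b\<in>Basis. v (x b) *\<^sub>T E b q)"
    and Ex': "\<And>q a b. q \<in> N \<Longrightarrow> a \<in> Basis \<Longrightarrow> b \<in> Basis \<Longrightarrow> E a q (x b) = (if a = b then 1 else 0)"
    by (rule local_frame[OF manifold, of "p"]) (rule that)
  define L where "L v = (\<Sum>b\<in>Basis. v (x b) *\<^sub>R b)" for v :: "'b tvec"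
  define M where "M w = (\<Sum>b\<in>Basis. (w \<bullet> b) *\<^sub>T E b p)" for w :: 'k
  have Mt: "M w \<in> tangent_space A p" for w unfolding M_def
    by (intro tangent_intros field_at E)
  have LM: "M (L v) = v" if "v \<in> tangent_space A p" for v
  proof -
    have "L v \<bullet> b = v (x b)" if "b \<in> Basis" for b unfolding L_def using that by simp
    then show ?thesis using Ex[OF N(2) that] unfolding M_def by simp
  qed
  define \<Psi> where "\<Psi> w = (\<Sum>i\<in>Basis. (w \<bullet> i) *\<^sub>R L (e i))" for w :: 'k
  define \<Phi> where "\<Phi> w = (\<Sum>i\<in>Basis. g p (M w) (e i) *\<^sub>R i)" for w :: 'k
  have l1: "linear \<Psi>" unfolding \<Psi>_def
    by (rule linearI) (simp_all add: inner_add_left scaleR_add_left sum.distrib scaleR_sum_right)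
  have "M (v + w) = M v + M w" "M (a *\<^sub>R v) = a *\<^sub>T M v" for v w a
    by (auto simp: M_def inner_add_left sum.distrib distrib_right sum_distrib_left mult.assoc)
  then have l2: "linear \<Phi>" unfolding \<Phi>_def
    by (intro linearI) (simp_all add: g_add_left g_scale_left Mt e scaleR_add_left sum.distrib scaleR_sum_right)
  have M\<Psi>: "M (\<Psi> w) = (\<Sum>i\<in>Basis. (w \<bullet> i) *\<^sub>T e i)" for w
  proof -
    have "M (\<Psi> w) f = (\<Sum>i\<in>Basis. (w \<bullet> i) * M (L (e i)) f)" for f
    proof -
      have "M (\<Psi> w) f = (\<Sum>b\<in>Basis. \<Sum>i\<in>Basis. (w \<bullet> i) * ((L (e i) \<bullet> b) * E b p f))"
        by (simp add: M_def \<Psi>_def inner_sum_left sum_distrib_right mult.assoc)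
      also have "\<dots> = (\<Sum>i\<in>Basis. \<Sum>b\<in>Basis. (w \<bullet> i) * ((L (e i) \<bullet> b) * E b p f))"
        by (rule sum.swap)
      finally show ?thesis by (simp add: M_def sum_distrib_left)
    qed
    then show ?thesis using LM[OF e] by auto
  qed
  have "\<Phi> (\<Psi> w) = w" for w
  proof -
    have "g p (M (\<Psi> w)) (e j) = w \<bullet> j" if "j \<in> Basis" for j
    proof -
      have "g p (M (\<Psi> w)) (e j) = (\<Sum>i\<in>Basis. (w \<bullet> i) * g p (e i) (e j))"
        unfolding M\<Psi> using that by (simp add: g_sum_left g_scale_left tangent_intros e)
      also have "\<dots> = (\<Sum>i\<in>Basis. if i = j then w \<bullet> i else 0)" using that o by (intro sum.cong) auto
      finally show ?thesis using that by simp
    qed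
    then show ?thesis by (simp add: \<Phi>_def euclidean_representation)
  qed
  then have "\<Phi> \<circ> \<Psi> = id" by auto
  then have "\<Psi> \<circ> \<Phi> = id" using linear_inverse_left[OF l1 l2] by simp
  then have "M (\<Psi> (\<Phi> (L u))) = u" using LM[OF u] by (metis comp_apply id_apply)
  then show ?thesis unfolding M\<Psi> by (simp add: \<Phi>_def LM[OF u])
qed

lemma orthonormal_at_tangent:
  assumes "orthonormal_at A g p E" "u \<in> tangent_space A p"
  shows "u = (\<Sum>i\<in>Basis. g p u (E i p) *\<^sub>T E i p)"
  by (rule orthonormal_expansion) (use assms in \<open>auto simp: orthonormal_at_def intro: field_at\<close>)

text \<open>The normalising factor is smooth only where \<open>s\<close> is positive, but
  \<open>\<F>\<close> consists of functions on the whole manifold. Cutting off the inverse square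
  root near \<open>s p\<close> gives a function smooth on the whole line that is unchanged near this
  value.\<close>

lemma inverse_sqrt_smooth:
  assumes s: "s \<in> \<F>" and p: "s p > 0"
  obtains r N where "r \<in> \<F>" "open N" "p \<in> N" "\<And>q. q \<in> N \<Longrightarrow> s q > 0 \<and> r q = inverse (sqrt (s q))"
proof -
  obtain \<chi>' :: "real \<Rightarrow> real" and M K where b: "smooth_on UNIV \<chi>'" "open M" "s p \<in> M" "\<And>x. x \<in> M \<Longrightarrow> \<chi>' x = 1"
    "compact K" "M \<subseteq> K" "K \<subseteq> {0<..}" "\<And>x. x \<notin> K \<Longrightarrow> \<chi>' x = 0"
    using bump_exists[of "{0<..}" "s p"] p by (metis greaterThan_iff open_greaterThan)
  define \<rho> where "\<rho> t = \<chi>' t * inverse (sqrt t)" for t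
  have s1: "smooth_on {0<..} (\<lambda>t::real. inverse (sqrt t))"
    by (rule smooth_on_compose[of _ "- {0}" inverse]) (auto simp: smooth_on_def differentiable_order_on_inverse differentiable_order_on_sqrt)
  have "smooth_on UNIV \<rho>"
  proof (rule smooth_on_local)
    fix x :: real
    show "\<exists>T. open T \<and> x \<in> T \<and> smooth_on T \<rho>"
    proof (cases "x > 0")
      case True
      have "smooth_on {0<..} \<rho>" unfolding \<rho>_def
        by (intro smooth_on_mult s1 smooth_on_subset[OF b(1)]) auto
      then show ?thesis using True by (intro exI[of _ "{0<..}"]) auto
    next
      case False
      have o: "open (- K)" using b(5) compact_imp_closed by blast
      have "smooth_on (- K) \<rho>"
        by (rule smooth_on_congI[OF o smooth_on_const[of _ 0]]) (simp add: \<rho>_def b(8))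
      moreover have "x \<in> - K" using False b(7) by auto
      ultimately show ?thesis using o by blast
    qed
  qed
  then have r: "(\<lambda>q. \<rho> (s q)) \<in> \<F>" by (rule smooth_functions_compose[OF manifold _ s])
  have "continuous_on UNIV s"
  proof -
    have "isCont s q" for q
    proof -
      obtain U c where U: "(U, c) \<in> A" "q \<in> U" using chart_exists[OF manifold] .
      have c1: "continuous_on (c ` U) (\<lambda>x. s (inv_into U c x))"
        using smooth_functionsD[OF s U(1)] unfolding smooth_on_def by (meson differentiable_order_on_imp_continuous_on)
      have "continuous_on U (\<lambda>q. s (inv_into U c (c q)))"
        by (rule continuous_on_compose2[OF c1 chartD(3)[OF manifold U(1)]]) auto
      then have "continuous_on U s" by (rule continuous_on_eq) (simp add: chartD(5)[OF manifold U(1)])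
      then show ?thesis using chartD(1)[OF manifold U(1)] U(2) continuous_on_eq_continuous_at by blast
    qed
    then show ?thesis by (simp add: continuous_at_imp_continuous_on)
  qed
  then have o: "open (s -` M)" using b(2) open_vimage by blast
  show ?thesis
    by (rule that[OF r o]) (use b in \<open>auto simp: \<rho>_def\<close>)
qed

text \<open>The clause on coordinates outside \<open>S\<close> records that at \<open>p\<close> the
  fields built so far lie in the span of the \<open>E\<close> with index in \<open>S\<close>. It
  keeps the \<open>s\<close>-coordinate of the next vector \<open>W\<close> equal to 1 at
  \<open>p\<close>, so \<open>W\<close> does not vanish there and can be normalised nearby.\<close>

lemma gram_schmidt:
  fixes E :: "'k \<Rightarrow> 'b field"
  assumes E: "\<And>b. b \<in> Basis \<Longrightarrow> E b \<in> \<X>"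
    and Ex: "\<And>a b. a \<in> Basis \<Longrightarrow> b \<in> Basis \<Longrightarrow> E a p (x b) = (if a = b then 1 else 0)"
    and S: "finite S" "S \<subseteq> Basis"
  shows "\<exists>N F. open N \<and> p \<in> N \<and> (\<forall>i\<in>S. F i \<in> \<X> \<and> (\<forall>b\<in>Basis - S. F i p (x b) = 0)) \<and>
     (\<forall>q\<in>N. \<forall>i\<in>S. \<forall>j\<in>S. g q (F i q) (F j q) = (if i = j then 1 else 0))"
  using S
proof (induction S rule: finite_induct)
  case empty
  then show ?case by (intro exI[of _ UNIV]) auto
next
  case (insert s S)
  have "S \<subseteq> Basis" using insert.prems by auto
  from insert.IH[OF this] obtain N F where N: "open N" "p \<in> N" and *: "\<forall>i\<in>S. F i \<in> \<X> \<and> (\<forall>b\<in>Basis - S. F i p (x b) = 0)"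
    "\<forall>q\<in>N. \<forall>i\<in>S. \<forall>j\<in>S. g q (F i q) (F j q) = (if i = j then 1 else 0)"
    by blast
  have F: "\<And>i. i \<in> S \<Longrightarrow> F i \<in> \<X>"
    and Fx: "\<And>i b. i \<in> S \<Longrightarrow> b \<in> Basis - S \<Longrightarrow> F i p (x b) = 0"
    and on: "\<And>q i j. q \<in> N \<Longrightarrow> i \<in> S \<Longrightarrow> j \<in> S \<Longrightarrow> g q (F i q) (F j q) = (if i = j then 1 else 0)"
    using * by blast+
  have sB: "s \<in> Basis" using insert.prems by auto
  define W where "W = E s - (\<Sum>i\<in>S. (\<lambda>q. g q (E s q) (F i q)) *\<^sub>F F i)"
  have W: "W \<in> \<X>" unfolding W_def
    by (intro field_diff field_sum field_scale g_smooth F E sB)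
  have "W p (x s) = 1" using Ex[OF sB sB] Fx insert.hyps sB by (simp add: W_def)
  then have "g p (W p) (W p) > 0" using g_pos[OF field_at[OF W]] by force
  then obtain r M where r: "r \<in> \<F>" "open M" "p \<in> M"
    "\<And>q. q \<in> M \<Longrightarrow> g q (W q) (W q) > 0 \<and> r q = inverse (sqrt (g q (W q) (W q)))"
    using inverse_sqrt_smooth[OF g_smooth[OF W W]] by metis
  define G where "G = F(s := r *\<^sub>F W)"
  have rW: "r *\<^sub>F W \<in> \<X>" using field_scale r W by blast
  have perp: "g q (W q) (F j q) = 0" if "q \<in> N" "j \<in> S" for q j
  proof -
    have "g q (W q) (F j q) = g q (E s q) (F j q) - (\<Sum>i\<in>S. g q (E s q) (F i q) * g q (F i q) (F j q))"
      unfolding W_def using that F E[OF sB]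
      by (simp add: g_diff_left g_sum_left g_scale_left tangent_intros field_at)
    also have "(\<Sum>i\<in>S. g q (E s q) (F i q) * g q (F i q) (F j q)) = (\<Sum>i\<in>S. if i = j then g q (E s q) (F i q) else 0)"
      using on that by (intro sum.cong) auto
    finally show ?thesis using that insert.hyps by simp
  qed
  have p1: "g q ((r *\<^sub>F W) q) (F j q) = 0" "g q (F j q) ((r *\<^sub>F W) q) = 0" if "q \<in> N" "j \<in> S" for q j
  proof -
    show "g q ((r *\<^sub>F W) q) (F j q) = 0"
      using perp[OF that] g_scale_left[OF field_at[OF W] field_at[OF F[OF that(2)]]] by simp
    then show "g q (F j q) ((r *\<^sub>F W) q) = 0"
      using g_sym[OF field_at[OF rW] field_at[OF F[OF that(2)]], of q] by (simp only:)
  qed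
  have p2: "g q ((r *\<^sub>F W) q) ((r *\<^sub>F W) q) = 1" if "q \<in> M" for q
  proof -
    have "g q ((r *\<^sub>F W) q) ((r *\<^sub>F W) q) = r q * g q (W q) ((r *\<^sub>F W) q)"
      using g_scale_left[OF field_at[OF W] field_at[OF rW]] by simp
    also have "g q (W q) ((r *\<^sub>F W) q) = r q * g q (W q) (W q)"
      using g_scale_left[OF field_at[OF W] field_at[OF W]] g_sym[OF field_at[OF W] field_at[OF rW]] by simp
    finally have "g q ((r *\<^sub>F W) q) ((r *\<^sub>F W) q) = (r q)\<^sup>2 * g q (W q) (W q)"
      by (simp only: power2_eq_square mult.assoc)
    then show ?thesis using r(4)[OF that] by (simp add: power_inverse)
  qed
  show ?case
  proof (intro exI[of _ "N \<inter> M"] exI[of _ G] conjI ballI)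
    show "open (N \<inter> M)" "p \<in> N \<inter> M" using N r by auto
    fix i assume i: "i \<in> insert s S"
    show "G i \<in> \<X>" using i rW F by (auto simp: G_def)
    fix b :: 'k assume b: "b \<in> Basis - insert s S"
    have "W p (x b) = 0" using Ex[OF sB, of b] Fx b by (auto simp: W_def intro!: sum.neutral)
    then show "G i p (x b) = 0" using i b Fx by (auto simp: G_def)
  next
    fix q i j assume "q \<in> N \<inter> M" "i \<in> insert s S" "j \<in> insert s S"
    then show "g q (G i q) (G j q) = (if i = j then 1 else 0)"
      using p1[of q] p2[of q] on[of q i j] insert.hyps by (auto simp: G_def simp del: fscale_apply)
  qed
qed

lemma orthonormal_frame:
  obtains N F where "open N" "p \<in> N" "\<And>q. q \<in> N \<Longrightarrow> orthonormal_at A g q F"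
proof -
  obtain N and E :: "'k \<Rightarrow> 'b field" and x where N: "open N" "p \<in> N"
    and E: "\<And>b. b \<in> Basis \<Longrightarrow> E b \<in> vector_fields A" and x: "\<And>b. b \<in> Basis \<Longrightarrow> x b \<in> smooth_functions A"
    and Ex: "\<And>q v. q \<in> N \<Longrightarrow> v \<in> tangent_space A q \<Longrightarrow> v = (\<Sum>b\<in>Basis. v (x b) *\<^sub>T E b q)"
    and Ex': "\<And>q a b. q \<in> N \<Longrightarrow> a \<in> Basis \<Longrightarrow> b \<in> Basis \<Longrightarrow> E a q (x b) = (if a = b then 1 else 0)"
    by (rule local_frame[OF manifold, of "p"]) (rule that)
  from gram_schmidt[OF E Ex'[OF N(2)] finite_Basis subset_refl]
  obtain M and F :: "'k \<Rightarrow> 'b field" where "open M" "p \<in> M" "\<forall>i\<in>Basis. F i \<in> \<X>"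
    "\<forall>q\<in>M. \<forall>i\<in>Basis. \<forall>j\<in>Basis. g q (F i q) (F j q) = (if i = j then 1 else 0)" by blast
  then show ?thesis using that[of M F] unfolding orthonormal_at_def by blast
qed

lemma tensorial_expansion:
  assumes t: "tensorial_at A \<X> p \<Phi>" and E: "orthonormal_at A g p E" and V: "V \<in> \<X>"
  shows "\<Phi> V = (\<Sum>i\<in>Basis. g p (V p) (E i p) * \<Phi> (E i))"
proof -
  have EX: "E i \<in> \<X>" if "i \<in> Basis" for i using E that by (simp add: orthonormal_at_def)
  \<comment> \<open>Constant coefficients suffice, since a tensorial functional sees only the value
    of the field at \<open>p\<close>.\<close>
  let ?W = "\<Sum>i\<in>Basis. (\<lambda>_. g p (V p) (E i p)) *\<^sub>F E i"
  have "\<Phi> V = \<Phi> ?W"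
  proof (rule field_pointwise[OF t V])
    show "?W \<in> \<X>" by (intro field_sum field_scale smooth_functions_const EX)
    show "V p = ?W p" using orthonormal_at_tangent[OF E field_at[OF V, of p]] by simp
  qed
  also have "\<dots> = (\<Sum>i\<in>Basis. g p (V p) (E i p) * \<Phi> (E i))"
    by (rule id.tensorial_sum[folded vector_fields_def, OF t, of Basis "\<lambda>i _. g p (V p) (E i p)"])
      (auto intro: smooth_functions_const EX)
  finally show ?thesis .
qed

text \<open>Expand the first argument \<open>E i\<close> in the frame \<open>F\<close> and exchange
  the sums; by symmetry of the metric the sum over \<open>i\<close> is then the expansion of
  \<open>F k\<close> in \<open>E\<close>, now in the second argument.\<close>

lemma trace_frame_independent:
  assumes t1: "\<And>V. V \<in> \<X> \<Longrightarrow> tensorial_at A \<X> p (\<lambda>W. \<Phi> V W)"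
    and t2: "\<And>V. V \<in> \<X> \<Longrightarrow> tensorial_at A \<X> p (\<lambda>W. \<Phi> W V)"
    and E: "orthonormal_at A g p E" and F: "orthonormal_at A g p F"
  shows "(\<Sum>i\<in>Basis. \<Phi> (E i) (E i)) = (\<Sum>i\<in>Basis. \<Phi> (F i) (F i))"
proof -
  have EX: "E i \<in> \<X>" and FX: "F i \<in> \<X>" if "i \<in> Basis" for i using E F that by (simp_all add: orthonormal_at_def)
  have "(\<Sum>i\<in>Basis. \<Phi> (E i) (E i)) = (\<Sum>i\<in>Basis. \<Sum>k\<in>Basis. g p (E i p) (F k p) * \<Phi> (F k) (E i))"
    using tensorial_expansion[OF t2 F EX] EX by (intro sum.cong) auto
  also have "\<dots> = (\<Sum>k\<in>Basis. \<Sum>i\<in>Basis. g p (E i p) (F k p) * \<Phi> (F k) (E i))" by (rule sum.swap)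
  also have "\<dots> = (\<Sum>k\<in>Basis. \<Sum>i\<in>Basis. g p (F k p) (E i p) * \<Phi> (F k) (E i))"
    using g_sym[OF field_at[OF EX] field_at[OF FX]] by (intro sum.cong) auto
  also have "\<dots> = (\<Sum>k\<in>Basis. \<Phi> (F k) (F k))"
    using tensorial_expansion[OF t1 E FX] FX by (intro sum.cong) auto
  finally show ?thesis .
qed

end

section \<open>Connections and curvature\<close>

locale connection = manifold_map A B \<iota>
  for A :: "('b::{t2_space, second_countable_topology}, 'k::euclidean_space) atlas"
    and B :: "('a::{t2_space, second_countable_topology}, 'e::euclidean_space) atlas"
    and \<iota> :: "'b \<Rightarrow> 'a" +
  fixes D :: "'b field \<Rightarrow> ('b \<Rightarrow> 'a tvec) \<Rightarrow> ('b \<Rightarrow> 'a tvec)"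
  assumes connection: "connection_on A (fields_along A B \<iota>) D"
begin

interpretation idA: manifold_map A A id
  by (rule manifold_map_id[OF manifold_A])

lemmas zero_field = idA.\<Gamma>_zero[folded vector_fields_def]
  and diff_field = idA.\<Gamma>_diff[folded vector_fields_def]

lemma
  assumes "X \<in> vector_fields A" "V \<in> \<Gamma>"
  shows D_closed: "D X V \<in> \<Gamma>"
    and D_add_left: "Y \<in> vector_fields A \<Longrightarrow> D (X + Y) V = D X V + D Y V"
    and D_add_right: "W \<in> \<Gamma> \<Longrightarrow> D X (V + W) = D X V + D X W"
    and D_scale_left: "a \<in> smooth_functions A \<Longrightarrow> D (a *\<^sub>F X) V = a *\<^sub>F D X V"
    and D_scale_right: "a \<in> smooth_functions A \<Longrightarrow> D X (a *\<^sub>F V) = (\<lambda>p. X p a) *\<^sub>F V + a *\<^sub>F D X V"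
  using connection assms unfolding connection_on_def by blast+

lemma D_zero_right: "X \<in> vector_fields A \<Longrightarrow> D X 0 = 0"
  using D_add_right[of X 0 0] \<Gamma>_zero by simp

lemma D_diff_left:
  assumes "X \<in> vector_fields A" "Y \<in> vector_fields A" "V \<in> \<Gamma>"
  shows "D (X - Y) V = D X V - D Y V"
  using D_add_left[OF diff_field[OF assms(1,2)] assms(3,2)] by (simp add: eq_diff_eq)

lemma D_minus_left:
  assumes "X \<in> vector_fields A" "V \<in> \<Gamma>"
  shows "D (- X) V = - D X V"
  using D_diff_left[OF assms(1,1,2)] D_diff_left[OF zero_field assms] by simp

end

locale levi_civita_manifold = riemannian_manifold A g
  for A :: "('b::{t2_space, second_countable_topology}, 'k::euclidean_space) atlas" and g :: "'b metric" +
  fixes nabla :: "'b field \<Rightarrow> 'b field \<Rightarrow> 'b field"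
  assumes levi_civita: "levi_civita A g nabla"
begin

sublocale conn: connection A A id nabla
  using levi_civita by unfold_locales (simp add: levi_civita_def vector_fields_def)

lemmas nabla_closed = conn.D_closed[folded vector_fields_def]
  and nabla_add_left = conn.D_add_left[folded vector_fields_def]
  and nabla_add_right = conn.D_add_right[folded vector_fields_def]
  and nabla_scale_left = conn.D_scale_left[folded vector_fields_def]
  and nabla_scale_right = conn.D_scale_right[folded vector_fields_def]
  and nabla_zero_right = conn.D_zero_right[folded vector_fields_def]
  and nabla_diff_left = conn.D_diff_left[folded vector_fields_def]
  and nabla_minus_left = conn.D_minus_left[folded vector_fields_def]

section \<open>Bracket, curvature and scalar curvature of the Levi-Civita connection\<close>

lemma torsion_free: "X \<in> \<X> \<Longrightarrow> Y \<in> \<X> \<Longrightarrow> lie_bracket X Y = nabla X Y - nabla Y X"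
  using levi_civita unfolding levi_civita_def by metis

lemma metric_compatible:
  "X \<in> \<X> \<Longrightarrow> Y \<in> \<X> \<Longrightarrow> Z \<in> \<X> \<Longrightarrow>
     X p (\<lambda>q. g q (Y q) (Z q)) = g p (nabla X Y p) (Z p) + g p (Y p) (nabla X Z p)"
  using levi_civita unfolding levi_civita_def by blast

text \<open>Torsion freeness expresses the bracket through \<open>nabla\<close>, so its closure and
  product rules are inherited from the axioms of a connection instead of coming from second
  derivatives of functions.\<close>

lemma bracket_closed: "X \<in> \<X> \<Longrightarrow> Y \<in> \<X> \<Longrightarrow> lie_bracket X Y \<in> \<X>"
  by (simp add: torsion_free field_diff nabla_closed)

lemma bracket_add: 
  assumes "X \<in> \<X>" "X' \<in> \<X>" "Y \<in> \<X>"
  shows "lie_bracket (X + X') Y = lie_bracket X Y + lie_bracket X' Y"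
  using assms by (simp add: torsion_free field_add nabla_add_left nabla_add_right)

lemma bracket_scale:
  assumes "X \<in> \<X>" "Y \<in> \<X>" "a \<in> \<F>"
  shows "lie_bracket (a *\<^sub>F X) Y = a *\<^sub>F lie_bracket X Y - (\<lambda>p. Y p a) *\<^sub>F X"
  by (intro ext)
    (simp add: assms torsion_free field_scale nabla_scale_left nabla_scale_right algebra_simps)

lemma bracket_swap: "lie_bracket Y X = - lie_bracket X Y"
  by (intro ext) (simp add: lie_bracket_def)

lemma curvature_closed:
  assumes "X \<in> \<X>" "Y \<in> \<X>" "Z \<in> \<X>"
  shows "curvature nabla X Y Z \<in> \<X>"
  unfolding curvature_def using assms by (intro field_diff nabla_closed bracket_closed)

lemma curvature_add_1:
  assumes X: "X \<in> \<X>" and X': "X' \<in> \<X>" and Y: "Y \<in> \<X>" and Z: "Z \<in> \<X>"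
  shows "curvature nabla (X + X') Y Z = curvature nabla X Y Z + curvature nabla X' Y Z"
proof -
  have e1: "nabla (X + X') (nabla Y Z) = nabla X (nabla Y Z) + nabla X' (nabla Y Z)"
    by (intro nabla_add_left nabla_closed X X' Y Z)
  have e2: "nabla Y (nabla (X + X') Z) = nabla Y (nabla X Z) + nabla Y (nabla X' Z)"
    unfolding nabla_add_left[OF X Z X'] by (intro nabla_add_right nabla_closed X X' Y Z)
  have e3: "nabla (lie_bracket (X + X') Y) Z = nabla (lie_bracket X Y) Z + nabla (lie_bracket X' Y) Z"
    unfolding bracket_add[OF X X' Y] by (intro nabla_add_left bracket_closed X X' Y Z)
  show ?thesis unfolding curvature_def e1 e2 e3 by (simp add: algebra_simps)
qed

text \<open>The derivative of \<open>a\<close> along \<open>Y\<close> enters once through the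
  product rule and once through the bracket; the two multiples of \<open>nabla X Z\<close>
  cancel.\<close>

lemma curvature_scale_1:
  assumes X: "X \<in> \<X>" and Y: "Y \<in> \<X>" and Z: "Z \<in> \<X>" and a: "a \<in> \<F>"
  shows "curvature nabla (a *\<^sub>F X) Y Z = a *\<^sub>F curvature nabla X Y Z"
proof -
  have Ya: "(\<lambda>p. Y p a) \<in> \<F>" by (rule field_apply[OF Y a])
  have e1: "nabla (a *\<^sub>F X) (nabla Y Z) = a *\<^sub>F nabla X (nabla Y Z)"
    by (intro nabla_scale_left nabla_closed X Y Z a)
  have e2: "nabla Y (nabla (a *\<^sub>F X) Z) = (\<lambda>p. Y p a) *\<^sub>F nabla X Z + a *\<^sub>F nabla Y (nabla X Z)"
    unfolding nabla_scale_left[OF X Z a] by (intro nabla_scale_right nabla_closed X Y Z a)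
  have e3: "nabla (lie_bracket (a *\<^sub>F X) Y) Z = a *\<^sub>F nabla (lie_bracket X Y) Z - (\<lambda>p. Y p a) *\<^sub>F nabla X Z"
    unfolding bracket_scale[OF X Y a]
    using nabla_diff_left[OF field_scale[OF a bracket_closed[OF X Y]] field_scale[OF Ya X] Z]
      nabla_scale_left[OF bracket_closed[OF X Y] Z a] nabla_scale_left[OF X Z Ya] by (simp only:)
  show ?thesis unfolding curvature_def e1 e2 e3 by (intro ext) (simp add: algebra_simps)
qed

lemma curvature_swap:
  assumes X: "X \<in> \<X>" and Y: "Y \<in> \<X>" and Z: "Z \<in> \<X>"
  shows "curvature nabla Y X Z = - curvature nabla X Y Z"
  unfolding curvature_def bracket_swap[of Y X] nabla_minus_left[OF bracket_closed[OF X Y] Z]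
  by (simp add: algebra_simps)

lemma curvature_add_3:
  assumes X: "X \<in> \<X>" and Y: "Y \<in> \<X>" and Z: "Z \<in> \<X>" and Z': "Z' \<in> \<X>"
  shows "curvature nabla X Y (Z + Z') = curvature nabla X Y Z + curvature nabla X Y Z'"
proof -
  have e: "nabla X (nabla Y (Z + Z')) = nabla X (nabla Y Z) + nabla X (nabla Y Z')"
    if X: "X \<in> \<X>" and Y: "Y \<in> \<X>" for X Y
    unfolding nabla_add_right[OF Y Z Z'] by (intro nabla_add_right nabla_closed X Y Z Z')
  show ?thesis 
    unfolding curvature_def e[OF X Y] e[OF Y X] nabla_add_right[OF bracket_closed[OF X Y] Z Z']
    by (simp add: algebra_simps)
qed

text \<open>The mixed first-order terms are symmetric in \<open>X\<close> and \<open>Y\<close>, and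
  the second derivatives of \<open>a\<close> cancel against its derivative along the
  bracket.\<close>

lemma curvature_scale_3:
  assumes X: "X \<in> \<X>" and Y: "Y \<in> \<X>" and Z: "Z \<in> \<X>" and a: "a \<in> \<F>"
  shows "curvature nabla X Y (a *\<^sub>F Z) = a *\<^sub>F curvature nabla X Y Z"
proof -
  have e: "nabla X (nabla Y (a *\<^sub>F Z)) = ((\<lambda>p. X p (\<lambda>q. Y q a)) *\<^sub>F Z + (\<lambda>p. Y p a) *\<^sub>F nabla X Z) +
     ((\<lambda>p. X p a) *\<^sub>F nabla Y Z + a *\<^sub>F nabla X (nabla Y Z))"
    if X: "X \<in> \<X>" and Y: "Y \<in> \<X>" for X Y
  proof -
    have Ya: "(\<lambda>p. Y p a) \<in> \<F>" by (rule field_apply[OF Y a])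
    show ?thesis
      unfolding nabla_scale_right[OF Y Z a]
        nabla_add_right[OF X field_scale[OF Ya Z] field_scale[OF a nabla_closed[OF Y Z]]]
        nabla_scale_right[OF X Z Ya] nabla_scale_right[OF X nabla_closed[OF Y Z] a] ..
  qed
  show ?thesis 
    unfolding curvature_def e[OF X Y] e[OF Y X] nabla_scale_right[OF bracket_closed[OF X Y] Z a]
    by (intro ext) (simp add: lie_bracket_def algebra_simps)
qed

lemma curvature_tensorial:
  assumes "X \<in> \<X>" "Y \<in> \<X>" "Z \<in> \<X>"
  shows "tensorial_at A \<X> p (\<lambda>V. g p (curvature nabla V Y Z p) (X p))"
    and "tensorial_at A \<X> p (\<lambda>V. g p (curvature nabla Y V Z p) (X p))"
    and "tensorial_at A \<X> p (\<lambda>V. g p (curvature nabla Y Z V p) (X p))"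
    and "tensorial_at A \<X> p (\<lambda>V. g p (curvature nabla X Y Z p) (V p))"
proof -
  have 1: "tensorial_at A \<X> p (\<lambda>V. g p (curvature nabla V Y Z p) (X p))" if "Y \<in> \<X>" "Z \<in> \<X>" for Y Z
    using that assms(1) unfolding tensorial_at_def
    by (auto simp: curvature_add_1 curvature_scale_1 g_add_left g_scale_left field_at curvature_closed)
  show "tensorial_at A \<X> p (\<lambda>V. g p (curvature nabla V Y Z p) (X p))" by (rule 1[OF assms(2,3)])
  show "tensorial_at A \<X> p (\<lambda>V. g p (curvature nabla Y V Z p) (X p))"
  proof -
    have "g p (curvature nabla Y V Z p) (X p) = - g p (curvature nabla V Y Z p) (X p)" if "V \<in> \<X>" for V
      using curvature_swap[OF that assms(2,3)] that assms
      by (simp add: g_minus_left field_at curvature_closed)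
    then show ?thesis using 1[OF assms(2,3)] unfolding tensorial_at_def
      by (simp add: field_add field_scale)
  qed
  show "tensorial_at A \<X> p (\<lambda>V. g p (curvature nabla Y Z V p) (X p))"
    using assms unfolding tensorial_at_def
    by (auto simp: curvature_add_3 curvature_scale_3 g_add_left g_scale_left field_at curvature_closed)
  show "tensorial_at A \<X> p (\<lambda>V. g p (curvature nabla X Y Z p) (V p))"
    using assms unfolding tensorial_at_def
    by (simp add: g_add_right g_scale_right field_at curvature_closed)
qed

text \<open>The frame chosen by \<open>SOME\<close> may jump from point to point, so smoothness is
  invisible in the definition. A frame of one's own is substituted in two rounds: in the inner
  trace, then in the outer one.\<close>

lemma scalar_curvature_frame:
  assumes F: "orthonormal_at A g p F"
  shows "scalar_curvature A g nabla p =
    (\<Sum>i\<in>Basis. \<Sum>j\<in>Basis. g p (curvature nabla (F i) (F j) (F j) p) (F i p))"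
proof -
  define E where "E = (SOME E. orthonormal_at A g p E)"
  have E: "orthonormal_at A g p E" unfolding E_def using F someI[of "orthonormal_at A g p" F] by simp
  have EX: "E i \<in> \<X>" and FX: "F i \<in> \<X>" if "i \<in> Basis" for i using E F that by (simp_all add: orthonormal_at_def)
  have "scalar_curvature A g nabla p = (\<Sum>i\<in>Basis. \<Sum>j\<in>Basis. g p (curvature nabla (E i) (E j) (E j) p) (E i p))"
    by (simp add: scalar_curvature_def E_def Let_def)
  also have "\<dots> = (\<Sum>i\<in>Basis. \<Sum>j\<in>Basis. g p (curvature nabla (E i) (F j) (F j) p) (E i p))"
  proof (rule sum.cong[OF refl])
    fix i :: 'k assume i: "i \<in> Basis"
    show "(\<Sum>j\<in>Basis. g p (curvature nabla (E i) (E j) (E j) p) (E i p)) =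
      (\<Sum>j\<in>Basis. g p (curvature nabla (E i) (F j) (F j) p) (E i p))"
      by (rule trace_frame_independent[where \<Phi> = "\<lambda>V W. g p (curvature nabla (E i) V W p) (E i p)", OF _ _ E F])
        (intro curvature_tensorial EX i; assumption)+
  qed
  also have "\<dots> = (\<Sum>j\<in>Basis. \<Sum>i\<in>Basis. g p (curvature nabla (E i) (F j) (F j) p) (E i p))"
    by (rule sum.swap)
  also have "\<dots> = (\<Sum>j\<in>Basis. \<Sum>i\<in>Basis. g p (curvature nabla (F i) (F j) (F j) p) (F i p))"
  proof (rule sum.cong[OF refl])
    fix j :: 'k assume j: "j \<in> Basis"
    show "(\<Sum>i\<in>Basis. g p (curvature nabla (E i) (F j) (F j) p) (E i p)) =
      (\<Sum>i\<in>Basis. g p (curvature nabla (F i) (F j) (F j) p) (F i p))"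
      by (rule trace_frame_independent[where \<Phi> = "\<lambda>V W. g p (curvature nabla V (F j) (F j) p) (W p)", OF _ _ E F])
        (intro curvature_tensorial FX j; assumption)+
  qed
  also have "\<dots> = (\<Sum>i\<in>Basis. \<Sum>j\<in>Basis. g p (curvature nabla (F i) (F j) (F j) p) (F i p))"
    by (rule sum.swap)
  finally show ?thesis .
qed

lemma scalar_curvature_smooth: "scalar_curvature A g nabla \<in> \<F>"
proof (rule smooth_functions_local[OF manifold])
  fix p
  obtain N and F :: "'k \<Rightarrow> 'b field" where N: "open N" "p \<in> N" and F: "\<And>q. q \<in> N \<Longrightarrow> orthonormal_at A g q F"
    by (rule orthonormal_frame[of p]) (rule that)
  let ?s = "\<lambda>q. \<Sum>i\<in>Basis. \<Sum>j\<in>Basis. g q (curvature nabla (F i) (F j) (F j) q) (F i q)"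
  have FX: "F i \<in> \<X>" if "i \<in> Basis" for i using F[OF N(2)] that by (simp add: orthonormal_at_def)
  have "?s \<in> \<F>" by (intro smooth_functions_sum[OF manifold] g_smooth curvature_closed FX)
  then show "\<exists>W s. open W \<and> p \<in> W \<and> s \<in> \<F> \<and> (\<forall>q\<in>W. scalar_curvature A g nabla q = s q)"
    using N scalar_curvature_frame[OF F] by (intro exI[of _ N] exI[of _ ?s]) simp
qed

lemma concircular_curvature_closed:
  assumes X: "X \<in> \<X>" and Y: "Y \<in> \<X>" and Z: "Z \<in> \<X>"
  shows "concircular_curvature n A g nabla X Y Z \<in> \<X>"
proof -
  let ?s = "\<lambda>p. scalar_curvature A g nabla p / (2 * real n * (2 * real n + 1))"
  have s: "?s \<in> \<F>"
    using smooth_functions_mult[OF manifold scalar_curvature_smooth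
        smooth_functions_const[of "1 / (2 * real n * (2 * real n + 1))"]] by simp
  have "curvature nabla X Y Z - ?s *\<^sub>F ((\<lambda>p. g p (Y p) (Z p)) *\<^sub>F X - (\<lambda>p. g p (X p) (Z p)) *\<^sub>F Y) \<in> \<X>"
    by (intro field_diff field_scale curvature_closed g_smooth s X Y Z)
  moreover have "curvature nabla X Y Z - ?s *\<^sub>F ((\<lambda>p. g p (Y p) (Z p)) *\<^sub>F X - (\<lambda>p. g p (X p) (Z p)) *\<^sub>F Y) =
    concircular_curvature n A g nabla X Y Z"
    unfolding concircular_curvature_def by (intro ext) simp
  ultimately show ?thesis by simp
qed

text \<open>Only the derivative of \<open>\<phi>\<close> in direction \<open>\<xi>\<close> enters, and it vanishes because of
  \<open>(nabla_\<xi> \<phi>) X = c (g(\<xi>, X) \<xi> - \<eta>(X) \<xi>) = 0\<close>.\<close>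

lemma curvature_reeb:
  assumes X: "X \<in> \<X>" and \<xi>: "\<xi> \<in> \<X>" and c: "c \<in> \<F>"
    and \<phi>: "\<And>Y. Y \<in> \<X> \<Longrightarrow> (\<lambda>p. \<phi> p (Y p)) \<in> \<X>"
    and \<phi>_add: "\<And>p u v. u \<in> tangent_space A p \<Longrightarrow> v \<in> tangent_space A p \<Longrightarrow> \<phi> p (u + v) = \<phi> p u + \<phi> p v"
    and \<phi>_scale: "\<And>p u a. u \<in> tangent_space A p \<Longrightarrow> \<phi> p (a *\<^sub>T u) = a *\<^sub>T \<phi> p u"
    and \<phi>\<xi>: "\<And>p. \<phi> p (\<xi> p) = 0"
    and nabla_\<xi>: "\<And>Y p. Y \<in> \<X> \<Longrightarrow> nabla Y \<xi> p = - (c p *\<^sub>T \<phi> p (Y p))"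
    and nabla_\<phi>: "\<And>p. nabla \<xi> (\<lambda>q. \<phi> q (X q)) p = \<phi> p (nabla \<xi> X p)"
  shows "curvature nabla X \<xi> \<xi> p = \<xi> p c *\<^sub>T \<phi> p (X p) - (c p)\<^sup>2 *\<^sub>T \<phi> p (\<phi> p (X p))"
proof -
  let ?\<phi>X = "\<lambda>q. \<phi> q (X q)"
  have "nabla \<xi> \<xi> = 0"
    using nabla_\<xi>[OF \<xi>] \<phi>\<xi> by (intro ext) simp
  then have e1: "nabla X (nabla \<xi> \<xi>) p = 0" using nabla_zero_right[OF X] by simp
  have X\<xi>: "nabla X \<xi> = (\<lambda>q. - c q) *\<^sub>F ?\<phi>X"
    using nabla_\<xi>[OF X] by (intro ext) simp
  have mc: "(\<lambda>q. - c q) \<in> \<F>" by (rule smooth_functions_minus[OF manifold c])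
  have "\<xi> p (\<lambda>q. - c q) = - \<xi> p c"
    using tangent_vector_derivation(3)[OF manifold field_at[OF \<xi>] smooth_functions_const[of "-1"] c, of p]
      tangent_vector_derivation(4)[OF manifold field_at[OF \<xi>], of p] by simp
  then have e2: "nabla \<xi> (nabla X \<xi>) p = - (\<xi> p c *\<^sub>T ?\<phi>X p) - c p *\<^sub>T \<phi> p (nabla \<xi> X p)"
    unfolding X\<xi> nabla_scale_right[OF \<xi> \<phi>[OF X] mc] by (intro ext) (simp add: nabla_\<phi>)
  let ?u = "nabla \<xi> X p"
  have t: "?u \<in> tangent_space A p" "\<phi> p (X p) \<in> tangent_space A p"
    using field_at[OF nabla_closed[OF \<xi> X]] field_at[OF \<phi>[OF X]] by auto
  \<comment> \<open>Torsion freeness writes the bracket in terms of \<open>?u\<close>, so that the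
    uncontrolled vector \<open>\<phi> p ?u\<close> in the third curvature term cancels the one in
    \<open>e2\<close>.\<close>
  have "lie_bracket X \<xi> p = (- c p) *\<^sub>T \<phi> p (X p) + (-1) *\<^sub>T ?u"
    unfolding torsion_free[OF X \<xi>] X\<xi> by (intro ext) simp
  then have "\<phi> p (lie_bracket X \<xi> p) = (- c p) *\<^sub>T \<phi> p (\<phi> p (X p)) + (-1) *\<^sub>T \<phi> p ?u"
    using t by (simp only: \<phi>_add \<phi>_scale tangent_intros)
  then have e3: "nabla (lie_bracket X \<xi>) \<xi> p = (c p)\<^sup>2 *\<^sub>T \<phi> p (\<phi> p (X p)) + c p *\<^sub>T \<phi> p ?u"
    unfolding nabla_\<xi>[OF bracket_closed[OF X \<xi>]] by (intro ext) (simp add: algebra_simps power2_eq_square)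
  have "curvature nabla X \<xi> \<xi> p = nabla X (nabla \<xi> \<xi>) p - nabla \<xi> (nabla X \<xi>) p - nabla (lie_bracket X \<xi>) \<xi> p"
    by (simp add: curvature_def)
  then show ?thesis unfolding e1 e2 e3 by (intro ext) simp
qed

end

section \<open>The pullback connection\<close>

text \<open>Separates the smoothness and linearity of \<open>\<phi>\<close> from the rest of the
  almost contact structure, for transfer to fields along \<open>\<iota>\<close>.\<close>

definition endomorphism_field ::
    "('a, 'e::euclidean_space) atlas \<Rightarrow> ('a \<Rightarrow> 'a tvec \<Rightarrow> 'a tvec) \<Rightarrow> bool" where
  "endomorphism_field A \<phi> \<longleftrightarrow>
     (\<forall>Y\<in>vector_fields A. (\<lambda>p. \<phi> p (Y p)) \<in> vector_fields A) \<and>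
     (\<forall>p. \<forall>u\<in>tangent_space A p. \<phi> p u \<in> tangent_space A p \<and>
        (\<forall>v\<in>tangent_space A p. \<phi> p (u + v) = \<phi> p u + \<phi> p v) \<and>
        (\<forall>a. \<phi> p (a *\<^sub>T u) = a *\<^sub>T \<phi> p u))"

lemma endomorphism_fieldD:
  assumes "endomorphism_field A \<phi>"
  shows "Y \<in> vector_fields A \<Longrightarrow> (\<lambda>p. \<phi> p (Y p)) \<in> vector_fields A"
    and "u \<in> tangent_space A p \<Longrightarrow> \<phi> p u \<in> tangent_space A p"
    and "u \<in> tangent_space A p \<Longrightarrow> v \<in> tangent_space A p \<Longrightarrow> \<phi> p (u + v) = \<phi> p u + \<phi> p v"
    and "u \<in> tangent_space A p \<Longrightarrow> \<phi> p (a *\<^sub>T u) = a *\<^sub>T \<phi> p u"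
  using assms unfolding endomorphism_field_def by blast+

lemma pushforward_apply: "f \<in> smooth_functions B \<Longrightarrow> pushforward B \<iota> v f = v (\<lambda>p. f (\<iota> p))"
  by (simp add: pushforward_def comp_def)

lemma pushforward_linear:
  "pushforward B \<iota> (u + v) = pushforward B \<iota> u + pushforward B \<iota> v"
  "pushforward B \<iota> (u - v) = pushforward B \<iota> u - pushforward B \<iota> v"
  "pushforward B \<iota> (- u) = - pushforward B \<iota> u"
  "pushforward B \<iota> (a *\<^sub>T u) = a *\<^sub>T pushforward B \<iota> u"
  "pushforward B \<iota> 0 = 0"
  by (auto simp: pushforward_def)

locale pullback = amb: levi_civita_manifold B g nablabar + manifold_map A B \<iota>
  for A :: "('b::{t2_space, second_countable_topology}, 'k::euclidean_space) atlas"
    and B :: "('a::{t2_space, second_countable_topology}, 'e::euclidean_space) atlas"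
    and \<iota> :: "'b \<Rightarrow> 'a" and g and nablabar +
  fixes D :: "'b field \<Rightarrow> ('b \<Rightarrow> 'a tvec) \<Rightarrow> ('b \<Rightarrow> 'a tvec)"
  assumes pullback: "pullback_connection A B \<iota> nablabar D"
begin

sublocale connection A B \<iota> D
  using pullback by unfold_locales (simp add: pullback_connection_def)

abbreviation push :: "'b field \<Rightarrow> 'b \<Rightarrow> 'a tvec" where
  "push X \<equiv> (\<lambda>p. pushforward B \<iota> (X p))"

lemma D_restriction:
  assumes "X \<in> vector_fields A" "X' \<in> vector_fields B" "Y \<in> vector_fields B" "X' (\<iota> p) = pushforward B \<iota> (X p)"
  shows "D X (\<lambda>q. Y (\<iota> q)) p = nablabar X' Y (\<iota> p)"
  using pullback assms unfolding pullback_connection_def comp_def by blast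

lemma extend_push:
  assumes "X \<in> vector_fields A"
  obtains X' where "X' \<in> vector_fields B" "X' (\<iota> p) = pushforward B \<iota> (X p)"
  using field_extension[OF \<Gamma>D(1)[OF pushforward_\<Gamma>[OF assms]]] by metis

lemma A_at: "X \<in> vector_fields A \<Longrightarrow> X p \<in> tangent_space A p"
  by (simp add: vector_fields_iff)

lemma apply_add:
  assumes "X \<in> vector_fields A" "f \<in> smooth_functions A" "h \<in> smooth_functions A"
  shows "X p (\<lambda>q. f q + h q) = X p f + X p h"
  using tangent_vector_derivation(2)[OF manifold_A A_at[OF assms(1)] assms(2,3)] .

lemma apply_mult:
  assumes "X \<in> vector_fields A" "f \<in> smooth_functions A" "h \<in> smooth_functions A"
  shows "X p (\<lambda>q. f q * h q) = f p * X p h + X p f * h p"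
  using tangent_vector_derivation(3)[OF manifold_A A_at[OF assms(1)] assms(2,3)] .

text \<open>The pointwise linear criterion is applied to one argument at a time. For pushed-forward
  fields the result is the smoothness of the induced metric.\<close>

lemma g_along_smooth:
  assumes V: "V \<in> \<Gamma>" and W: "W \<in> \<Gamma>"
  shows "(\<lambda>p. g (\<iota> p) (V p) (W p)) \<in> smooth_functions A"
proof -
  have 1: "(\<lambda>p. g (\<iota> p) (V p) (Y (\<iota> p))) \<in> smooth_functions A" if Y: "Y \<in> vector_fields B" for Y
  proof (rule smooth_pointwise_linear[where \<psi> = "\<lambda>p u. g (\<iota> p) u (Y (\<iota> p))", OF _ _ _ V])
    fix Z assume Z: "Z \<in> vector_fields B"
    show "(\<lambda>p. g (\<iota> p) (Z (\<iota> p)) (Y (\<iota> p))) \<in> smooth_functions A"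
      using smooth_map_comp[OF manifold_A manifold_B smooth_\<iota> amb.g_smooth[OF Z Y]] .
  qed (simp_all add: amb.g_add_left amb.g_scale_left amb.field_at Y)
  show ?thesis
    by (rule smooth_pointwise_linear[where \<psi> = "\<lambda>p u. g (\<iota> p) (V p) u", OF _ _ 1 W])
      (simp_all add: amb.g_add_right amb.g_scale_right \<Gamma>D(1)[OF V])
qed

text \<open>The defect \<open>\<Phi>\<close> is symmetric and tensorial, hence vanishes as soon as
  it does on restrictions of ambient fields, where it expresses that \<open>nablabar\<close> is
  metric.\<close>

lemma D_metric:
  assumes X: "X \<in> vector_fields A" and V: "V \<in> \<Gamma>" and W: "W \<in> \<Gamma>"
  shows "X p (\<lambda>q. g (\<iota> q) (V q) (W q)) = g (\<iota> p) (D X V p) (W p) + g (\<iota> p) (V p) (D X W p)"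
proof -
  define \<Phi> where "\<Phi> V W = X p (\<lambda>q. g (\<iota> q) (V q) (W q)) - (g (\<iota> p) (D X V p) (W p) + g (\<iota> p) (V p) (D X W p))" for V W
  have sym: "\<Phi> V W = \<Phi> W V" if V: "V \<in> \<Gamma>" and W: "W \<in> \<Gamma>" for V W
  proof -
    have "(\<lambda>q. g (\<iota> q) (V q) (W q)) = (\<lambda>q. g (\<iota> q) (W q) (V q))"
      by (intro ext amb.g_sym \<Gamma>D(1) V W)
    moreover have "g (\<iota> p) (D X V p) (W p) = g (\<iota> p) (W p) (D X V p)"
      "g (\<iota> p) (V p) (D X W p) = g (\<iota> p) (D X W p) (V p)"
      by (intro amb.g_sym \<Gamma>D(1) D_closed X V W)+
    ultimately show ?thesis unfolding \<Phi>_def by simp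
  qed
  have tens: "tensorial_at A \<Gamma> p (\<lambda>V. \<Phi> V W)" if W: "W \<in> \<Gamma>" for W
    unfolding tensorial_at_def
  proof (intro conjI ballI)
    fix V V' assume V: "V \<in> \<Gamma>" and V': "V' \<in> \<Gamma>"
    have "(\<lambda>q. g (\<iota> q) ((V + V') q) (W q)) = (\<lambda>q. g (\<iota> q) (V q) (W q) + g (\<iota> q) (V' q) (W q))"
      by (simp add: amb.g_add_left \<Gamma>D(1) V V' W)
    then have "X p (\<lambda>q. g (\<iota> q) ((V + V') q) (W q)) = X p (\<lambda>q. g (\<iota> q) (V q) (W q)) + X p (\<lambda>q. g (\<iota> q) (V' q) (W q))"
      using apply_add[OF X g_along_smooth[OF V W] g_along_smooth[OF V' W]] by simp
    then show "\<Phi> (V + V') W = \<Phi> V W + \<Phi> V' W"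
      unfolding \<Phi>_def D_add_right[OF X V V']
      by (simp add: amb.g_add_left \<Gamma>D(1) V V' W D_closed X)
  next
    fix a V assume a: "a \<in> smooth_functions A" and V: "V \<in> \<Gamma>"
    have "(\<lambda>q. g (\<iota> q) ((a *\<^sub>F V) q) (W q)) = (\<lambda>q. a q * g (\<iota> q) (V q) (W q))"
      by (simp add: amb.g_scale_left \<Gamma>D(1) V W)
    then have "X p (\<lambda>q. g (\<iota> q) ((a *\<^sub>F V) q) (W q)) = a p * X p (\<lambda>q. g (\<iota> q) (V q) (W q)) + X p a * g (\<iota> p) (V p) (W p)"
      using apply_mult[OF X a g_along_smooth[OF V W]] by simp
    then show "\<Phi> (a *\<^sub>F V) W = a p * \<Phi> V W"
      unfolding \<Phi>_def D_scale_right[OF X V a]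
      by (simp add: amb.g_add_left amb.g_scale_left \<Gamma>D(1) V W D_closed X tangent_space_linear(2)[OF manifold_B] algebra_simps)
  qed
  obtain X' where X': "X' \<in> vector_fields B" "X' (\<iota> p) = pushforward B \<iota> (X p)" by (rule extend_push[OF X])
  have base: "\<Phi> (\<lambda>q. Y (\<iota> q)) (\<lambda>q. Z (\<iota> q)) = 0" if Y: "Y \<in> vector_fields B" and Z: "Z \<in> vector_fields B" for Y Z
  proof -
    have "X p (\<lambda>q. g (\<iota> q) (Y (\<iota> q)) (Z (\<iota> q))) = X' (\<iota> p) (\<lambda>r. g r (Y r) (Z r))"
      unfolding X'(2) pushforward_apply[OF amb.g_smooth[OF Y Z]] ..
    then show ?thesis unfolding \<Phi>_def D_restriction[OF X X'(1) Y X'(2)] D_restriction[OF X X'(1) Z X'(2)]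
      by (simp add: amb.metric_compatible[OF X'(1) Y Z])
  qed
  \<comment> \<open>The reduction treats one argument at a time: \<open>W\<close> is moved to the
    first place by symmetry and reduced there, then \<open>V\<close> follows.\<close>
  have "\<Phi> (\<lambda>q. Y (\<iota> q)) W = 0" if Y: "Y \<in> vector_fields B" for Y
  proof -
    have "\<Phi> W (\<lambda>q. Y (\<iota> q)) = 0"
      by (rule tensorial_vanish[OF tens[OF restriction_\<Gamma>[OF Y]] W]) (rule base[OF _ Y])
    then show ?thesis using sym[OF restriction_\<Gamma>[OF Y] W] by simp
  qed
  then have "\<Phi> V W = 0" by (rule tensorial_vanish[OF tens[OF W] V])
  then show ?thesis unfolding \<Phi>_def by simp
qed

text \<open>The defect \<open>X (V f) - (D X V) f\<close> is tensorial in \<open>V\<close>, so it may be computed from ambient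
  extensions, where it is the Hessian of \<open>f\<close>.\<close>

lemma hessian_along:
  assumes X: "X \<in> vector_fields A" and V: "V \<in> \<Gamma>" and f: "f \<in> smooth_functions B"
    and X': "X' \<in> vector_fields B" "X' (\<iota> p) = pushforward B \<iota> (X p)"
    and Y: "Y \<in> vector_fields B" "Y (\<iota> p) = V p"
  shows "X p (\<lambda>q. V q f) - D X V p f = X' (\<iota> p) (\<lambda>r. Y r f) - nablabar X' Y (\<iota> p) f"
proof -
  have t: "tensorial_at A \<Gamma> p (\<lambda>V. X p (\<lambda>q. V q f) - D X V p f)"
    unfolding tensorial_at_def
  proof (intro conjI ballI)
    fix V V' assume V: "V \<in> \<Gamma>" and V': "V' \<in> \<Gamma>"
    show "X p (\<lambda>q. (V + V') q f) - D X (V + V') p f = (X p (\<lambda>q. V q f) - D X V p f) + (X p (\<lambda>q. V' q f) - D X V' p f)"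
      using apply_add[OF X \<Gamma>D(2)[OF V f] \<Gamma>D(2)[OF V' f]] D_add_right[OF X V V'] by simp
  next
    fix a V assume a: "a \<in> smooth_functions A" and V: "V \<in> \<Gamma>"
    show "X p (\<lambda>q. (a *\<^sub>F V) q f) - D X (a *\<^sub>F V) p f = a p * (X p (\<lambda>q. V q f) - D X V p f)"
      using apply_mult[OF X a \<Gamma>D(2)[OF V f]] D_scale_right[OF X V a] by (simp add: algebra_simps)
  qed
  have "X p (\<lambda>q. V q f) - D X V p f = X p (\<lambda>q. Y (\<iota> q) f) - D X (\<lambda>q. Y (\<iota> q)) p f"
    by (rule tensorial_pointwise[OF t V restriction_\<Gamma>[OF Y(1)]]) (simp add: Y(2))
  moreover have "X' (\<iota> p) (\<lambda>r. Y r f) = X p (\<lambda>q. Y (\<iota> q) f)"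
    unfolding X'(2) pushforward_apply[OF amb.field_apply[OF Y(1) f]] ..
  ultimately show ?thesis using D_restriction[OF X X'(1) Y(1) X'(2)] by simp
qed

text \<open>Subtracting two instances of \<open>hessian_along\<close> isolates the bracket, since
  the ambient Hessian is symmetric. The extensions \<open>X'\<close> and \<open>Y'\<close> match the
  pushed-forward fields only at the point, so their own bracket is never identified with that of
  \<open>X\<close> and \<open>Y\<close>.\<close>

lemma D_torsion_free:
  assumes X: "X \<in> vector_fields A" and Y: "Y \<in> vector_fields A"
  shows "D X (push Y) p - D Y (push X) p = pushforward B \<iota> (lie_bracket X Y p)"
proof
  fix f
  show "(D X (push Y) p - D Y (push X) p) f = pushforward B \<iota> (lie_bracket X Y p) f"
  proof (cases "f \<in> smooth_functions B")
    case f: True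
    obtain X' where X': "X' \<in> vector_fields B" "X' (\<iota> p) = pushforward B \<iota> (X p)" by (rule extend_push[OF X])
    obtain Y' where Y': "Y' \<in> vector_fields B" "Y' (\<iota> p) = pushforward B \<iota> (Y p)" by (rule extend_push[OF Y])
    have "X p (\<lambda>q. push Y q f) - D X (push Y) p f = X' (\<iota> p) (\<lambda>r. Y' r f) - nablabar X' Y' (\<iota> p) f"
      by (rule hessian_along[OF X pushforward_\<Gamma>[OF Y] f X' Y'])
    moreover have "Y p (\<lambda>q. push X q f) - D Y (push X) p f = Y' (\<iota> p) (\<lambda>r. X' r f) - nablabar Y' X' (\<iota> p) f"
      by (rule hessian_along[OF Y pushforward_\<Gamma>[OF X] f Y' X'])
    moreover have "X' (\<iota> p) (\<lambda>r. Y' r f) - Y' (\<iota> p) (\<lambda>r. X' r f) = nablabar X' Y' (\<iota> p) f - nablabar Y' X' (\<iota> p) f"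
      using fun_cong[OF fun_cong[OF amb.torsion_free[OF X'(1) Y'(1)]], of "\<iota> p" f] by (simp add: lie_bracket_def)
    ultimately show ?thesis using f by (simp add: pushforward_apply lie_bracket_def)
  next
    \<comment> \<open>Tangent vectors take the default value 0 on non-smooth functions, so both
      sides vanish.\<close>
    case False
    then show ?thesis
      using tangent_vector_derivation(1)[OF manifold_B \<Gamma>D(1)[OF D_closed[OF X pushforward_\<Gamma>[OF Y]]] False]
        tangent_vector_derivation(1)[OF manifold_B \<Gamma>D(1)[OF D_closed[OF Y pushforward_\<Gamma>[OF X]]] False]
      by (simp add: pushforward_def)
  qed
qed

lemma endomorphism_along:
  assumes \<phi>: "endomorphism_field B \<phi>" and V: "V \<in> \<Gamma>"
  shows "(\<lambda>p. \<phi> (\<iota> p) (V p)) \<in> \<Gamma>"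
proof (rule \<Gamma>I)
  show "\<phi> (\<iota> p) (V p) \<in> tangent_space B (\<iota> p)" for p
    by (rule endomorphism_fieldD(2)[OF \<phi> \<Gamma>D(1)[OF V]])
  show "(\<lambda>p. \<phi> (\<iota> p) (V p) f) \<in> smooth_functions A" if f: "f \<in> smooth_functions B" for f
  proof (rule smooth_pointwise_linear[where \<psi> = "\<lambda>p u. \<phi> (\<iota> p) u f", OF _ _ _ V])
    fix Y assume "Y \<in> vector_fields B"
    then have "(\<lambda>r. \<phi> r (Y r) f) \<in> smooth_functions B"
      using amb.field_apply[OF endomorphism_fieldD(1)[OF \<phi>] f] by blast
    then show "(\<lambda>p. \<phi> (\<iota> p) (Y (\<iota> p)) f) \<in> smooth_functions A"
      by (rule smooth_map_comp[OF manifold_A manifold_B smooth_\<iota>])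
  qed (simp_all add: endomorphism_fieldD[OF \<phi>])
qed

text \<open>Parallelism of \<open>\<phi>\<close> in a single direction survives the pullback: both
  terms of the defect produce the same multiple of \<open>\<phi>\<close> applied to \<open>V\<close>
  when \<open>V\<close> is scaled, so the defect is tensorial.\<close>

lemma D_endomorphism:
  assumes \<phi>: "endomorphism_field B \<phi>" and X: "X \<in> vector_fields A" and V: "V \<in> \<Gamma>"
    and X': "X' \<in> vector_fields B" "X' (\<iota> p) = pushforward B \<iota> (X p)"
    and par: "\<And>Y. Y \<in> vector_fields B \<Longrightarrow> nablabar X' (\<lambda>r. \<phi> r (Y r)) (\<iota> p) = \<phi> (\<iota> p) (nablabar X' Y (\<iota> p))"
  shows "D X (\<lambda>q. \<phi> (\<iota> q) (V q)) p = \<phi> (\<iota> p) (D X V p)"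
proof
  fix f
  define \<Phi> where "\<Phi> V = D X (\<lambda>q. \<phi> (\<iota> q) (V q)) p f - \<phi> (\<iota> p) (D X V p) f" for V
  have t: "tensorial_at A \<Gamma> p \<Phi>"
    unfolding tensorial_at_def
  proof (intro conjI ballI)
    fix V V' assume V: "V \<in> \<Gamma>" and V': "V' \<in> \<Gamma>"
    have "(\<lambda>q. \<phi> (\<iota> q) ((V + V') q)) = (\<lambda>q. \<phi> (\<iota> q) (V q)) + (\<lambda>q. \<phi> (\<iota> q) (V' q))"
      using endomorphism_fieldD(3)[OF \<phi> \<Gamma>D(1)[OF V] \<Gamma>D(1)[OF V']] by (intro ext) simp
    then have "D X (\<lambda>q. \<phi> (\<iota> q) ((V + V') q)) = D X (\<lambda>q. \<phi> (\<iota> q) (V q)) + D X (\<lambda>q. \<phi> (\<iota> q) (V' q))"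
      using D_add_right[OF X endomorphism_along[OF \<phi> V] endomorphism_along[OF \<phi> V']] by (simp only:)
    moreover have "\<phi> (\<iota> p) (D X (V + V') p) = \<phi> (\<iota> p) (D X V p) + \<phi> (\<iota> p) (D X V' p)"
      unfolding D_add_right[OF X V V'] plus_fun_apply[of _ _ p]
      by (rule endomorphism_fieldD(3)[OF \<phi> \<Gamma>D(1)[OF D_closed[OF X V]] \<Gamma>D(1)[OF D_closed[OF X V']]])
    ultimately show "\<Phi> (V + V') = \<Phi> V + \<Phi> V'" unfolding \<Phi>_def by simp
  next
    fix a V assume a: "a \<in> smooth_functions A" and V: "V \<in> \<Gamma>"
    have "(\<lambda>q. \<phi> (\<iota> q) ((a *\<^sub>F V) q)) = a *\<^sub>F (\<lambda>q. \<phi> (\<iota> q) (V q))"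
      using endomorphism_fieldD(4)[OF \<phi> \<Gamma>D(1)[OF V]] by (intro ext) simp
    then have 1: "D X (\<lambda>q. \<phi> (\<iota> q) ((a *\<^sub>F V) q)) =
        (\<lambda>p. X p a) *\<^sub>F (\<lambda>q. \<phi> (\<iota> q) (V q)) + a *\<^sub>F D X (\<lambda>q. \<phi> (\<iota> q) (V q))"
      using D_scale_right[OF X endomorphism_along[OF \<phi> V] a] by (simp only:)
    have 2: "\<phi> (\<iota> p) (D X (a *\<^sub>F V) p) = X p a *\<^sub>T \<phi> (\<iota> p) (V p) + a p *\<^sub>T \<phi> (\<iota> p) (D X V p)"
      unfolding D_scale_right[OF X V a] plus_fun_apply[of _ _ p] fscale_apply
      by (simp only: endomorphism_fieldD[OF \<phi>] \<Gamma>D(1)[OF V] \<Gamma>D(1)[OF D_closed[OF X V]] tangent_space_linear(2)[OF manifold_B])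
    show "\<Phi> (a *\<^sub>F V) = a p * \<Phi> V" unfolding \<Phi>_def 1 2 by (simp add: algebra_simps)
  qed
  have "\<Phi> V = 0"
  proof (rule tensorial_vanish[OF t V])
    fix Y assume Y: "Y \<in> vector_fields B"
    show "\<Phi> (\<lambda>q. Y (\<iota> q)) = 0"
      using D_restriction[OF X X'(1) endomorphism_fieldD(1)[OF \<phi> Y] X'(2)]
        D_restriction[OF X X'(1) Y X'(2)] par[OF Y] by (simp add: \<Phi>_def)
  qed
  then show "D X (\<lambda>q. \<phi> (\<iota> q) (V q)) p f = \<phi> (\<iota> p) (D X V p) f" by (simp add: \<Phi>_def)
qed

end

section \<open>The second fundamental form of an immersion\<close>

locale immersion = pullback A B \<iota> g nablabar D
  for A :: "('b::{t2_space, second_countable_topology}, 'k::euclidean_space) atlas"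
    and B :: "('a::{t2_space, second_countable_topology}, 'e::euclidean_space) atlas"
    and \<iota> :: "'b \<Rightarrow> 'a" and g and nablabar and D +
  fixes nabla :: "'b field \<Rightarrow> 'b field \<Rightarrow> 'b field"
  assumes immersed: "inj_on (pushforward B \<iota>) (tangent_space A p)"
    and induced_levi_civita: "levi_civita A (induced_metric B \<iota> g) nabla"
begin

lemma push_at: "u \<in> tangent_space A p \<Longrightarrow> pushforward B \<iota> u \<in> tangent_space B (\<iota> p)"
  by (rule pushforward_tangent[OF manifold_A manifold_B smooth_\<iota>])

sublocale sub: levi_civita_manifold A "induced_metric B \<iota> g" nabla
proof unfold_locales
  show "smooth_manifold A" by (rule manifold_A)
  show "levi_civita A (induced_metric B \<iota> g) nabla" by (rule induced_levi_civita)
  \<comment> \<open>Injectivity of the differential is what makes the induced metric positive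
    definite.\<close>
  have nz: "pushforward B \<iota> u \<noteq> 0" if "u \<in> tangent_space A p" "u \<noteq> 0" for u p
    using immersed[of p] that tangent_space_zero[OF manifold_A, of p] pushforward_linear(5)[of B \<iota>]
    by (metis inj_onD)
  show "riemannian_metric A (induced_metric B \<iota> g)"
    unfolding riemannian_metric_def induced_metric_def pushforward_linear
    using amb.g_sym amb.g_add_left amb.g_scale_left amb.g_pos nz push_at g_along_smooth pushforward_\<Gamma>
    by (auto simp: push_at)
qed

abbreviation "h \<equiv> second_fundamental_form B \<iota> nabla D"

lemma h_apply: "h X Y p = D X (push Y) p - pushforward B \<iota> (nabla X Y p)"
  by (simp add: second_fundamental_form_def)

lemma h_at: "X \<in> sub.\<X> \<Longrightarrow> Y \<in> sub.\<X> \<Longrightarrow> h X Y p \<in> tangent_space B (\<iota> p)"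
  unfolding h_apply
  by (intro tangent_space_diff[OF manifold_B] \<Gamma>D(1) D_closed push_at sub.field_at sub.nabla_closed pushforward_\<Gamma>)

lemma h_sym:
  assumes X: "X \<in> sub.\<X>" and Y: "Y \<in> sub.\<X>"
  shows "h X Y = h Y X"
proof
  fix p
  have "D X (push Y) p - D Y (push X) p = pushforward B \<iota> (nabla X Y p) - pushforward B \<iota> (nabla Y X p)"
    unfolding D_torsion_free[OF X Y] sub.torsion_free[OF X Y] minus_apply pushforward_linear ..
  then show "h X Y p = h Y X p" unfolding h_apply by (simp add: algebra_simps)
qed

lemma h_scale_left:
  assumes "X \<in> sub.\<X>" "Y \<in> sub.\<X>" "a \<in> sub.\<F>"
  shows "h (a *\<^sub>F X) Y = a *\<^sub>F h X Y"
  unfolding second_fundamental_form_def D_scale_left[OF assms(1) pushforward_\<Gamma>[OF assms(2)] assms(3)]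
    sub.nabla_scale_left[OF assms]
  by (intro ext) (simp add: pushforward_linear algebra_simps)

lemma h_diff_left:
  assumes "X \<in> sub.\<X>" "X' \<in> sub.\<X>" "Y \<in> sub.\<X>"
  shows "h (X - X') Y = h X Y - h X' Y"
  unfolding second_fundamental_form_def D_diff_left[OF assms(1,2) pushforward_\<Gamma>[OF assms(3)]]
    sub.nabla_diff_left[OF assms]
  by (intro ext) (simp add: pushforward_linear algebra_simps)

text \<open>Both connections are metric and torsion free, so \<open>g (h X Y) Z\<close> is symmetric in the first two and
  skew in the last two arguments.\<close>

lemma h_normal:
  assumes X: "X \<in> sub.\<X>" and Y: "Y \<in> sub.\<X>" and Z: "Z \<in> sub.\<X>"
  shows "g (\<iota> p) (h X Y p) (push Z p) = 0"
proof -
  define s where "s X Y Z = g (\<iota> p) (h X Y p) (push Z p)" for X Y Z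
  have skew: "s X Y Z = - s X Z Y" if X: "X \<in> sub.\<X>" and Y: "Y \<in> sub.\<X>" and Z: "Z \<in> sub.\<X>" for X Y Z
  proof -
    note t = \<Gamma>D(1)[OF pushforward_\<Gamma>[OF Y], of p] \<Gamma>D(1)[OF pushforward_\<Gamma>[OF Z], of p]
      \<Gamma>D(1)[OF D_closed[OF X pushforward_\<Gamma>[OF Y]], of p] \<Gamma>D(1)[OF D_closed[OF X pushforward_\<Gamma>[OF Z]], of p]
      push_at[OF sub.field_at[OF sub.nabla_closed[OF X Y], of p]] push_at[OF sub.field_at[OF sub.nabla_closed[OF X Z], of p]]
    have "g (\<iota> p) (D X (push Y) p) (push Z p) + g (\<iota> p) (push Y p) (D X (push Z) p) =
      g (\<iota> p) (pushforward B \<iota> (nabla X Y p)) (push Z p) + g (\<iota> p) (push Y p) (pushforward B \<iota> (nabla X Z p))"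
      using D_metric[OF X pushforward_\<Gamma>[OF Y] pushforward_\<Gamma>[OF Z], of p] sub.metric_compatible[OF X Y Z, of p]
      by (simp add: induced_metric_def)
    then show ?thesis unfolding s_def h_apply
      using amb.g_sym[OF t(1) t(4)] amb.g_sym[OF t(1) t(6)] by (simp add: amb.g_diff_left t)
  qed
  have sym: "s X Y Z = s Y X Z" if "X \<in> sub.\<X>" "Y \<in> sub.\<X>" for X Y Z
    unfolding s_def using h_sym[OF that] by simp
  \<comment> \<open>Alternating the skew and the symmetric exchange runs through all six orders of
    the arguments; three sign changes bring back the first order with the opposite sign.\<close>
  have "s X Y Z = - s X Y Z"
    using skew[OF X Y Z] sym[OF X Z, of Y] skew[OF Z X Y] sym[OF Z Y, of X] skew[OF Y Z X] sym[OF Y X, of Z] by simp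
  then show ?thesis by (simp add: s_def)
qed

text \<open>A vector both normal and tangent is orthogonal to itself. This yields vanishing of
  \<open>h\<close> from tangency of the ambient derivative alone.\<close>

lemma h_tangential_zero:
  assumes X: "X \<in> sub.\<X>" and Y: "Y \<in> sub.\<X>" and t: "h X Y p \<in> tangent_image A B \<iota> p"
  shows "h X Y p = 0"
proof (rule ccontr)
  assume "h X Y p \<noteq> 0"
  then have "g (\<iota> p) (h X Y p) (h X Y p) > 0" by (rule amb.g_pos[OF h_at[OF X Y]])
  moreover obtain w where w: "w \<in> tangent_space A p" "h X Y p = pushforward B \<iota> w"
    using t by (auto simp: tangent_image_def)
  moreover obtain Z where Z: "Z \<in> sub.\<X>" "Z p = w"
    using sub.id.field_extension[OF w(1)] by metis
  ultimately show False using h_normal[OF X Y Z(1), of p] by simp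
qed

text \<open>In a local orthonormal frame of the induced metric, the coefficients of the lift are the
  products of \<open>V\<close> with the pushed-forward frame, and these are smooth.\<close>

lemma lift_field:
  assumes V: "V \<in> \<Gamma>" and t: "\<And>p. V p \<in> tangent_image A B \<iota> p"
  shows "(\<lambda>p. inv_into (tangent_space A p) (pushforward B \<iota>) (V p)) \<in> sub.\<X>" (is "?X \<in> _")
proof -
  have X: "?X p \<in> tangent_space A p" "pushforward B \<iota> (?X p) = V p" for p
    using inv_into_into[OF t[of p, unfolded tangent_image_def]] f_inv_into_f[OF t[of p, unfolded tangent_image_def]] by blast+
  show ?thesis
    unfolding vector_fields_iff
  proof (intro conjI allI ballI)
    show "?X p \<in> tangent_space A p" for p by (rule X)
    fix f assume f: "f \<in> sub.\<F>"
    show "(\<lambda>p. ?X p f) \<in> sub.\<F>"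
    proof (rule smooth_functions_local[OF manifold_A])
      fix p
      obtain N and F :: "'k \<Rightarrow> 'b field" where N: "open N" "p \<in> N"
        and F: "\<And>q. q \<in> N \<Longrightarrow> orthonormal_at A (induced_metric B \<iota> g) q F"
        by (rule sub.orthonormal_frame[of p]) (rule that)
      let ?s = "\<lambda>q. \<Sum>i\<in>Basis. g (\<iota> q) (V q) (push (F i) q) * F i q f"
      have FX: "F i \<in> sub.\<X>" if "i \<in> Basis" for i using F[OF N(2)] that by (simp add: orthonormal_at_def)
      have "?s \<in> sub.\<F>"
        by (rule smooth_functions_sum[OF manifold_A], rule smooth_functions_mult[OF manifold_A
              g_along_smooth[OF V pushforward_\<Gamma>[OF FX]] sub.field_apply[OF FX f]])
      moreover have "?X q f = ?s q" if "q \<in> N" for q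
      proof -
        have "?X q f = (\<Sum>i\<in>Basis. induced_metric B \<iota> g q (?X q) (F i q) *\<^sub>T F i q) f"
          using sub.orthonormal_at_tangent[OF F[OF that] X(1)] by (rule fun_cong)
        then show ?thesis by (simp add: induced_metric_def X(2))
      qed
      ultimately show "\<exists>W s. open W \<and> p \<in> W \<and> s \<in> sub.\<F> \<and> (\<forall>q\<in>W. ?X q f = s q)"
        using N by (intro exI[of _ N] exI[of _ ?s]) simp
    qed
  qed
qed

end

section \<open>The possible values of \<open>f\<^sub>1 - f\<^sub>3\<close> in the ambient
  manifold\<close>

lemma almost_contact_endomorphism:
  assumes "almost_contact_metric A \<phi> \<xi> \<eta> g"
  shows "endomorphism_field A \<phi>"
  unfolding endomorphism_field_def
proof (intro conjI ballI allI)
  show "(\<lambda>p. \<phi> p (Y p)) \<in> vector_fields A" if "Y \<in> vector_fields A" for Y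
    using assms that unfolding almost_contact_metric_def by blast
  fix p u assume "u \<in> tangent_space A p"
  then show "\<phi> p u \<in> tangent_space A p" "\<phi> p (a *\<^sub>T u) = a *\<^sub>T \<phi> p u" 
    "v \<in> tangent_space A p \<Longrightarrow> \<phi> p (u + v) = \<phi> p u + \<phi> p v" for a v
    using assms unfolding almost_contact_metric_def by blast+
qed

text \<open>Computing \<open>R(X, \<xi>)\<xi>\<close> once from the structure equations and once from the curvature formula gives
  \<open>c\<^sup>2 (X - \<eta>(X) \<xi>) + \<xi>(c) \<phi>X = c (X - \<eta>(X) \<xi>)\<close> for \<open>c = f\<^sub>1 - f\<^sub>3\<close>, and \<open>\<phi>X\<close> is orthogonal to \<open>X - \<eta>(X) \<xi>\<close>.\<close>

lemma space_form_factor: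
  fixes B :: "('a::{t2_space, second_countable_topology}, 'e::euclidean_space) atlas"
  assumes sf: "generalized_sasakian_space_form n B \<phi> \<xi> \<eta> g nablabar f\<^sub>1 f\<^sub>2 f\<^sub>3"
    and se: "structure_equations B \<phi> \<xi> \<eta> g nablabar f\<^sub>1 f\<^sub>3"
  shows "f\<^sub>1 q - f\<^sub>3 q = 0 \<or> f\<^sub>1 q - f\<^sub>3 q = 1"
proof -
  have acm: "almost_contact_metric B \<phi> \<xi> \<eta> g" and B: "smooth_manifold B" and n: "n > 1" "DIM('e) = 2 * n + 1"
    and smooth: "f\<^sub>1 \<in> smooth_functions B" "f\<^sub>3 \<in> smooth_functions B"
    using sf unfolding generalized_sasakian_space_form_def by blast+
  interpret amb: levi_civita_manifold B g nablabar
    using sf acm unfolding generalized_sasakian_space_form_def almost_contact_metric_def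
    by unfold_locales blast+
  note endo = endomorphism_fieldD[OF almost_contact_endomorphism[OF acm]]
  have \<xi>: "\<xi> \<in> amb.\<X>" using acm unfolding almost_contact_metric_def by blast
  have \<xi>1: "\<phi> q (\<xi> q) = 0" "\<eta> q (\<xi> q) = 1" for q using acm unfolding almost_contact_metric_def by blast+
  have ac: "\<phi> q (\<phi> q u) = \<eta> q u *\<^sub>T \<xi> q - u" "g q u (\<xi> q) = \<eta> q u" "\<eta> q (\<phi> q u) = 0"
    "v \<in> tangent_space B q \<Longrightarrow> g q (\<phi> q u) (\<phi> q v) = g q u v - \<eta> q u * \<eta> q v"
    if "u \<in> tangent_space B q" for q u v
    using acm that unfolding almost_contact_metric_def by blast+
  define c where "c q = f\<^sub>1 q - f\<^sub>3 q" for q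
  have c: "c \<in> amb.\<F>" unfolding c_def by (rule smooth_functions_diff[OF B smooth])
  \<comment> \<open>The dimension exceeds 1, so two coordinate fields are independent at
    \<open>q\<close> and cannot both be multiples of \<open>\<xi> q\<close>.\<close>
  obtain u where u: "u \<in> tangent_space B q" "u - \<eta> q u *\<^sub>T \<xi> q \<noteq> 0"
  proof -
    obtain N and E :: "'e \<Rightarrow> 'a field" and x where N: "open N" "q \<in> N"
      and E: "\<And>b. b \<in> Basis \<Longrightarrow> E b \<in> vector_fields B" and x: "\<And>b. b \<in> Basis \<Longrightarrow> x b \<in> smooth_functions B"
      and Ex: "\<And>q v. q \<in> N \<Longrightarrow> v \<in> tangent_space B q \<Longrightarrow> v = (\<Sum>b\<in>Basis. v (x b) *\<^sub>T E b q)"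
      and Ex': "\<And>q a b. q \<in> N \<Longrightarrow> a \<in> Basis \<Longrightarrow> b \<in> Basis \<Longrightarrow> E a q (x b) = (if a = b then 1 else 0)"
      by (rule local_frame[OF B, of "q"]) (rule that)
    obtain a b :: 'e where ab: "a \<in> Basis" "b \<in> Basis" "a \<noteq> b"
    proof -
      have "\<not> card (Basis :: 'e set) \<le> Suc 0" using n by simp
      then show ?thesis using that card_le_Suc0_iff_eq[of "Basis :: 'e set"] finite_Basis by blast
    qed
    have "E a q - \<eta> q (E a q) *\<^sub>T \<xi> q \<noteq> 0 \<or> E b q - \<eta> q (E b q) *\<^sub>T \<xi> q \<noteq> 0"
    proof (rule ccontr)
      assume "\<not> ?thesis"
      then have "E a q f = \<eta> q (E a q) * \<xi> q f" "E b q f = \<eta> q (E b q) * \<xi> q f" for f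
        by (auto simp: fun_eq_iff)
      from this(1)[of "x a"] this(1)[of "x b"] this(2)[of "x b"]
      show False using Ex'[OF N(2)] ab by auto
    qed
    then show ?thesis using that E ab amb.field_at by blast
  qed
  obtain X where X: "X \<in> amb.\<X>" "X q = u" using amb.id.field_extension[OF u(1)] by metis
  define w where "w = u - \<eta> q u *\<^sub>T \<xi> q"
  have t: "u \<in> tangent_space B q" "\<xi> q \<in> tangent_space B q" "\<phi> q u \<in> tangent_space B q" "w \<in> tangent_space B q"
    using u amb.field_at[OF \<xi>] endo(2) amb.tangent_intros(2,3) unfolding w_def by auto
  \<comment> \<open>Every \<open>f\<^sub>2\<close> term contains
    \<open>\<phi> q (\<xi> q) = 0\<close>; the \<open>f\<^sub>1\<close> bracket reduces to
    \<open>w\<close> and the \<open>f\<^sub>3\<close> bracket to \<open>- w\<close>.\<close>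
  have R: "curvature nablabar X \<xi> \<xi> q = c q *\<^sub>T w"
  proof -
    have "g q u 0 = 0" "g q (\<xi> q) 0 = 0" using amb.g_scale_right[OF t(1,1), of 0] amb.g_scale_right[OF t(1,2), of 0]
      by (simp_all add: tscale_def zero_fun_def)
    moreover have "curvature nablabar X \<xi> \<xi> q =
          f\<^sub>1 q *\<^sub>T (g q (\<xi> q) (\<xi> q) *\<^sub>T X q - g q (X q) (\<xi> q) *\<^sub>T \<xi> q) +
          f\<^sub>2 q *\<^sub>T (g q (X q) (\<phi> q (\<xi> q)) *\<^sub>T \<phi> q (\<xi> q) - g q (\<xi> q) (\<phi> q (\<xi> q)) *\<^sub>T \<phi> q (X q)
                    + (2 * g q (X q) (\<phi> q (\<xi> q))) *\<^sub>T \<phi> q (\<xi> q)) +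
          f\<^sub>3 q *\<^sub>T ((\<eta> q (X q) * \<eta> q (\<xi> q)) *\<^sub>T \<xi> q - (\<eta> q (\<xi> q) * \<eta> q (\<xi> q)) *\<^sub>T X q
                    + (g q (X q) (\<xi> q) * \<eta> q (\<xi> q)) *\<^sub>T \<xi> q
                    - (g q (\<xi> q) (\<xi> q) * \<eta> q (X q)) *\<^sub>T \<xi> q)"
      using sf X(1) \<xi> unfolding generalized_sasakian_space_form_def by blast
    ultimately show ?thesis
      unfolding X(2) \<xi>1 ac(2)[OF t(1)] ac(2)[OF t(2)] w_def c_def by (intro ext) (simp add: algebra_simps)
  qed
  have "curvature nablabar X \<xi> \<xi> q = \<xi> q c *\<^sub>T \<phi> q (X q) - (c q)\<^sup>2 *\<^sub>T \<phi> q (\<phi> q (X q))"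
  proof (rule amb.curvature_reeb[where \<phi> = \<phi> and \<xi> = \<xi> and c = c and X = X and p = q])
    show "nablabar Y \<xi> p = - (c p *\<^sub>T \<phi> p (Y p))" if "Y \<in> amb.\<X>" for Y p
      using se that unfolding structure_equations_def c_def by blast
    have "nablabar \<xi> (\<lambda>q. \<phi> q (X q)) p - \<phi> p (nablabar \<xi> X p) =
        (f\<^sub>1 p - f\<^sub>3 p) *\<^sub>T (g p (\<xi> p) (X p) *\<^sub>T \<xi> p - \<eta> p (X p) *\<^sub>T \<xi> p)" for p
      using se X(1) \<xi> unfolding structure_equations_def by blast
    moreover have "g p (\<xi> p) (X p) = \<eta> p (X p)" for p
      using amb.g_sym[OF amb.field_at[OF \<xi>] amb.field_at[OF X(1)]] ac(2)[OF amb.field_at[OF X(1)]] by simp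
    ultimately show "nablabar \<xi> (\<lambda>q. \<phi> q (X q)) p = \<phi> p (nablabar \<xi> X p)" for p
      by (simp add: fun_eq_iff)
  qed (fact X(1) \<xi> c endo(1,3,4) \<xi>1(1))+
  moreover have "\<phi> q (\<phi> q u) = - w" unfolding ac(1)[OF t(1)] w_def by simp
  ultimately have "(c q - (c q)\<^sup>2) *\<^sub>T w = \<xi> q c *\<^sub>T \<phi> q u"
    unfolding R X(2) by (simp add: fun_eq_iff algebra_simps)
  then have "g q ((c q - (c q)\<^sup>2) *\<^sub>T w) w = g q (\<xi> q c *\<^sub>T \<phi> q u) w" by (simp only:)
  then have "(c q - (c q)\<^sup>2) * g q w w = \<xi> q c * g q (\<phi> q u) w"
    unfolding amb.g_scale_left[OF t(4,4)] amb.g_scale_left[OF t(3,4)] .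
  moreover have "g q (\<phi> q u) w = 0"
  proof -
    \<comment> \<open>Compatibility of the metric with \<open>\<phi>\<close> and the formula for
      \<open>\<phi>\<close> squared give the product with \<open>w\<close> as minus that with
      \<open>u\<close>; a direct computation gives the opposite sign.\<close>
    have "g q (\<phi> q u) (\<phi> q (\<phi> q u)) = g q u (\<phi> q u)"
      using ac(4)[OF t(1) t(3)] ac(3)[OF t(1)] by simp
    also have "\<dots> = g q (\<phi> q u) u" by (rule amb.g_sym[OF t(1,3)])
    also have "\<phi> q (\<phi> q u) = (-1) *\<^sub>T w" unfolding ac(1)[OF t(1)] w_def by (intro ext) simp
    finally have "- g q (\<phi> q u) w = g q (\<phi> q u) u" unfolding amb.g_scale_right[OF t(4,3)] by simp
    moreover have "g q (\<phi> q u) w = g q (\<phi> q u) u"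
      unfolding w_def amb.g_diff_right[OF t(1,3) amb.tangent_intros(2)[OF t(2)]] amb.g_scale_right[OF t(2,3)]
      using ac(2,3)[OF t(3)] ac(3)[OF t(1)] by simp
    ultimately show ?thesis by simp
  qed
  moreover have "g q w w > 0" using amb.g_pos[OF t(4)] u(2) unfolding w_def by blast
  ultimately have "c q = (c q)\<^sup>2" by simp
  then show ?thesis unfolding c_def power2_eq_square by (metis mult_cancel_left1)
qed

section \<open>Immersions tangent to a Sasakian structure\<close>

text \<open>The structure equations are recorded only at points of the image, where the factor has
  already been normalised to 1; elsewhere in the ambient manifold it may be 0.\<close>

locale reeb_immersion = immersion A B \<iota> g nablabar D nabla
  for A :: "('b::{t2_space, second_countable_topology}, 'k::euclidean_space) atlas"
    and B :: "('a::{t2_space, second_countable_topology}, 'e::euclidean_space) atlas"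
    and \<iota> :: "'b \<Rightarrow> 'a" and g and nablabar and D and nabla +
  fixes \<phi> :: "'a \<Rightarrow> 'a tvec \<Rightarrow> 'a tvec" and \<xi> :: "'a field"
  assumes \<phi>: "endomorphism_field B \<phi>" and \<xi>: "\<xi> \<in> vector_fields B"
    and \<phi>\<xi>: "\<phi> q (\<xi> q) = 0"
    and nablabar_\<xi>: "X \<in> vector_fields B \<Longrightarrow> nablabar X \<xi> (\<iota> p) = - \<phi> (\<iota> p) (X (\<iota> p))"
    and nablabar_\<phi>: "X \<in> vector_fields B \<Longrightarrow>
      nablabar \<xi> (\<lambda>q. \<phi> q (X q)) (\<iota> p) = \<phi> (\<iota> p) (nablabar \<xi> X (\<iota> p))"
    and \<xi>_tangent: "\<xi> (\<iota> p) \<in> tangent_image A B \<iota> p"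
    and \<phi>_invariant: "v \<in> tangent_image A B \<iota> p \<Longrightarrow> \<phi> (\<iota> p) v \<in> tangent_image A B \<iota> p"
begin

section \<open>The structure induced on the submanifold\<close>

definition lift :: "'b \<Rightarrow> 'a tvec \<Rightarrow> 'b tvec" where
  "lift p = inv_into (tangent_space A p) (pushforward B \<iota>)"

definition reeb :: "'b field" where
  "reeb p = lift p (\<xi> (\<iota> p))"

definition phi :: "'b \<Rightarrow> 'b tvec \<Rightarrow> 'b tvec" where
  "phi p u = lift p (\<phi> (\<iota> p) (pushforward B \<iota> u))"

lemma lift:
  assumes "v \<in> tangent_image A B \<iota> p"
  shows "lift p v \<in> tangent_space A p" "pushforward B \<iota> (lift p v) = v"
  using inv_into_into[OF assms[unfolded tangent_image_def]] f_inv_into_f[OF assms[unfolded tangent_image_def]]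
  by (simp_all add: lift_def)

lemma push_inject:
  "u \<in> tangent_space A p \<Longrightarrow> v \<in> tangent_space A p \<Longrightarrow> pushforward B \<iota> u = pushforward B \<iota> v \<Longrightarrow> u = v"
  using immersed by (metis inj_onD)

lemma tangent_imageI: "u \<in> tangent_space A p \<Longrightarrow> pushforward B \<iota> u \<in> tangent_image A B \<iota> p"
  by (simp add: tangent_image_def)

lemma push_reeb: "pushforward B \<iota> (reeb p) = \<xi> (\<iota> p)"
  unfolding reeb_def by (rule lift(2)[OF \<xi>_tangent])

lemma reeb_field: "reeb \<in> sub.\<X>"
  using lift_field[OF restriction_\<Gamma>[OF \<xi>] \<xi>_tangent] unfolding reeb_def lift_def .

lemma phi:
  assumes "u \<in> tangent_space A p"
  shows "phi p u \<in> tangent_space A p" "pushforward B \<iota> (phi p u) = \<phi> (\<iota> p) (pushforward B \<iota> u)"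
  unfolding phi_def using lift[OF \<phi>_invariant[OF tangent_imageI[OF assms]]] .

lemma phi_field:
  assumes "Y \<in> sub.\<X>"
  shows "(\<lambda>p. phi p (Y p)) \<in> sub.\<X>"
  using lift_field[OF endomorphism_along[OF \<phi> pushforward_\<Gamma>[OF assms]]
      \<phi>_invariant[OF tangent_imageI[OF sub.field_at[OF assms]]]]
  unfolding phi_def lift_def .

lemma push_phi: "Y \<in> sub.\<X> \<Longrightarrow> push (\<lambda>p. phi p (Y p)) = (\<lambda>p. \<phi> (\<iota> p) (push Y p))"
  using phi(2)[OF sub.field_at] by blast

lemma phi_add:
  assumes "u \<in> tangent_space A p" "v \<in> tangent_space A p"
  shows "phi p (u + v) = phi p u + phi p v"
  by (rule push_inject[of _ p])
    (simp_all add: phi assms sub.tangent_intros pushforward_linear endomorphism_fieldD[OF \<phi>] push_at)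

lemma phi_scale:
  assumes "u \<in> tangent_space A p"
  shows "phi p (a *\<^sub>T u) = a *\<^sub>T phi p u"
  by (rule push_inject[of _ p])
    (simp_all add: phi assms sub.tangent_intros pushforward_linear endomorphism_fieldD[OF \<phi>] push_at)

lemma phi_reeb: "phi p (reeb p) = 0"
  by (rule push_inject[of _ p])
    (simp_all add: phi sub.field_at[OF reeb_field] sub.tangent_intros pushforward_linear push_reeb \<phi>\<xi>)

lemma D_reeb:
  assumes X: "X \<in> sub.\<X>"
  shows "D X (push reeb) p = pushforward B \<iota> (- phi p (X p))"
proof -
  obtain X' where X': "X' \<in> vector_fields B" "X' (\<iota> p) = pushforward B \<iota> (X p)" by (rule extend_push[OF X])
  show ?thesis
    unfolding push_reeb D_restriction[OF X X'(1) \<xi> X'(2)] nablabar_\<xi>[OF X'(1)] X'(2)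
      pushforward_linear phi(2)[OF sub.field_at[OF X]] ..
qed

text \<open>The ambient derivative of \<open>\<xi>\<close> in a tangent direction is minus its image
  under \<open>\<phi>\<close>, tangent by invariance; so \<open>h X reeb\<close> is tangent as well
  as normal.\<close>

lemma h_reeb:
  assumes X: "X \<in> sub.\<X>"
  shows "h X reeb = 0"
proof
  fix p
  have "h X reeb p = pushforward B \<iota> (- phi p (X p) - nabla X reeb p)"
    unfolding h_apply D_reeb[OF X] pushforward_linear ..
  then have "h X reeb p \<in> tangent_image A B \<iota> p"
    using tangent_imageI sub.tangent_intros phi(1) sub.field_at X reeb_field sub.nabla_closed by metis
  then show "h X reeb p = 0 p" using h_tangential_zero[OF X reeb_field] by simp
qed

lemma h_reeb_left: "X \<in> sub.\<X> \<Longrightarrow> h reeb X = 0"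
  using h_sym[OF reeb_field] h_reeb by simp

lemma nabla_reeb:
  assumes X: "X \<in> sub.\<X>"
  shows "nabla X reeb p = - phi p (X p)"
proof (rule push_inject[of _ p])
  show "nabla X reeb p \<in> tangent_space A p" "- phi p (X p) \<in> tangent_space A p"
    by (intro sub.field_at sub.nabla_closed X reeb_field sub.tangent_intros phi)+
  show "pushforward B \<iota> (nabla X reeb p) = pushforward B \<iota> (- phi p (X p))"
    using h_apply[of X reeb p] unfolding h_reeb[OF X] D_reeb[OF X] by simp
qed

text \<open>In the direction of \<open>reeb\<close> the second fundamental form vanishes, so
  \<open>nabla reeb\<close> pushed forward is \<open>D reeb\<close>, and the parallelism of the
  ambient \<open>\<phi>\<close> transfers.\<close>

lemma nabla_phi:
  assumes X: "X \<in> sub.\<X>"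
  shows "nabla reeb (\<lambda>q. phi q (X q)) p = phi p (nabla reeb X p)"
proof (rule push_inject[of _ p])
  show "nabla reeb (\<lambda>q. phi q (X q)) p \<in> tangent_space A p" "phi p (nabla reeb X p) \<in> tangent_space A p"
    by (intro sub.field_at sub.nabla_closed X reeb_field phi phi_field)+
  have h: "pushforward B \<iota> (nabla reeb Y p) = D reeb (push Y) p" if "Y \<in> sub.\<X>" for Y
    using h_apply[of reeb Y p] unfolding h_reeb_left[OF that] by simp
  show "pushforward B \<iota> (nabla reeb (\<lambda>q. phi q (X q)) p) = pushforward B \<iota> (phi p (nabla reeb X p))"
    unfolding h[OF phi_field[OF X]] phi(2)[OF sub.field_at[OF sub.nabla_closed[OF reeb_field X]]] h[OF X] push_phi[OF X]
    by (rule D_endomorphism[where \<phi> = \<phi> and X = reeb and V = "push X" and X' = \<xi> and p = p])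
      (fact \<phi> reeb_field pushforward_\<Gamma>[OF X] \<xi> push_reeb[symmetric] nablabar_\<phi>)+
qed

text \<open>The computation made for the ambient manifold, now applied intrinsically with the
  constant factor 1, whose derivative drops out.\<close>

lemma curvature_reeb_sub:
  assumes X: "X \<in> sub.\<X>"
  shows "curvature nabla X reeb reeb p = - phi p (phi p (X p))"
proof -
  have "reeb p (\<lambda>_. 1) = 0" by (rule tangent_vector_derivation(4)[OF manifold_A sub.field_at[OF reeb_field]])
  moreover have "curvature nabla X reeb reeb p = reeb p (\<lambda>_. 1) *\<^sub>T phi p (X p) - 1\<^sup>2 *\<^sub>T phi p (phi p (X p))"
  proof (rule sub.curvature_reeb[where c = "\<lambda>_. 1" and \<phi> = phi and \<xi> = reeb and X = X and p = p])
    show "nabla Y reeb q = - (1 *\<^sub>T phi q (Y q))" if "Y \<in> sub.\<X>" for Y q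
      unfolding nabla_reeb[OF that] by (simp add: tscale_def)
    show "nabla reeb (\<lambda>q. phi q (X q)) q = phi q (nabla reeb X q)" for q by (rule nabla_phi[OF X])
  qed (fact X reeb_field smooth_functions_const phi_field phi_add phi_scale phi_reeb)+
  ultimately show ?thesis by (simp add: fun_eq_iff)
qed

text \<open>Evaluating the definite description requires uniqueness: a candidate \<open>u\<close> is
  normal while \<open>- u\<close> is tangent, hence it is orthogonal to itself. This single value
  carries the argument, since only the zero section gets differentiated in the normal
  bundle.\<close>

lemma normal_part_zero: "normal_part A B \<iota> g p 0 = 0"
  unfolding normal_part_def
proof (rule the_equality, intro conjI ballI)
  show "0 \<in> tangent_space B (\<iota> p)" by (rule tangent_space_zero[OF manifold_B])
  show "0 - 0 \<in> tangent_image A B \<iota> p"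
    using tangent_imageI[OF tangent_space_zero[OF manifold_A], of p] by (simp add: pushforward_linear)
  show "g (\<iota> p) 0 t = 0" if "t \<in> tangent_image A B \<iota> p" for t
    using that push_at amb.g_zero_left unfolding tangent_image_def by blast
next
  fix u assume u: "u \<in> tangent_space B (\<iota> p) \<and> 0 - u \<in> tangent_image A B \<iota> p \<and>
    (\<forall>t\<in>tangent_image A B \<iota> p. g (\<iota> p) u t = 0)"
  then have "g (\<iota> p) u (0 - u) = 0" by blast
  then have "g (\<iota> p) (- u) u = 0"
    using u amb.g_sym[of u "\<iota> p" "- u"] tangent_space_minus[OF manifold_B] by simp
  then have "g (\<iota> p) u u = 0" using u amb.g_minus_left by simp
  then show "u = 0" using u amb.g_pos[of u "\<iota> p"] by force
qed

section \<open>The covariant derivative of \<open>h\<close> and 2-semiparallelity\<close>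

abbreviation "nabla_perp \<equiv> normal_connection A B \<iota> g D"
abbreviation "nabla_h \<equiv> covariant_derivative_sff nabla_perp nabla h"

lemma nabla_perp_zero: "X \<in> sub.\<X> \<Longrightarrow> nabla_perp X 0 = 0"
  unfolding normal_connection_def by (intro ext) (simp add: D_zero_right normal_part_zero)

lemma curvature_perp_zero:
  assumes "X \<in> sub.\<X>" "Y \<in> sub.\<X>"
  shows "curvature nabla_perp X Y 0 = 0"
  unfolding curvature_def using assms by (simp add: nabla_perp_zero sub.bracket_closed)

text \<open>Since \<open>h\<close> vanishes on \<open>reeb\<close>, the only surviving term is minus
  \<open>h\<close> of \<open>V\<close> and \<open>nabla Z reeb\<close>, and the latter is minus
  \<open>phi\<close> of \<open>Z\<close>.\<close>

lemma nabla_h_reeb: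
  assumes Z: "Z \<in> sub.\<X>" and V: "V \<in> sub.\<X>"
  shows "nabla_h Z V reeb = h V (\<lambda>p. phi p (Z p))" "nabla_h Z reeb V = h V (\<lambda>p. phi p (Z p))"
proof -
  \<comment> \<open>Written as a difference so that \<open>h_diff_left\<close> supplies the sign
    rule for \<open>h\<close>.\<close>
  have e: "nabla Z reeb = 0 - (\<lambda>p. phi p (Z p))" using nabla_reeb[OF Z] by (intro ext) simp
  note z = sub.field_zero phi_field[OF Z]
  have l: "h (nabla Z reeb) V = - h (\<lambda>p. phi p (Z p)) V"
    unfolding e h_diff_left[OF z V] using h_diff_left[OF sub.field_zero sub.field_zero V] by simp
  then have r: "h V (nabla Z reeb) = - h V (\<lambda>p. phi p (Z p))"
    using h_sym[OF V sub.nabla_closed[OF Z reeb_field]] h_sym[OF V phi_field[OF Z]] by simp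
  show "nabla_h Z V reeb = h V (\<lambda>p. phi p (Z p))"
    unfolding covariant_derivative_sff_def h_reeb[OF V] h_reeb[OF sub.nabla_closed[OF Z V]] r nabla_perp_zero[OF Z] by simp
  show "nabla_h Z reeb V = h V (\<lambda>p. phi p (Z p))"
    unfolding covariant_derivative_sff_def h_reeb_left[OF V] h_reeb_left[OF sub.nabla_closed[OF Z V]] l nabla_perp_zero[OF Z]
      h_sym[OF V phi_field[OF Z]] by simp
qed

lemma totally_geodesic_imp_two_semiparallel:
  assumes "totally_geodesic A h"
    and C: "\<And>X Y Z. X \<in> sub.\<X> \<Longrightarrow> Y \<in> sub.\<X> \<Longrightarrow> Z \<in> sub.\<X> \<Longrightarrow> C X Y Z \<in> sub.\<X>"
  shows "two_semiparallel A C nabla_perp nabla_h"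
proof -
  have "h X Y = 0" if "X \<in> sub.\<X>" "Y \<in> sub.\<X>" for X Y
    using assms(1) that unfolding totally_geodesic_def by blast
  then have "nabla_h Z U W = 0" if "Z \<in> sub.\<X>" "U \<in> sub.\<X>" "W \<in> sub.\<X>" for Z U W
    using that unfolding covariant_derivative_sff_def by (simp add: nabla_perp_zero sub.nabla_closed)
  then show ?thesis unfolding two_semiparallel_def by (simp add: C curvature_perp_zero)
qed

text \<open>Evaluating the condition at \<open>(X, \<xi>)\<close> and \<open>(Z, \<xi>, \<xi>)\<close> leaves only \<open>2 h (C(X, \<xi>)\<xi>) (\<phi>Z)\<close>.\<close>

lemma two_semiparallel_reeb:
  assumes semi: "two_semiparallel A C nabla_perp nabla_h"
    and C: "\<And>X Y Z. X \<in> sub.\<X> \<Longrightarrow> Y \<in> sub.\<X> \<Longrightarrow> Z \<in> sub.\<X> \<Longrightarrow> C X Y Z \<in> sub.\<X>"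
    and X: "X \<in> sub.\<X>" and Z: "Z \<in> sub.\<X>"
  shows "h (C X reeb reeb) (\<lambda>p. phi p (Z p)) = 0"
proof -
  \<comment> \<open>With \<open>reeb\<close> in both last places the tensor is zero, which removes
    the normal curvature term and the term containing \<open>C X reeb Z\<close>.\<close>
  have z: "nabla_h Y reeb reeb = 0" if "Y \<in> sub.\<X>" for Y
    unfolding nabla_h_reeb(1)[OF that reeb_field] by (rule h_reeb_left[OF phi_field[OF that]])
  have "curvature nabla_perp X reeb (nabla_h Z reeb reeb) - nabla_h (C X reeb Z) reeb reeb -
    nabla_h Z (C X reeb reeb) reeb - nabla_h Z reeb (C X reeb reeb) = 0"
    using semi X Z reeb_field unfolding two_semiparallel_def by blast
  then have *: "h (C X reeb reeb) (\<lambda>p. phi p (Z p)) + h (C X reeb reeb) (\<lambda>p. phi p (Z p)) = 0"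
    unfolding z[OF Z] z[OF C[OF X reeb_field Z]] curvature_perp_zero[OF X reeb_field]
      nabla_h_reeb[OF Z C[OF X reeb_field reeb_field]]
    by (simp add: fun_eq_iff)
  then show ?thesis by (simp add: fun_eq_iff)
qed

end

theorem theorem3p3:
  fixes B :: "('a::{t2_space, second_countable_topology}, 'e::euclidean_space) atlas"
    and \<phi> :: "'a \<Rightarrow> 'a tvec \<Rightarrow> 'a tvec"
    and \<xi> :: "'a field"
    and \<eta> :: "'a \<Rightarrow> 'a tvec \<Rightarrow> real"
    and g :: "'a metric"
    and nablabar :: "'a field \<Rightarrow> 'a field \<Rightarrow> 'a field"
    and f\<^sub>1 f\<^sub>2 f\<^sub>3 :: "'a \<Rightarrow> real"
    and n :: nat
    and A :: "('b::{t2_space, second_countable_topology}, 'k::euclidean_space) atlas"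
    and \<iota> :: "'b \<Rightarrow> 'a"
    and nabla :: "'b field \<Rightarrow> 'b field \<Rightarrow> 'b field"
    and D :: "'b field \<Rightarrow> ('b \<Rightarrow> 'a tvec) \<Rightarrow> ('b \<Rightarrow> 'a tvec)"
    and r :: "'b \<Rightarrow> real"
  assumes "generalized_sasakian_space_form n B \<phi> \<xi> \<eta> g nablabar f\<^sub>1 f\<^sub>2 f\<^sub>3"
    and "structure_equations B \<phi> \<xi> \<eta> g nablabar f\<^sub>1 f\<^sub>3"
    and "invariant_submanifold A B \<iota> \<phi> \<xi>"
    and "levi_civita A (induced_metric B \<iota> g) nabla"
    and "pullback_connection A B \<iota> nablabar D"
    and "r = scalar_curvature A (induced_metric B \<iota> g) nabla"
    and "\<And>p. f\<^sub>1 (\<iota> p) \<noteq> f\<^sub>3 (\<iota> p)"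
    and "\<And>p. r p \<noteq> 2 * real n * (2 * real n + 1) * (f\<^sub>1 (\<iota> p) - f\<^sub>3 (\<iota> p))"
  shows "totally_geodesic A (second_fundamental_form B \<iota> nabla D) \<longleftrightarrow>
         concircularly_two_semiparallel n A B \<iota> g nabla D"
proof -
  have acm: "almost_contact_metric B \<phi> \<xi> \<eta> g" and n: "n > 1" and lc: "levi_civita B g nablabar" "smooth_manifold B"
    using assms(1) unfolding generalized_sasakian_space_form_def by blast+
  have c: "f\<^sub>1 (\<iota> p) - f\<^sub>3 (\<iota> p) = 1" for p
    using space_form_factor[OF assms(1,2), of "\<iota> p"] assms(7)[of p] by simp
  have \<xi>: "\<xi> \<in> vector_fields B" using acm unfolding almost_contact_metric_def by blast
  have \<xi>1: "\<phi> q (\<xi> q) = 0" "\<eta> q (\<xi> q) = 1" for q using acm unfolding almost_contact_metric_def by blast+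
  have ac: "\<phi> q (\<phi> q u) = \<eta> q u *\<^sub>T \<xi> q - u" "g q u (\<xi> q) = \<eta> q u"
    if "u \<in> tangent_space B q" for q u v
    using acm that unfolding almost_contact_metric_def by blast+
  have inv: "immersed_submanifold A B \<iota>" "\<xi> (\<iota> p) \<in> tangent_image A B \<iota> p"
    "v \<in> tangent_image A B \<iota> p \<Longrightarrow> \<phi> (\<iota> p) v \<in> tangent_image A B \<iota> p" for p v
    using assms(3) unfolding invariant_submanifold_def by blast+
  interpret immersion A B \<iota> g nablabar D nabla
    using inv(1) lc acm assms(4,5) unfolding immersed_submanifold_def almost_contact_metric_def
    by unfold_locales blast+
  have \<xi>_sym: "g q (\<xi> q) (X q) = \<eta> q (X q)" if X: "X \<in> vector_fields B" for q X
    using amb.g_sym[OF amb.field_at[OF \<xi>] amb.field_at[OF X]] ac(2)[OF amb.field_at[OF X]] by simp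
  interpret reeb_immersion A B \<iota> g nablabar D nabla \<phi> \<xi>
  proof unfold_locales
    show "endomorphism_field B \<phi>" by (rule almost_contact_endomorphism[OF acm])
    fix X p assume X: "X \<in> vector_fields B"
    have "nablabar X \<xi> (\<iota> p) = - ((f\<^sub>1 (\<iota> p) - f\<^sub>3 (\<iota> p)) *\<^sub>T \<phi> (\<iota> p) (X (\<iota> p)))"
      using assms(2) X unfolding structure_equations_def by blast
    then show "nablabar X \<xi> (\<iota> p) = - \<phi> (\<iota> p) (X (\<iota> p))"
      unfolding c by (simp add: tscale_def)
    have "nablabar \<xi> (\<lambda>q. \<phi> q (X q)) (\<iota> p) - \<phi> (\<iota> p) (nablabar \<xi> X (\<iota> p)) =
        (f\<^sub>1 (\<iota> p) - f\<^sub>3 (\<iota> p)) *\<^sub>T (g (\<iota> p) (\<xi> (\<iota> p)) (X (\<iota> p)) *\<^sub>T \<xi> (\<iota> p) - \<eta> (\<iota> p) (X (\<iota> p)) *\<^sub>T \<xi> (\<iota> p))"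
      using assms(2) X \<xi> unfolding structure_equations_def by blast
    then show "nablabar \<xi> (\<lambda>q. \<phi> q (X q)) (\<iota> p) = \<phi> (\<iota> p) (nablabar \<xi> X (\<iota> p))"
      unfolding \<xi>_sym[OF X] by (simp add: fun_eq_iff)
  qed (use \<xi> \<xi>1 inv in auto)
  let ?C = "concircular_curvature n A (induced_metric B \<iota> g) nabla"
  have C: "?C X Y Z \<in> sub.\<X>" if "X \<in> sub.\<X>" "Y \<in> sub.\<X>" "Z \<in> sub.\<X>" for X Y Z
    by (rule sub.concircular_curvature_closed[OF that])
  define k where "k = (\<lambda>p. 1 - r p / (2 * real n * (2 * real n + 1)))"
  have k_smooth: "k \<in> sub.\<F>"
    using smooth_functions_diff[OF manifold_A smooth_functions_const[of 1] smooth_functions_mult[OF manifold_A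
          smooth_functions_const[of "1 / (2 * real n * (2 * real n + 1))"] sub.scalar_curvature_smooth]]
    unfolding k_def assms(6) by simp
  \<comment> \<open>As the difference of the two functions is 1 along the submanifold, the excluded
    value of \<open>r\<close> is exactly the zero of \<open>k\<close>.\<close>
  have k: "k p \<noteq> 0" for p
    using assms(8)[of p] n unfolding c k_def by (auto simp: field_simps)
  define eta where "eta X p = \<eta> (\<iota> p) (push X p)" for X p
  have eta_smooth: "eta X \<in> sub.\<F>" if X: "X \<in> sub.\<X>" for X
    using g_along_smooth[OF pushforward_\<Gamma>[OF X] restriction_\<Gamma>[OF \<xi>]]
      ac(2)[OF push_at[OF sub.field_at[OF X]]] unfolding eta_def by simp
  have phi_phi: "phi p (phi p (X p)) = eta X p *\<^sub>T reeb p - X p" if X: "X \<in> sub.\<X>" for X p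
  proof (rule push_inject[of _ p])
    note t = sub.field_at[OF X, of p] sub.field_at[OF reeb_field, of p]
    show "phi p (phi p (X p)) \<in> tangent_space A p" "eta X p *\<^sub>T reeb p - X p \<in> tangent_space A p"
      by (intro phi sub.tangent_intros t)+
    show "pushforward B \<iota> (phi p (phi p (X p))) = pushforward B \<iota> (eta X p *\<^sub>T reeb p - X p)"
      unfolding phi(2)[OF phi(1)[OF t(1)]] phi(2)[OF t(1)] ac(1)[OF push_at[OF t(1)]] pushforward_linear push_reeb eta_def ..
  qed
  \<comment> \<open>Both the curvature and the metric part of the concircular tensor are multiples
    of the same projection of \<open>X\<close> off \<open>reeb\<close>; \<open>k\<close> is the
    difference of their coefficients.\<close>
  have C_reeb: "?C X reeb reeb = k *\<^sub>F (X - eta X *\<^sub>F reeb)" if X: "X \<in> sub.\<X>" for X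
  proof
    fix p
    have "induced_metric B \<iota> g p (reeb p) (reeb p) = 1"
      unfolding induced_metric_def push_reeb ac(2)[OF amb.field_at[OF \<xi>]] \<xi>1 ..
    moreover have "induced_metric B \<iota> g p (X p) (reeb p) = eta X p"
      unfolding induced_metric_def push_reeb ac(2)[OF push_at[OF sub.field_at[OF X]]] eta_def ..
    ultimately show "?C X reeb reeb p = (k *\<^sub>F (X - eta X *\<^sub>F reeb)) p"
      unfolding concircular_curvature_def minus_apply[of _ _ p] curvature_reeb_sub[OF X] phi_phi[OF X]
      by (intro ext) (simp add: k_def assms(6) algebra_simps)
  qed
  show ?thesis
  proof
    assume "totally_geodesic A h"
    then show "concircularly_two_semiparallel n A B \<iota> g nabla D"
      unfolding concircularly_two_semiparallel_def using C by (rule totally_geodesic_imp_two_semiparallel)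
  next
    assume semi: "concircularly_two_semiparallel n A B \<iota> g nabla D"
    have h_phi: "h X (\<lambda>p. phi p (Z p)) = 0" if X: "X \<in> sub.\<X>" and Z: "Z \<in> sub.\<X>" for X Z
    proof -
      note e = sub.field_scale[OF eta_smooth[OF X] reeb_field]
      have "h (k *\<^sub>F (X - eta X *\<^sub>F reeb)) (\<lambda>p. phi p (Z p)) = 0"
        using two_semiparallel_reeb[OF semi[unfolded concircularly_two_semiparallel_def] C X Z]
        unfolding C_reeb[OF X] .
      \<comment> \<open>The projection costs nothing, because \<open>h\<close> vanishes on
        \<open>reeb\<close>; the nowhere zero factor \<open>k\<close> is then divided out
        pointwise.\<close>
      then have "k *\<^sub>F (h X (\<lambda>p. phi p (Z p)) - eta X *\<^sub>F 0) = 0"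
        unfolding h_scale_left[OF sub.field_diff[OF X e] phi_field[OF Z] k_smooth] h_diff_left[OF X e phi_field[OF Z]]
          h_scale_left[OF reeb_field phi_field[OF Z] eta_smooth[OF X]] h_reeb_left[OF phi_field[OF Z]] .
      then show ?thesis using k by (simp add: fun_eq_iff)
    qed
    \<comment> \<open>Apply \<open>h_phi\<close> with \<open>phi\<close> of \<open>Y\<close> in
      place of \<open>Z\<close>: applying \<open>phi\<close> twice gives \<open>- Y\<close> up to a
      multiple of \<open>reeb\<close>, which \<open>h\<close> kills.\<close>
    have "h X Y = 0" if X: "X \<in> sub.\<X>" and Y: "Y \<in> sub.\<X>" for X Y
    proof -
      note e = sub.field_scale[OF eta_smooth[OF Y] reeb_field]
      have "(\<lambda>p. phi p (phi p (Y p))) = eta Y *\<^sub>F reeb - Y"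
        using phi_phi[OF Y] by (intro ext) simp
      then have "h X (eta Y *\<^sub>F reeb - Y) = 0" using h_phi[OF X phi_field[OF Y]] by simp
      then have "h (eta Y *\<^sub>F reeb - Y) X = 0" using h_sym[OF X sub.field_diff[OF e Y]] by simp
      then have "eta Y *\<^sub>F 0 - h Y X = 0"
        unfolding h_diff_left[OF e Y X] h_scale_left[OF reeb_field X eta_smooth[OF Y]] h_reeb_left[OF X] .
      then show ?thesis using h_sym[OF X Y] by (simp add: fun_eq_iff)
    qed
    then show "totally_geodesic A h" by (simp add: totally_geodesic_def)
  qed
qed

end
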